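(* Let $H\in(1/2,1)$, let $(B^H_t)_{t\ge0}$ be a fractional Brownian motion with Hurst parameter $H$, and let $y_0>0$ be a constant. Let $f:[0,\infty)\times(0,\infty)\to[0,\infty)$ be a nonnegative continuous function, differentiable in its second variable $x$, such that: (a) there exists $x_1>0$ such that $f(t,x)\ge g(t)$ for all $t>0$ and $x\in(0,x_1)$, where $g$ is a continuous function such that $g(t)>0$ if $t>0$; (b) $f(t,x)\ge x\,\partial_xf(t,x)$ for all $t>0$ and $x>0$; (c) $f(t,x)\le h(t)(x+1)$ for all $t\ge0$ and $x>0$, where $h$ is a nonnegative locally bounded function. Then there exists a unique positive solution $Y=(Y_t,t\ge0)$ to the stochastic differential equation $$Y_t=y_0+\int_0^tf(s,Y_s)\,ds+\int_0^t\sqrt{Y_s}\,dB^H_s,\qquad t\ge0,$$ and $Y_t$ has finite moments of all (positive) orders for every $t\ge0$.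
   Context: A fractional Brownian motion with Hurst parameter $H$ is a mean zero Gaussian process $(B^H_t)_{t\ge0}$ with continuous paths and covariance $\mathbb{E}(B^H_tB^H_s)=\frac12\left(t^{2H}+s^{2H}-|t-s|^{2H}\right)$. The integral with respect to $B^H$ is the pathwise Young (Riemann–Stieltjes) integral. A positive solution is a process, strictly positive for all $t\ge0$, whose paths are Hölder continuous on compact intervals of every order $\beta<H$ (so that the Young integral is well defined) and which satisfies the equation almost surely; uniqueness is pathwise. *)

theory Defs
  imports "HOL-Probability.Probability"
begin

text \<open>Gaussian laws may be degenerate: almost surely constant variables are included.\<close>

definition gaussian_rv :: "'a measure \<Rightarrow> ('a \<Rightarrow> real) \<Rightarrow> bool" where
  "gaussian_rv M X \<longleftrightarrow>
     X \<in> borel_measurable M \<and>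
     (\<exists>m. (AE \<omega> in M. X \<omega> = m) \<or>
          (\<exists>\<sigma>>0. distributed M lborel X (\<lambda>x. ennreal (normal_density m \<sigma> x))))"

definition gaussian_process :: "'a measure \<Rightarrow> real set \<Rightarrow> (real \<Rightarrow> 'a \<Rightarrow> real) \<Rightarrow> bool" where
  "gaussian_process M T X \<longleftrightarrow>
     (\<forall>I c. finite I \<longrightarrow> I \<subseteq> T \<longrightarrow> gaussian_rv M (\<lambda>\<omega>. \<Sum>t\<in>I. c t * X t \<omega>))"

definition fractional_brownian_motion ::
  "'a measure \<Rightarrow> real \<Rightarrow> (real \<Rightarrow> 'a \<Rightarrow> real) \<Rightarrow> bool" where
  "fractional_brownian_motion M H B \<longleftrightarrow>
     gaussian_process M {0..} B \<and>
     (\<forall>t\<ge>0. (\<integral>\<omega>. B t \<omega> \<partial>M) = 0) \<and>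
     (\<forall>t\<ge>0. \<forall>s\<ge>0. (\<integral>\<omega>. B t \<omega> * B s \<omega> \<partial>M)
        = (t powr (2 * H) + s powr (2 * H) - \<bar>t - s\<bar> powr (2 * H)) / 2) \<and>
     (\<forall>\<omega>\<in>space M. continuous_on {0..} (\<lambda>t. B t \<omega>))"

text \<open>
  Riemann--Stieltjes integral \<open>\<integral> u dv\<close> over \<open>{a..b}\<close>, as the limit of the tagged
  Riemann--Stieltjes sums as the mesh tends to zero.  (A uniform mesh bound is used,
  not a gauge, so this is not the Henstock--Stieltjes integral.)
\<close>

definition has_RS_integral ::
  "(real \<Rightarrow> real) \<Rightarrow> (real \<Rightarrow> real) \<Rightarrow> real \<Rightarrow> real \<Rightarrow> real \<Rightarrow> bool" where
  "has_RS_integral u v a b I \<longleftrightarrow>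
     (\<forall>\<epsilon>>0. \<exists>\<delta>>0. \<forall>p. p tagged_division_of {a..b} \<longrightarrow>
        (\<forall>(x, k)\<in>p. Sup k - Inf k < \<delta>) \<longrightarrow>
        \<bar>(\<Sum>(x, k)\<in>p. u x * (v (Sup k) - v (Inf k))) - I\<bar> < \<epsilon>)"

definition holder_on :: "real \<Rightarrow> real set \<Rightarrow> (real \<Rightarrow> real) \<Rightarrow> bool" where
  "holder_on \<beta> S u \<longleftrightarrow> (\<exists>C. \<forall>s\<in>S. \<forall>t\<in>S. \<bar>u t - u s\<bar> \<le> C * \<bar>t - s\<bar> powr \<beta>)"

definition positive_solution ::
  "'a measure \<Rightarrow> real \<Rightarrow> (real \<Rightarrow> 'a \<Rightarrow> real) \<Rightarrow> (real \<Rightarrow> real \<Rightarrow> real) \<Rightarrow> real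
     \<Rightarrow> (real \<Rightarrow> 'a \<Rightarrow> real) \<Rightarrow> bool" where
  "positive_solution M H B f y0 Y \<longleftrightarrow>
     (\<forall>t\<ge>0. Y t \<in> borel_measurable M) \<and>
     (\<forall>\<omega>\<in>space M. \<forall>t\<ge>0. 0 < Y t \<omega>) \<and>
     (\<forall>\<omega>\<in>space M. \<forall>T\<ge>0. \<forall>\<beta>. 0 < \<beta> \<and> \<beta> < H \<longrightarrow> holder_on \<beta> {0..T} (\<lambda>t. Y t \<omega>)) \<and>
     (AE \<omega> in M. \<forall>t\<ge>0. \<exists>D I.
        ((\<lambda>s. f s (Y s \<omega>)) has_integral D) {0..t} \<and>
        has_RS_integral (\<lambda>s. sqrt (Y s \<omega>)) (\<lambda>s. B s \<omega>) 0 t I \<and>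
        Y t \<omega> = y0 + D + I)"

end

theory Submission
  imports Defs
begin

text \<open>
  For \<open>X = sqrt Y\<close> the equation has additive noise: \<open>X = sqrt y0 + \<integral> F(s, X) ds + B/2\<close> with
  \<open>F(t, x) = f(t, x\<^sup>2)/(2x)\<close>.  Condition (b) says that \<open>f(t, x)/x\<close> is nonincreasing in \<open>x\<close>, so \<open>F\<close> is
  one-sided Lipschitz away from \<open>x = 0\<close>; this gives pathwise uniqueness, and makes the solutions of
  the equation with delayed argument \<open>X' = F(t, X(t - d)) + B'/2\<close> Cauchy as \<open>d\<close> tends to \<open>0\<close>, so
  that the solution is a measurable function of the noise.  Since \<open>F\<close> is at least
  \<open>g/(2x)\<close> near \<open>0\<close> and \<open>B\<close> is Hoelder of an order \<open>\<beta> > 1/2\<close>, the solution stays above a positive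
  path-dependent level, so truncating \<open>F\<close> near \<open>0\<close> and \<open>\<infinity>\<close> changes nothing.  The linear growth of
  \<open>f\<close> bounds \<open>X\<close> by a multiple of \<open>1 + sup |B|\<close>, whose moments come from dyadic chaining.
  The two forms of the equation are equivalent by the Young-Loeve estimate.
\<close>

section \<open>Differential inequalities\<close>

text \<open>Young integrals obey the ordinary chain rule, so the square root makes the noise
  coefficient the constant 1/2 and no second-order term appears; the price is the factor 1/x in the
  drift. The exponent 1/2 is the threshold of the fight at 0: over a time r the noise moves the path
  by at most \<epsilon> = C r^\<beta>, while at that height the drift pushes it by about
  r/\<epsilon>, which wins for small r when 2\<beta> > 1. The same inequality controls the errors of
  Riemann sums. Measurability shapes the construction. Compactness would give solutions path by path
  but no measurable choice among approximations, and the hypotheses give no two-sided Lipschitz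
  bound for Picard iteration. With a delayed argument each approximant is a finite number of
  explicit integrations of the noise. The level below which truncation is harmless depends on the
  path, so the truncation levels are the deterministic 1/(n+1), and the solution is the limit along
  them, eventually constant for each path on each bounded time interval. Moments need a Hoelder
  constant with finite moments, not merely an almost surely finite one.\<close>

lemma barrier:
  fixes \<phi> :: "real \<Rightarrow> real"
  assumes "a \<le> b" "continuous_on {a..b} \<phi>" "\<phi> a \<le> A"
    and der: "\<And>t. a < t \<Longrightarrow> t < b \<Longrightarrow> A < \<phi> t \<Longrightarrow> \<exists>d\<le>0. (\<phi> has_real_derivative d) (at t)"
  shows "\<phi> b \<le> A"
proof (rule ccontr)
  assume "\<not> \<phi> b \<le> A"
  \<comment> \<open>The last element of \<open>S\<close> is the last time at or below the level;
    after it the derivative hypothesis holds throughout, so \<open>\<phi>\<close> cannot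
    rise.\<close>
  define S where "S = {t \<in> {a..b}. \<phi> t \<le> A}"
  have "compact S"
    using continuous_on_closed_Collect_le[OF assms(2) continuous_on_const closed_atLeastAtMost, of A]
    by (auto simp: S_def compact_eq_bounded_closed intro: bounded_subset[OF bounded_closed_interval[of a b]])
  moreover have "a \<in> S" using assms(1,3) by (simp add: S_def)
  then have "S \<noteq> {}" by blast
  ultimately obtain s where s: "s \<in> S" "\<And>t. t \<in> S \<Longrightarrow> t \<le> s"
    using compact_attains_sup[of S] by metis
  have "s < b" using s(1) \<open>\<not> \<phi> b \<le> A\<close> by (auto simp: S_def less_le)
  have "\<phi> b \<le> \<phi> s"
  proof (rule DERIV_nonpos_imp_decreasing_open[of s b \<phi>])
    show "s \<le> b" using \<open>s < b\<close> by simp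
    show "continuous_on {s..b} \<phi>" using s(1) assms(2) by (auto simp: S_def intro: continuous_on_subset)
    fix x assume "s < x" "x < b"
    then have "x \<notin> S" using s(2) by fastforce
    then have "A < \<phi> x" "a < x" using \<open>s < x\<close> \<open>x < b\<close> s(1) by (auto simp: S_def)
    then show "\<exists>y. (\<phi> has_real_derivative y) (at x) \<and> y \<le> 0" using der \<open>x < b\<close> by blast
  qed
  then show False using s(1) \<open>\<not> \<phi> b \<le> A\<close> by (auto simp: S_def)
qed

text \<open>With the integrating factor, \<open>(\<phi> s + e / L) * exp (- L * s)\<close> has
  nonpositive derivative wherever the inequality holds. It is demanded only above \<open>A\<close>
  because both uses have it only there: for an ordered pair of solutions (\<open>A = 0\<close>) and
  for a large solution.\<close>

lemma one_sided_gronwall: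
  fixes \<phi> :: "real \<Rightarrow> real"
  assumes "0 \<le> t" and cont: "continuous_on {0..t} \<phi>" and "\<phi> 0 \<le> A" "0 \<le> A" "0 < L" "0 \<le> e"
    and der: "\<And>s. 0 < s \<Longrightarrow> s < t \<Longrightarrow> A < \<phi> s \<Longrightarrow>
      \<exists>d \<le> L * \<phi> s + e. (\<phi> has_real_derivative d) (at s)"
  shows "\<phi> t \<le> (A + e / L) * exp (L * t) - e / L"
proof -
  define \<psi> where "\<psi> = (\<lambda>s. (\<phi> s + e / L) * exp (- L * s))"
  have "\<psi> t \<le> A + e / L"
  proof (rule barrier[of 0 t])
    show "continuous_on {0..t} \<psi>" unfolding \<psi>_def by (intro continuous_intros cont)
    fix s assume s: "0 < s" "s < t" "A + e / L < \<psi> s"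
    \<comment> \<open>As \<open>exp (L * s) \<ge> 1\<close> and \<open>A + e / L \<ge> 0\<close>,
      exceeding the constant level for \<open>\<psi>\<close> forces
      \<open>A < \<phi> s\<close>.\<close>
    have "A + e / L \<le> (A + e / L) * exp (L * s)"
      using mult_left_mono[of 1 "exp (L * s)" "A + e / L"] assms(4-6) s(1) by simp
    also have "\<dots> < \<psi> s * exp (L * s)" using s(3) by (intro mult_strict_right_mono) auto
    also have "\<dots> = \<phi> s + e / L" by (simp add: \<psi>_def mult.assoc flip: exp_add)
    finally have "A < \<phi> s" by simp
    then obtain d where d: "d \<le> L * \<phi> s + e" "(\<phi> has_real_derivative d) (at s)"
      using der s(1,2) by blast
    have "(\<psi> has_real_derivative (d - L * \<phi> s - e) * exp (- L * s)) (at s)"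
      unfolding \<psi>_def using assms(5)
      by (auto intro!: derivative_eq_intros d(2) simp: field_simps)
    moreover have "(d - L * \<phi> s - e) * exp (- L * s) \<le> 0"
      using d(1) by (intro mult_nonpos_nonneg) auto
    ultimately show "\<exists>d\<le>0. (\<psi> has_real_derivative d) (at s)" by blast
  qed (use assms in \<open>auto simp: \<psi>_def\<close>)
  then have "\<psi> t * exp (L * t) \<le> (A + e / L) * exp (L * t)" by (intro mult_right_mono) auto
  moreover have "\<psi> t * exp (L * t) = \<phi> t + e / L"
    by (simp add: \<psi>_def mult.assoc flip: exp_add)
  ultimately show ?thesis by simp
qed

lemma indefinite_integral_derivative:
  fixes u :: "real \<Rightarrow> real"
  assumes "continuous_on {0..T} u" "0 < t" "t < T"
  shows "((\<lambda>s. integral {0..s} u) has_real_derivative u t) (at t)"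
proof -
  have "((\<lambda>s. integral {0..s} u) has_real_derivative u t) (at t within {0..T})"
    using assms by (intro integral_has_real_derivative) auto
  moreover have "at t within {0..T} = at t"
    by (rule at_within_interior) (use assms in \<open>simp\<close>)
  ultimately show ?thesis by simp
qed

text \<open>\<open>X\<close> and \<open>Z\<close> need not be differentiable, but the common noise
  \<open>b\<close> cancels in their difference, which is a difference of two indefinite integrals.
  The slack \<open>e\<close> will absorb the error caused by the delay.\<close>

lemma one_sided_comparison:
  fixes u v X Z :: "real \<Rightarrow> real"
  assumes u: "continuous_on {0..t} u" and v: "continuous_on {0..t} v" and "0 \<le> t"
    and X: "\<And>s. s \<in> {0..t} \<Longrightarrow> X s = x0 + integral {0..s} u + b s"
    and Z: "\<And>s. s \<in> {0..t} \<Longrightarrow> Z s = x0 + integral {0..s} v + b s"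
    and "0 < L" "0 \<le> e"
    and le: "\<And>s. s \<in> {0..t} \<Longrightarrow> Z s < X s \<Longrightarrow> u s - v s \<le> L * (X s - Z s) + e"
  shows "X t - Z t \<le> e / L * (exp (L * t) - 1)"
proof -
  define \<phi> where "\<phi> = (\<lambda>s. integral {0..s} u - integral {0..s} v)"
  have eq: "\<phi> s = X s - Z s" if "s \<in> {0..t}" for s
    unfolding \<phi>_def using X[OF that] Z[OF that] by simp
  have "\<phi> t \<le> (0 + e / L) * exp (L * t) - e / L"
  proof (rule one_sided_gronwall)
    show "continuous_on {0..t} \<phi>" unfolding \<phi>_def
      by (intro continuous_intros indefinite_integral_continuous_1 integrable_continuous_interval u v)
    fix s assume s: "0 < s" "s < t" "0 < \<phi> s"
    have "(\<phi> has_real_derivative u s - v s) (at s)"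
      unfolding \<phi>_def by (intro derivative_intros indefinite_integral_derivative[OF u] indefinite_integral_derivative[OF v] s)
    moreover have "u s - v s \<le> L * \<phi> s + e" using le[of s] eq[of s] s by auto
    ultimately show "\<exists>d\<le>L * \<phi> s + e. (\<phi> has_real_derivative d) (at s)" by blast
  qed (use assms in \<open>auto simp: \<phi>_def\<close>)
  then show ?thesis using eq[of t] \<open>0 \<le> t\<close> by (simp add: algebra_simps)
qed

section \<open>Riemann--Stieltjes sums and the Young--Loeve estimate\<close>

definition rs_sum :: "(real \<Rightarrow> real) \<Rightarrow> (real \<Rightarrow> real) \<Rightarrow> (real \<times> real set) set \<Rightarrow> real" where
  "rs_sum u v p = (\<Sum>(x, k)\<in>p. u x * (v (Sup k) - v (Inf k)))"

lemma has_RS_integralD: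
  assumes "has_RS_integral u v a b I" "0 < \<epsilon>"
  obtains \<delta> where "0 < \<delta>" "\<And>p. p tagged_division_of {a..b} \<Longrightarrow>
    (\<And>x k. (x, k) \<in> p \<Longrightarrow> Sup k - Inf k < \<delta>) \<Longrightarrow> \<bar>rs_sum u v p - I\<bar> < \<epsilon>"
proof -
  obtain \<delta> where "0 < \<delta>" and \<delta>: "\<forall>p. p tagged_division_of {a..b} \<longrightarrow>
        (\<forall>(x, k)\<in>p. Sup k - Inf k < \<delta>) \<longrightarrow>
        \<bar>(\<Sum>(x, k)\<in>p. u x * (v (Sup k) - v (Inf k))) - I\<bar> < \<epsilon>"
    using assms unfolding has_RS_integral_def by blast
  have "\<bar>rs_sum u v p - I\<bar> < \<epsilon>" if "p tagged_division_of {a..b}"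
    "\<And>x k. (x, k) \<in> p \<Longrightarrow> Sup k - Inf k < \<delta>" for p
    using \<delta>[rule_format, OF that(1)] that(2) unfolding rs_sum_def by blast
  then show ?thesis using that \<open>0 < \<delta>\<close> by blast
qed

lemma tagged_division_real_piece:
  assumes "p tagged_division_of {a..b::real}" "(x, k) \<in> p"
  obtains c d where "k = {c..d}" "a \<le> c" "c \<le> x" "x \<le> d" "d \<le> b" "Inf k = c" "Sup k = d"
proof -
  obtain c d where k: "k = {c..d}" using tagged_division_ofD(4)[OF assms] by (auto simp: box_real)
  have "x \<in> k" "k \<subseteq> {a..b}" using tagged_division_ofD(2,3)[OF assms] by auto
  then show ?thesis using k that[of c d] by (auto simp: subset_eq)
qed

lemma mesh_fine_division_exists:
  fixes a b :: real
  assumes "0 < \<delta>"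
  obtains p where "p tagged_division_of {a..b}" "\<And>x k. (x, k) \<in> p \<Longrightarrow> Sup k - Inf k < \<delta>"
proof -
  obtain p where p: "p tagged_division_of {a..b}" "(\<lambda>x. ball x (\<delta> / 2)) fine p"
    using fine_division_exists_real[OF gauge_ball[of "\<delta> / 2"]] assms by (metis half_gt_zero)
  have "Sup k - Inf k < \<delta>" if xk: "(x, k) \<in> p" for x k
  proof -
    obtain c d where k: "k = {c..d}" "c \<le> x" "x \<le> d" "Inf k = c" "Sup k = d"
      using tagged_division_real_piece[OF p(1) xk] by metis
    have "k \<subseteq> ball x (\<delta> / 2)" using p(2) xk by (auto simp: fine_def)
    moreover have "c \<in> k" "d \<in> k" using k(1-3) by auto
    ultimately have "c \<in> ball x (\<delta> / 2)" "d \<in> ball x (\<delta> / 2)" by blast+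
    then show ?thesis unfolding k(4,5) mem_ball dist_real_def by linarith
  qed
  then show ?thesis using that p(1) by blast
qed

text \<open>Errors of order \<open>(d - c) powr \<gamma>\<close> with \<open>\<gamma> > 1\<close>
  add up to at most \<open>C * (b - a)\<close> times a positive power of the mesh, while the
  increments of \<open>J\<close> telescope. Existence and value of the integral come together,
  without a Cauchy argument for Riemann sums.\<close>

lemma has_RS_integral_of_germ:
  assumes "a \<le> b" "1 < \<gamma>" "0 \<le> C"
    and germ: "\<And>\<xi> c d. a \<le> c \<Longrightarrow> c \<le> \<xi> \<Longrightarrow> \<xi> \<le> d \<Longrightarrow> d \<le> b \<Longrightarrow>
      \<bar>u \<xi> * (v d - v c) - (J d - J c)\<bar> \<le> C * (d - c) powr \<gamma>"
  shows "has_RS_integral u v a b (J b - J a)"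
  unfolding has_RS_integral_def
proof (intro allI impI)
  fix \<epsilon> :: real assume "0 < \<epsilon>"
  \<comment> \<open>\<open>q\<close> is the admissible error rate and \<open>\<delta>\<close> the
    mesh with \<open>\<delta> powr (\<gamma> - 1) = q\<close>; the \<open>+ 1\<close> keeps the
    denominator positive and the final estimate strict.\<close>
  define q where "q = \<epsilon> / (C * (b - a) + 1)"
  have den: "0 < C * (b - a) + 1" using assms by (simp add: add_nonneg_pos)
  then have "0 < q" using \<open>0 < \<epsilon>\<close> by (simp add: q_def)
  define \<delta> where "\<delta> = q powr (1 / (\<gamma> - 1))"
  have "0 < \<delta>" using \<open>0 < q\<close> by (simp add: \<delta>_def)
  have \<delta>: "\<delta> powr (\<gamma> - 1) = q" using \<open>0 < q\<close> assms(2) by (simp add: \<delta>_def powr_powr)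
  have "\<bar>(\<Sum>(x, k)\<in>p. u x * (v (Sup k) - v (Inf k))) - (J b - J a)\<bar> < \<epsilon>"
    if p: "p tagged_division_of {a..b}" and fine: "\<forall>(x, k)\<in>p. Sup k - Inf k < \<delta>" for p
  proof -
    have piece: "\<bar>u x * (v (Sup k) - v (Inf k)) - (J (Sup k) - J (Inf k))\<bar> \<le> C * q * (Sup k - Inf k)"
      if xk: "(x, k) \<in> p" for x k
    proof -
      obtain c d where k: "a \<le> c" "c \<le> x" "x \<le> d" "d \<le> b" "Inf k = c" "Sup k = d"
        using tagged_division_real_piece[OF p xk] by metis
      have "(d - c) powr \<gamma> = (d - c) powr (\<gamma> - 1) * (d - c)"
        using k by (cases "c = d") (auto simp: powr_diff)
      also have "\<dots> \<le> q * (d - c)"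
        unfolding \<delta>[symmetric] using fine xk k assms(2)
        by (intro mult_right_mono powr_mono2) auto
      finally have "C * (d - c) powr \<gamma> \<le> C * (q * (d - c))" using assms(3) by (rule mult_left_mono)
      then show ?thesis using germ[OF k(1-4)] k by (simp add: mult.assoc)
    qed
    have "(\<Sum>(x, k)\<in>p. u x * (v (Sup k) - v (Inf k))) - (J b - J a)
        = (\<Sum>(x, k)\<in>p. u x * (v (Sup k) - v (Inf k)) - (J (Sup k) - J (Inf k)))"
      using additive_tagged_division_1[OF assms(1) p, of J]
      by (simp add: split_def sum_subtractf)
    also have "\<bar>\<dots>\<bar> \<le> (\<Sum>(x, k)\<in>p. C * q * (Sup k - Inf k))"
      by (rule order_trans[OF sum_abs]) (auto intro!: sum_mono piece)
    also have "\<dots> = C * q * (b - a)"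
      using additive_tagged_division_1[OF assms(1) p, of "\<lambda>x. C * q * x"]
      by (simp add: right_diff_distrib)
    also have "\<dots> < q * (C * (b - a) + 1)" using \<open>0 < q\<close> by (simp add: algebra_simps)
    also have "\<dots> = \<epsilon>" using den by (simp add: q_def)
    finally show ?thesis .
  qed
  then show "\<exists>\<delta>>0. \<forall>p. p tagged_division_of {a..b} \<longrightarrow> (\<forall>(x, k)\<in>p. Sup k - Inf k < \<delta>) \<longrightarrow>
        \<bar>(\<Sum>(x, k)\<in>p. u x * (v (Sup k) - v (Inf k))) - (J b - J a)\<bar> < \<epsilon>"
    using \<open>0 < \<delta>\<close> by blast
qed

text \<open>With integrand and integrator 0, the germ estimate makes \<open>J b - J a\<close> a
  Riemann-Stieltjes integral all of whose sums vanish.\<close>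

lemma constant_of_powr_increments:
  assumes "a \<le> b" "1 < \<gamma>" "0 \<le> C"
    and "\<And>c d. a \<le> c \<Longrightarrow> c \<le> d \<Longrightarrow> d \<le> b \<Longrightarrow> \<bar>J d - J c\<bar> \<le> C * (d - c) powr \<gamma>"
  shows "J b = (J a :: real)"
proof (rule ccontr)
  assume "J b \<noteq> J a"
  have "has_RS_integral (\<lambda>_. 0) (\<lambda>_. 0) a b (J b - J a)"
    by (rule has_RS_integral_of_germ[OF assms(1-3)]) (use assms(4) in \<open>auto simp: abs_minus_commute\<close>)
  then obtain \<delta> where "0 < \<delta>" and \<delta>: "\<And>p. p tagged_division_of {a..b} \<Longrightarrow>
    (\<And>x k. (x, k) \<in> p \<Longrightarrow> Sup k - Inf k < \<delta>) \<Longrightarrow>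
    \<bar>rs_sum (\<lambda>_. 0) (\<lambda>_. 0) p - (J b - J a)\<bar> < \<bar>J b - J a\<bar>"
    using has_RS_integralD[of _ _ _ _ _ "\<bar>J b - J a\<bar>"] \<open>J b \<noteq> J a\<close>
    by (metis zero_less_abs_iff right_minus_eq)
  obtain p where p: "p tagged_division_of {a..b}" "\<And>x k. (x, k) \<in> p \<Longrightarrow> Sup k - Inf k < \<delta>"
    using mesh_fine_division_exists[OF \<open>0 < \<delta>\<close>] by blast
  have "\<bar>rs_sum (\<lambda>_. 0) (\<lambda>_. 0) p - (J b - J a)\<bar> < \<bar>J b - J a\<bar>"
    by (rule \<delta>) (use p in auto)
  then show False by (simp add: rs_sum_def)
qed

lemma rs_sum_Un:
  assumes p1: "p1 tagged_division_of {a..c}" and p2: "p2 tagged_division_of {c..b}"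
    and "a \<le> c" "c \<le> b"
  shows "(p1 \<union> p2) tagged_division_of {a..b}"
    and "rs_sum u v (p1 \<union> p2) = rs_sum u v p1 + rs_sum u v p2"
proof -
  have "{a..b} = {a..c} \<union> {c..b}" using assms(3,4) by auto
  then show "(p1 \<union> p2) tagged_division_of {a..b}"
    using tagged_division_Un[OF p1 p2] by (simp add: interior_atLeastAtMost_real)
  \<comment> \<open>The two divisions need not be disjoint as sets: a degenerate cell at
    \<open>c\<close> may belong to both. It contributes nothing, so the sums still add.\<close>
  have "Sup k = Inf k" if "(x, k) \<in> p1 \<inter> p2" for x k
    using tagged_division_real_piece[OF p1, of x k] tagged_division_real_piece[OF p2, of x k] that
    by (smt (verit) IntD1 IntD2)
  then have 0: "(\<Sum>(x, k)\<in>p1 \<inter> p2. u x * (v (Sup k) - v (Inf k))) = 0"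
    by (intro sum.neutral) auto
  show "rs_sum u v (p1 \<union> p2) = rs_sum u v p1 + rs_sum u v p2"
    using sum.union_inter[OF tagged_division_ofD(1)[OF p1] tagged_division_ofD(1)[OF p2],
        of "\<lambda>(x, k). u x * (v (Sup k) - v (Inf k))"] 0
    by (simp add: rs_sum_def)
qed

text \<open>Tags sit at left ends, so halving \<open>{c..d}\<close> at \<open>m\<close> changes the
  sum by the single product \<open>(u m - u c) * (v d - v m)\<close>. The constant is the fixed
  point of \<open>A = A * 2 powr (1 - \<gamma>) + C\<close>: the two halves reproduce the bound with
  a factor below 1, and the midpoint adds \<open>C\<close>.\<close>

lemma rs_sum_bisection:
  assumes "1 < \<gamma>" "0 \<le> C"
    and inc: "\<And>r s t. a \<le> r \<Longrightarrow> r \<le> s \<Longrightarrow> s \<le> t \<Longrightarrow> t \<le> b \<Longrightarrow>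
      \<bar>(u s - u r) * (v t - v s)\<bar> \<le> C * (t - r) powr \<gamma>"
    and "a \<le> c" "c \<le> d" "d \<le> b"
  shows "\<exists>p. p tagged_division_of {c..d} \<and> (\<forall>x k. (x, k) \<in> p \<longrightarrow> Sup k - Inf k \<le> (d - c) / 2 ^ n) \<and>
    \<bar>rs_sum u v p - u c * (v d - v c)\<bar> \<le> C / (1 - 2 powr (1 - \<gamma>)) * (d - c) powr \<gamma>"
  using assms(4-6)
proof (induction n arbitrary: c d)
  case 0
  have "2 powr (1 - \<gamma>) < 2 powr 0" using assms(1) by (intro powr_less_mono) auto
  then show ?case using 0 assms(2) tagged_division_of_self_real[of c d c]
    by (intro exI[of _ "{(c, {c..d})}"]) (auto simp: rs_sum_def tagged_division_of_self_real)
next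
  case (Suc n)
  define A where "A = C / (1 - 2 powr (1 - \<gamma>))"
  have "2 powr (1 - \<gamma>) < 2 powr 0" using assms(1) by (intro powr_less_mono) auto
  then have "1 - 2 powr (1 - \<gamma>) \<noteq> 0" using assms(1) by simp
  then have "A * (1 - 2 powr (1 - \<gamma>)) = C" by (simp add: A_def)
  then have A: "A * 2 powr (1 - \<gamma>) + C = A" by (simp add: algebra_simps)
  define m where "m = (c + d) / 2"
  have m: "c \<le> m" "m \<le> d" "m - c = (d - c) / 2" "d - m = (d - c) / 2"
    using Suc.prems by (auto simp: m_def field_simps)
  obtain p1 where p1: "p1 tagged_division_of {c..m}"
    "\<And>x k. (x, k) \<in> p1 \<Longrightarrow> Sup k - Inf k \<le> (m - c) / 2 ^ n"
    "\<bar>rs_sum u v p1 - u c * (v m - v c)\<bar> \<le> A * (m - c) powr \<gamma>"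
    using Suc.IH[of c m] Suc.prems m unfolding A_def by auto
  obtain p2 where p2: "p2 tagged_division_of {m..d}"
    "\<And>x k. (x, k) \<in> p2 \<Longrightarrow> Sup k - Inf k \<le> (d - m) / 2 ^ n"
    "\<bar>rs_sum u v p2 - u m * (v d - v m)\<bar> \<le> A * (d - m) powr \<gamma>"
    using Suc.IH[of m d] Suc.prems m unfolding A_def by auto
  note Un = rs_sum_Un[OF p1(1) p2(1) m(1,2)]
  have "rs_sum u v (p1 \<union> p2) - u c * (v d - v c) = (rs_sum u v p1 - u c * (v m - v c))
      + (rs_sum u v p2 - u m * (v d - v m)) + (u m - u c) * (v d - v m)"
    unfolding Un(2) by (simp add: algebra_simps)
  also have "\<bar>\<dots>\<bar> \<le> A * (m - c) powr \<gamma> + A * (d - m) powr \<gamma> + C * (d - c) powr \<gamma>"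
    using p1(3) p2(3) inc[of c m d] Suc.prems m by linarith
  also have "\<dots> = (A * 2 powr (1 - \<gamma>) + C) * (d - c) powr \<gamma>"
    using Suc.prems unfolding m by (simp add: powr_divide powr_diff algebra_simps)
  finally have "\<bar>rs_sum u v (p1 \<union> p2) - u c * (v d - v c)\<bar> \<le> A * (d - c) powr \<gamma>" unfolding A .
  moreover have "Sup k - Inf k \<le> (d - c) / 2 ^ Suc n" if "(x, k) \<in> p1 \<union> p2" for x k
    using that p1(2)[of x k] p2(2)[of x k] unfolding m by auto
  ultimately show ?case using Un(1) unfolding A_def by blast
qed

text \<open>No integral over \<open>{s..t}\<close> is assumed to exist. A fine division of
  \<open>{0..s}\<close> joined with repeated bisections of \<open>{s..t}\<close> is a fine division
  of \<open>{0..t}\<close>; its whole sum is near \<open>J\<close>, its first part near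
  \<open>I\<close>, and its second part obeys the bisection bound.\<close>

lemma young_loeve:
  assumes "1 < \<gamma>" "0 \<le> C"
    and inc: "\<And>r s t. 0 \<le> r \<Longrightarrow> r \<le> s \<Longrightarrow> s \<le> t \<Longrightarrow> t \<le> T \<Longrightarrow>
      \<bar>(u s - u r) * (v t - v s)\<bar> \<le> C * (t - r) powr \<gamma>"
    and "0 \<le> s" "s \<le> t" "t \<le> T"
    and I: "has_RS_integral u v 0 s I" and J: "has_RS_integral u v 0 t J"
  shows "\<bar>J - I - u s * (v t - v s)\<bar> \<le> C / (1 - 2 powr (1 - \<gamma>)) * (t - s) powr \<gamma>" (is "_ \<le> ?A")
proof (rule field_le_epsilon)
  fix e :: real assume "0 < e"
  then have "0 < e / 2" by simp
  obtain \<delta>1 where \<delta>1: "0 < \<delta>1" "\<And>p. p tagged_division_of {0..s} \<Longrightarrow>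
    (\<And>x k. (x, k) \<in> p \<Longrightarrow> Sup k - Inf k < \<delta>1) \<Longrightarrow> \<bar>rs_sum u v p - I\<bar> < e / 2"
    using has_RS_integralD[OF I \<open>0 < e / 2\<close>] by blast
  obtain \<delta>2 where \<delta>2: "0 < \<delta>2" "\<And>p. p tagged_division_of {0..t} \<Longrightarrow>
    (\<And>x k. (x, k) \<in> p \<Longrightarrow> Sup k - Inf k < \<delta>2) \<Longrightarrow> \<bar>rs_sum u v p - J\<bar> < e / 2"
    using has_RS_integralD[OF J \<open>0 < e / 2\<close>] by blast
  \<comment> \<open>The mesh is below both thresholds because \<open>p1\<close> serves twice: alone
    for \<open>I\<close>, and as a part of the division for \<open>J\<close>.\<close>
  obtain p1 where p1: "p1 tagged_division_of {0..s}"
    "\<And>x k. (x, k) \<in> p1 \<Longrightarrow> Sup k - Inf k < min \<delta>1 \<delta>2"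
    using mesh_fine_division_exists[of "min \<delta>1 \<delta>2"] \<delta>1(1) \<delta>2(1) by auto
  obtain n where "(t - s) / \<delta>2 < 2 ^ n" using real_arch_pow[of 2 "(t - s) / \<delta>2"] by auto
  then have n: "(t - s) / 2 ^ n < \<delta>2" using \<delta>2(1) by (simp add: field_simps)
  obtain p2 where p2: "p2 tagged_division_of {s..t}"
    "\<And>x k. (x, k) \<in> p2 \<Longrightarrow> Sup k - Inf k \<le> (t - s) / 2 ^ n"
    "\<bar>rs_sum u v p2 - u s * (v t - v s)\<bar> \<le> ?A"
    using rs_sum_bisection[of \<gamma> C 0 T u v s t n, OF assms(1,2) inc assms(4-6)] by auto
  note Un = rs_sum_Un[OF p1(1) p2(1) assms(4,5)]
  have "\<bar>rs_sum u v (p1 \<union> p2) - J\<bar> < e / 2"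
    using p1(2) p2(2) n by (intro \<delta>2(2) Un(1)) fastforce
  moreover have "\<bar>rs_sum u v p1 - I\<bar> < e / 2"
    using p1(2) by (intro \<delta>1(2) p1(1)) fastforce
  ultimately show "\<bar>J - I - u s * (v t - v s)\<bar> \<le> ?A + e"
    using p2(3) unfolding Un(2) by linarith
qed

section \<open>Dyadic chaining\<close>

text \<open>With \<open>q = 2 powr -\<beta>\<close>, the fraction is the geometric tail
  \<open>q + q^2 + ...\<close> of a chain of dyadic points running to a limit. It occurs once per
  endpoint, the \<open>1\<close> is the step between the two starting points, and
  \<open>2 powr \<beta>\<close> is the loss from rounding \<open>t - s\<close> to a power of
  1/2.\<close>

definition chain_const :: "real \<Rightarrow> real" where
  "chain_const \<beta> = (2 * (2 powr -\<beta> / (1 - 2 powr -\<beta>)) + 1) * 2 powr \<beta>"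

lemma dyadic_chaining:
  fixes \<phi> :: "real \<Rightarrow> real"
  assumes "0 < \<beta>" "0 \<le> A" and cont: "continuous_on {0..1} \<phi>"
    and inc: "\<And>n j. j < 2 ^ n \<Longrightarrow>
      \<bar>\<phi> (real (Suc j) / 2 ^ n) - \<phi> (real j / 2 ^ n)\<bar> \<le> A * (2 powr -\<beta>) ^ n"
    and "s \<in> {0..1}" "t \<in> {0..1}"
  shows "\<bar>\<phi> t - \<phi> s\<bar> \<le> A * chain_const \<beta> * \<bar>t - s\<bar> powr \<beta>"
proof -
  define q where "q = 2 powr -\<beta>"
  have q: "0 < q" "q < 1" using assms(1) powr_less_mono[of "-\<beta>" 0 2] by (auto simp: q_def)
  define c where "c = q / (1 - q)"
  have c: "c * (1 - q) = q" "0 \<le> c" using q by (auto simp: c_def)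
  \<comment> \<open>\<open>D n t\<close> will be the level-\<open>n\<close> dyadic point at or just
    left of \<open>t\<close>, and \<open>N n t\<close> its numerator; passing to the next level
    moves it by at most one cell of the finer grid.\<close>
  define N where "N = (\<lambda>n t. nat \<lfloor>t * 2 ^ n :: real\<rfloor>)"
  define D where "D = (\<lambda>n t. real (N n t) / 2 ^ n)"
  have N: "real (N n t) \<le> t * 2 ^ n" "t * 2 ^ n < real (N n t) + 1" if "0 \<le> t" for n t
    using that by (auto simp: N_def)
  have N_le: "N n t \<le> 2 ^ n" if "t \<in> {0..1}" for n t
  proof -
    have "real (N n t) \<le> t * 2 ^ n" using N that by auto
    also have "\<dots> \<le> 1 * 2 ^ n" using that by (intro mult_right_mono) auto
    finally have "real (N n t) \<le> real (2 ^ n)" by simp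
    then show ?thesis by (simp only: of_nat_le_iff)
  qed
  have adj: "\<bar>\<phi> (real i / 2 ^ n) - \<phi> (real j / 2 ^ n)\<bar> \<le> A * q ^ n"
    if "j \<le> i" "i \<le> j + 1" "i \<le> 2 ^ n" for i j n
  proof (cases "i = j")
    case True then show ?thesis using q assms(2) by simp
  next
    case False
    then have "i = Suc j" "j < 2 ^ n" using that by auto
    then show ?thesis using inc[of j n] by (simp add: q_def)
  qed
  have step: "\<bar>\<phi> (D (Suc n) t) - \<phi> (D n t)\<bar> \<le> A * q ^ Suc n" if t: "t \<in> {0..1}" for n t
  proof -
    have 1: "real (N n t) \<le> t * 2 ^ n" "t * 2 ^ n < real (N n t) + 1"
      "real (N (Suc n) t) \<le> 2 * (t * 2 ^ n)" "2 * (t * 2 ^ n) < real (N (Suc n) t) + 1"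
      using N[of t n] N[of t "Suc n"] t by (auto simp: mult.left_commute)
    then have "2 * N n t \<le> N (Suc n) t" "N (Suc n) t \<le> 2 * N n t + 1" by linarith+
    from adj[OF this N_le[OF t]] show ?thesis by (simp add: D_def)
  qed
  \<comment> \<open>The bound is kept as the telescoping difference
    \<open>q ^ n - q ^ (n + k)\<close>; the plain bound by \<open>q ^ n\<close> would not survive
    the induction.\<close>
  have tail: "\<bar>\<phi> (D (n + k) t) - \<phi> (D n t)\<bar> \<le> A * c * (q ^ n - q ^ (n + k))" if t: "t \<in> {0..1}" for n k t
  proof (induction k)
    case (Suc k)
    have "A * c * (q ^ (n + k) - q ^ Suc (n + k)) = A * (c * (1 - q)) * q ^ (n + k)"
      by (simp add: algebra_simps)
    also have "\<dots> = A * q ^ Suc (n + k)" unfolding c by simp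
    finally show ?case using Suc step[OF t, of "n + k"] by (simp add: right_diff_distrib)
  qed simp
  have lim: "(\<lambda>n. D n t) \<longlonglongrightarrow> t" if t: "t \<in> {0..1}" for t
  proof -
    have "\<bar>D n t - t\<bar> \<le> (1 / 2) ^ n" for n
    proof -
      have "D n t - t = (real (N n t) - t * 2 ^ n) / 2 ^ n" by (simp add: D_def field_simps)
      then show ?thesis using N[of t n] t by (simp add: power_divide divide_right_mono)
    qed
    then have "(\<lambda>n. D n t - t) \<longlonglongrightarrow> 0"
      by (intro Lim_null_comparison[OF _ LIMSEQ_power_zero[of "1 / 2 :: real"]]) auto
    then show ?thesis by (simp add: LIM_zero_iff)
  qed
  have D01: "D n t \<in> {0..1}" if "t \<in> {0..1}" for n t
  proof -
    have "real (N n t) \<le> real (2 ^ n)" using N_le[OF that] by (simp only: of_nat_le_iff)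
    then show ?thesis by (simp add: D_def)
  qed
  have approx: "\<bar>\<phi> t - \<phi> (D n t)\<bar> \<le> A * c * q ^ n" if t: "t \<in> {0..1}" for n t
  proof -
    have "(\<lambda>k. D (n + k) t) \<longlonglongrightarrow> t" using LIMSEQ_ignore_initial_segment[OF lim[OF t], of n] by (simp add: add.commute)
    then have "(\<lambda>k. \<phi> (D (n + k) t)) \<longlonglongrightarrow> \<phi> t"
      by (rule continuous_on_tendsto_compose[OF cont _ t]) (use D01[OF t] in auto)
    then have "(\<lambda>k. \<bar>\<phi> (D (n + k) t) - \<phi> (D n t)\<bar>) \<longlonglongrightarrow> \<bar>\<phi> t - \<phi> (D n t)\<bar>"
      by (intro tendsto_intros)
    moreover have "\<bar>\<phi> (D (n + k) t) - \<phi> (D n t)\<bar> \<le> A * c * q ^ n" for k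
      using tail[OF t, of n k] q c(2) assms(2)
        mult_left_mono[of "q ^ n - q ^ (n + k)" "q ^ n" "A * c"] by auto
    ultimately show ?thesis by (intro LIMSEQ_le_const2) auto
  qed
  have main: "\<bar>\<phi> t - \<phi> s\<bar> \<le> A * chain_const \<beta> * (t - s) powr \<beta>"
    if s: "s \<in> {0..1}" and t: "t \<in> {0..1}" and "s < t" for s t
  proof -
    \<comment> \<open>This selects the level with
      \<open>(1 / 2) ^ Suc n < t - s \<le> (1 / 2) ^ n\<close>: coarse enough that the dyadic points
      of \<open>s\<close> and \<open>t\<close> coincide or are neighbours, fine enough that
      \<open>q ^ n\<close> is comparable to \<open>(t - s) powr \<beta>\<close>.\<close>
    define P where "P = (\<lambda>m. (1 / 2 :: real) ^ m < t - s)"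
    have "\<exists>m. P m" unfolding P_def using \<open>s < t\<close> by (intro real_arch_pow_inv) auto
    then have "P (LEAST m. P m)" by (rule LeastI_ex)
    moreover have "\<not> P 0" using s t by (auto simp: P_def)
    ultimately obtain n where n: "Suc n = (LEAST m. P m)" by (metis not0_implies_Suc)
    have "P (Suc n)" "\<not> P n" using \<open>P (LEAST m. P m)\<close> n not_less_Least[of n P] by auto
    then have lo: "(1 / 2) ^ Suc n \<le> t - s" and hi: "t - s \<le> (1 / 2) ^ n" by (auto simp: P_def)
    have "(t - s) * 2 ^ n \<le> 1" using hi by (simp add: field_simps power_divide)
    then have d: "t * 2 ^ n \<le> s * 2 ^ n + 1" by (simp add: algebra_simps)
    have "s * 2 ^ n \<le> t * 2 ^ n" using \<open>s < t\<close> by simp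
    then have "N n s \<le> N n t" unfolding N_def by (intro nat_mono floor_mono)
    moreover have "N n t \<le> N n s + 1" using N[of s n] N[of t n] d s t by auto
    ultimately have "\<bar>\<phi> (D n t) - \<phi> (D n s)\<bar> \<le> A * q ^ n"
      unfolding D_def using adj N_le[OF t] by blast
    then have "\<bar>\<phi> t - \<phi> s\<bar> \<le> A * (2 * c + 1) * q ^ n"
      using approx[OF s, of n] approx[OF t, of n] by (simp add: algebra_simps)
    also have "q ^ n = 2 powr \<beta> * q ^ Suc n" by (simp add: q_def powr_minus)
    also have "q ^ Suc n = (2 powr - real (Suc n)) powr \<beta>"
      by (simp add: q_def powr_powr powr_power mult.commute del: power_Suc of_nat_Suc)
    also have "2 powr - real (Suc n) = (1 / 2) ^ Suc n"
      unfolding powr_minus powr_realpow[OF zero_less_numeral] by (simp add: power_divide inverse_eq_divide)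
    also have "A * (2 * c + 1) * (2 powr \<beta> * ((1 / 2) ^ Suc n) powr \<beta>)
        \<le> A * (2 * c + 1) * (2 powr \<beta> * (t - s) powr \<beta>)"
      using lo assms(1,2) c by (intro mult_left_mono powr_mono2) auto
    finally show ?thesis by (simp add: chain_const_def c_def q_def mult.assoc)
  qed
  consider "s < t" | "t < s" | "s = t" by linarith
  then show ?thesis
    using main[of s t] main[of t s] assms(5,6) by cases (auto simp: abs_minus_commute)
qed

lemma chain_const_pos: "0 < \<beta> \<Longrightarrow> 0 < chain_const \<beta>"
  using powr_less_mono[of "-\<beta>" 0 2]
  by (auto simp: chain_const_def intro!: mult_pos_pos add_nonneg_pos divide_nonneg_nonneg)

text \<open>\<open>K\<close> is, up to a constant, the sum over all levels of the normalised
  \<open>p\<close>-th powers of dyadic increments. Level \<open>n\<close> has \<open>2 ^ n\<close>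
  cells, each of mean at most of order \<open>2 powr (- n * H * p)\<close>, divided by
  \<open>2 powr (- n * \<beta> * p)\<close>; the ratio \<open>2 powr (1 - p * (H - \<beta>))\<close>
  is below 1 by hypothesis. An even \<open>p\<close> spares absolute values.\<close>

lemma kolmogorov_chentsov_bound:
  fixes X :: "real \<Rightarrow> 'a \<Rightarrow> real"
  assumes "0 < T" "0 < \<beta>" "even p" "1 < real p * (H - \<beta>)"
    and cont: "\<And>\<omega>. \<omega> \<in> space M \<Longrightarrow> continuous_on {0..T} (\<lambda>t. X t \<omega>)"
    and int: "\<And>s t. s \<in> {0..T} \<Longrightarrow> t \<in> {0..T} \<Longrightarrow> integrable M (\<lambda>\<omega>. (X t \<omega> - X s \<omega>) ^ p)"
    and mom: "\<And>s t. s \<in> {0..T} \<Longrightarrow> t \<in> {0..T} \<Longrightarrow>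
      (\<integral>\<omega>. (X t \<omega> - X s \<omega>) ^ p \<partial>M) \<le> c * \<bar>t - s\<bar> powr (H * real p)"
  obtains K where "integrable M K"
    "AE \<omega> in M. 0 \<le> K \<omega> \<and> (\<forall>s\<in>{0..T}. \<forall>t\<in>{0..T}. \<bar>X t \<omega> - X s \<omega>\<bar> ^ p \<le> K \<omega> * (\<bar>t - s\<bar> powr \<beta>) ^ p)"
proof -
  have "p \<noteq> 0" using assms(4) by (intro notI) simp
  define q where "q = 2 powr -\<beta>"
  have "0 < q" by (simp add: q_def)
  define D where "D = (\<lambda>n j \<omega>. (X (T * (real (Suc j) / 2 ^ n)) \<omega> - X (T * (real j / 2 ^ n)) \<omega>) ^ p)"
  define S where "S = (\<lambda>n \<omega>. (\<Sum>j<2 ^ n. D n j \<omega>) / (q ^ n) ^ p)"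
  have mem: "T * (real j / 2 ^ n) \<in> {0..T}" if "j \<le> 2 ^ n" for j n
  proof -
    have "real j \<le> real (2 ^ n)" using that by (simp only: of_nat_le_iff)
    then have "real j / 2 ^ n \<le> 1" by simp
    then show ?thesis using \<open>0 < T\<close> mult_left_mono[of "real j / 2 ^ n" 1 T] by auto
  qed
  have D_int: "integrable M (D n j)" if "j < 2 ^ n" for n j
    unfolding D_def using that by (intro int mem) auto
  have D0: "0 \<le> D n j \<omega>" for n j \<omega> unfolding D_def using \<open>even p\<close> by (rule zero_le_even_power)
  have S0: "0 \<le> S n \<omega>" for n \<omega> unfolding S_def using \<open>0 < q\<close> by (intro divide_nonneg_nonneg sum_nonneg D0) auto
  have S_int: "integrable M (S n)" for n unfolding S_def by (intro integrable_divide Bochner_Integration.integrable_sum D_int) auto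
  define \<rho> where "\<rho> = 2 powr (1 - real p * (H - \<beta>))"
  have \<rho>: "0 < \<rho>" "\<rho> < 1" using assms(4) powr_less_mono[of "1 - real p * (H - \<beta>)" 0 2] by (auto simp: \<rho>_def)
  have S_bound: "(\<integral>\<omega>. S n \<omega> \<partial>M) \<le> c * T powr (H * real p) * \<rho> ^ n" for n
  proof -
    have "(\<integral>\<omega>. S n \<omega> \<partial>M) = (\<Sum>j<2 ^ n. \<integral>\<omega>. D n j \<omega> \<partial>M) / (q ^ n) ^ p"
      unfolding S_def using D_int by (subst Bochner_Integration.integral_sum[symmetric]) auto
    also have "\<dots> \<le> (\<Sum>j<(2::nat) ^ n. c * (T / 2 ^ n) powr (H * real p)) / (q ^ n) ^ p"
    proof (intro divide_right_mono sum_mono)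
      fix j :: nat assume j: "j \<in> {..<2 ^ n}"
      have "(\<integral>\<omega>. D n j \<omega> \<partial>M) \<le> c * \<bar>T * (real (Suc j) / 2 ^ n) - T * (real j / 2 ^ n)\<bar> powr (H * real p)"
        unfolding D_def using j by (intro mom mem) auto
      also have "T * (real (Suc j) / 2 ^ n) - T * (real j / 2 ^ n) = T / 2 ^ n"
        by (simp add: field_simps)
      finally show "(\<integral>\<omega>. D n j \<omega> \<partial>M) \<le> c * (T / 2 ^ n) powr (H * real p)" using \<open>0 < T\<close> by simp
    qed (use \<open>0 < q\<close> in auto)
    also have "\<dots> = 2 ^ n * (c * (T / 2 ^ n) powr (H * real p)) / (q ^ n) ^ p" by simp
    also have "\<dots> = c * T powr (H * real p) * \<rho> ^ n"
    proof -
      have 1: "(2 :: real) ^ n = 2 powr real n" by (simp add: powr_realpow)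
      have 2: "(2 ^ n :: real) powr (H * real p) = 2 powr (real n * (H * real p))"
        unfolding 1 powr_powr ..
      have 3: "(q ^ n) ^ p = 2 powr (- \<beta> * real n * real p)"
        by (simp add: q_def powr_power mult.commute mult.left_commute)
      have 4: "2 powr real n / 2 powr (real n * (H * real p)) / 2 powr (- \<beta> * real n * real p) = \<rho> ^ n"
        unfolding \<rho>_def powr_diff[symmetric] by (simp add: powr_power algebra_simps)
      show ?thesis using \<open>0 < T\<close> unfolding 4[symmetric]
        by (simp add: powr_divide 2 3) (simp add: 1)
    qed
    finally show ?thesis .
  qed
  have summ: "summable (\<lambda>n. \<integral>\<omega>. S n \<omega> \<partial>M)"
  proof (rule summable_comparison_test')
    show "summable (\<lambda>n. c * T powr (H * real p) * \<rho> ^ n)"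
      using \<rho> by (intro summable_mult summable_geometric) auto
    show "norm (\<integral>\<omega>. S n \<omega> \<partial>M) \<le> c * T powr (H * real p) * \<rho> ^ n" for n
      using S_bound[of n] S0 by (simp add: integral_nonneg_AE)
  qed
  have "(\<integral>\<^sup>+\<omega>. (\<Sum>n. ennreal (S n \<omega>)) \<partial>M) = (\<Sum>n. \<integral>\<^sup>+\<omega>. ennreal (S n \<omega>) \<partial>M)"
    using borel_measurable_integrable[OF S_int] by (intro nn_integral_suminf) auto
  also have "\<dots> = (\<Sum>n. ennreal (\<integral>\<omega>. S n \<omega> \<partial>M))"
    using S0 by (subst nn_integral_eq_integral[OF S_int]) auto
  also have "\<dots> \<noteq> top" using summ S0
    by (subst suminf_ennreal2) (auto intro!: integral_nonneg_AE)
  finally have "AE \<omega> in M. (\<Sum>n. ennreal (S n \<omega>)) \<noteq> \<infinity>"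
    using borel_measurable_integrable[OF S_int] by (intro nn_integral_PInf_AE) auto
  then have AE_summ: "AE \<omega> in M. summable (\<lambda>n. S n \<omega>)"
    by eventually_elim (use S0 in \<open>auto intro!: summable_suminf_not_top\<close>)
  define K0 where "K0 = (\<lambda>\<omega>. \<Sum>n. S n \<omega>)"
  \<comment> \<open>Chaining takes place on \<open>{0..1}\<close>; the power of \<open>1 / T\<close>
    is the rescaling from \<open>{0..T}\<close>.\<close>
  define b where "b = (chain_const \<beta> * (1 / T) powr \<beta>) ^ p"
  show thesis
  proof (rule that[of "\<lambda>\<omega>. K0 \<omega> * b"])
    show "integrable M (\<lambda>\<omega>. K0 \<omega> * b)"
      unfolding K0_def using AE_summ summ S0 S_int
      by (intro integrable_mult_left integrable_suminf) auto
    show "AE \<omega> in M. 0 \<le> K0 \<omega> * b \<and> (\<forall>s\<in>{0..T}. \<forall>t\<in>{0..T}.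
      \<bar>X t \<omega> - X s \<omega>\<bar> ^ p \<le> K0 \<omega> * b * (\<bar>t - s\<bar> powr \<beta>) ^ p)"
      using AE_summ AE_space
    proof eventually_elim
      fix \<omega> assume su: "summable (\<lambda>n. S n \<omega>)" and \<omega>: "\<omega> \<in> space M"
      have K0: "0 \<le> K0 \<omega>" unfolding K0_def by (rule suminf_nonneg[OF su S0])
      \<comment> \<open>Every single normalised increment is a summand of
        \<open>K0 \<omega>\<close>, so the \<open>p\<close>-th root of \<open>K0 \<omega>\<close> is
        a chaining constant valid at all levels.\<close>
      define A where "A = root p (K0 \<omega>)"
      have A: "0 \<le> A" "A ^ p = K0 \<omega>" using K0 \<open>p \<noteq> 0\<close> by (auto simp: A_def)
      define \<phi> where "\<phi> = (\<lambda>u. X (T * u) \<omega>)"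
      have inc: "\<bar>\<phi> (real (Suc j) / 2 ^ n) - \<phi> (real j / 2 ^ n)\<bar> \<le> A * (2 powr -\<beta>) ^ n"
        if j: "j < 2 ^ n" for n j
      proof -
        have "D n j \<omega> \<le> (\<Sum>j<2 ^ n. D n j \<omega>)" using j D0 by (intro member_le_sum) auto
        then have "D n j \<omega> / (q ^ n) ^ p \<le> S n \<omega>" unfolding S_def using \<open>0 < q\<close> by (intro divide_right_mono) auto
        also have "\<dots> \<le> K0 \<omega>" unfolding K0_def
          using sum_le_suminf[OF su, of "{n}"] S0 by auto
        finally have "D n j \<omega> \<le> (A * q ^ n) ^ p" using \<open>0 < q\<close> A by (simp add: power_mult_distrib field_simps)
        then have "\<bar>\<phi> (real (Suc j) / 2 ^ n) - \<phi> (real j / 2 ^ n)\<bar> ^ p \<le> (A * q ^ n) ^ p"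
          using \<open>even p\<close> by (simp add: D_def \<phi>_def power_even_abs)
        then show ?thesis unfolding q_def[symmetric] 
          using \<open>p \<noteq> 0\<close> A \<open>0 < q\<close> by (simp add: power_mono_iff)
      qed
      have \<phi>_cont: "continuous_on {0..1} \<phi>"
        unfolding \<phi>_def using \<open>0 < T\<close>
        by (intro continuous_on_compose2[OF cont[OF \<omega>]] continuous_intros) (auto simp: mult_left_le)
      have "\<bar>X t \<omega> - X s \<omega>\<bar> ^ p \<le> K0 \<omega> * b * (\<bar>t - s\<bar> powr \<beta>) ^ p"
        if st: "s \<in> {0..T}" "t \<in> {0..T}" for s t
      proof -
        have "\<bar>\<phi> (t / T) - \<phi> (s / T)\<bar> \<le> A * chain_const \<beta> * \<bar>t / T - s / T\<bar> powr \<beta>"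
          by (rule dyadic_chaining[OF \<open>0 < \<beta>\<close> A(1) \<phi>_cont inc]) (use st \<open>0 < T\<close> in auto)
        also have "\<bar>t / T - s / T\<bar> = (1 / T) * \<bar>t - s\<bar>"
          using \<open>0 < T\<close> by (simp add: abs_div flip: diff_divide_distrib)
        finally have "\<bar>X t \<omega> - X s \<omega>\<bar> \<le> A * (chain_const \<beta> * (1 / T) powr \<beta>) * \<bar>t - s\<bar> powr \<beta>"
          using \<open>0 < T\<close> by (simp add: \<phi>_def powr_mult powr_divide mult_ac)
        then have "\<bar>X t \<omega> - X s \<omega>\<bar> ^ p \<le> (A * (chain_const \<beta> * (1 / T) powr \<beta>) * \<bar>t - s\<bar> powr \<beta>) ^ p"
          by (intro power_mono) auto
        then show ?thesis by (simp add: power_mult_distrib A b_def)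
      qed
      moreover have "0 \<le> K0 \<omega> * b" using K0 chain_const_pos[OF \<open>0 < \<beta>\<close>] by (auto simp: b_def intro!: mult_nonneg_nonneg zero_le_power)
      ultimately show "0 \<le> K0 \<omega> * b \<and> (\<forall>s\<in>{0..T}. \<forall>t\<in>{0..T}.
        \<bar>X t \<omega> - X s \<omega>\<bar> ^ p \<le> K0 \<omega> * b * (\<bar>t - s\<bar> powr \<beta>) ^ p)" by blast
    qed
  qed
qed

section \<open>Moments and Hoelder continuity of fractional Brownian motion\<close>

lemma holder_on_mono:
  assumes "holder_on \<beta> S u" "S' \<subseteq> S" shows "holder_on \<beta> S' u"
  using assms unfolding holder_on_def by (meson subsetD)

context prob_space
begin

lemma gaussian_rv_integrable: "gaussian_rv M X \<Longrightarrow> integrable M X"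
proof -
  assume "gaussian_rv M X"
  then obtain m where meas: "X \<in> borel_measurable M" and m: "(AE \<omega> in M. X \<omega> = m) \<or>
          (\<exists>\<sigma>>0. distributed M lborel X (\<lambda>x. ennreal (normal_density m \<sigma> x)))"
    by (auto simp: gaussian_rv_def)
  from m show ?thesis
  proof
    assume "AE \<omega> in M. X \<omega> = m"
    then show ?thesis using meas integrable_cong_AE[of X M "\<lambda>_. m"] by simp
  next
    assume "\<exists>\<sigma>>0. distributed M lborel X (\<lambda>x. ennreal (normal_density m \<sigma> x))"
    then obtain \<sigma> where "0 < \<sigma>" and D: "distributed M lborel X (\<lambda>x. ennreal (normal_density m \<sigma> x))" by blast
    show ?thesis
      by (rule distributed_integrable_var[OF D normal_density_nonneg integrable_normal_moment_nz_1[OF \<open>0 < \<sigma>\<close>]])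
  qed
qed

text \<open>The factor is the double factorial \<open>(2k - 1)!!\<close>. In the degenerate case
  mean zero forces \<open>X = 0\<close> almost surely; both sides then vanish except for
  \<open>k = 0\<close>, where \<open>0 ^ 0 = 1\<close>.\<close>

lemma gaussian_rv_even_moment:
  assumes "gaussian_rv M X" "expectation X = 0"
  shows "integrable M (\<lambda>\<omega>. X \<omega> ^ (2 * k))"
    and "expectation (\<lambda>\<omega>. X \<omega> ^ (2 * k)) = fact (2 * k) / (2 ^ k * fact k) * expectation (\<lambda>\<omega>. (X \<omega>)\<^sup>2) ^ k"
proof -
  obtain m where meas[measurable]: "X \<in> borel_measurable M" and m: "(AE \<omega> in M. X \<omega> = m) \<or>
          (\<exists>\<sigma>>0. distributed M lborel X (\<lambda>x. ennreal (normal_density m \<sigma> x)))"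
    using assms(1) by (auto simp: gaussian_rv_def)
  have "integrable M (\<lambda>\<omega>. X \<omega> ^ (2 * k)) \<and>
    expectation (\<lambda>\<omega>. X \<omega> ^ (2 * k)) = fact (2 * k) / (2 ^ k * fact k) * expectation (\<lambda>\<omega>. (X \<omega>)\<^sup>2) ^ k"
    using m
  proof
    assume AE: "AE \<omega> in M. X \<omega> = m"
    then have "expectation X = expectation (\<lambda>_. m)" by (intro integral_cong_AE) auto
    then have "m = 0" using assms(2) by (simp add: prob_space)
    have "AE \<omega> in M. X \<omega> ^ (2 * j) = 0 ^ (2 * j)" for j :: nat
      using AE unfolding \<open>m = 0\<close> by eventually_elim simp
    then have *: "integrable M (\<lambda>\<omega>. X \<omega> ^ (2 * j)) \<longleftrightarrow> integrable M (\<lambda>_. 0 ^ (2 * j) :: real)"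
      "expectation (\<lambda>\<omega>. X \<omega> ^ (2 * j)) = expectation (\<lambda>_. 0 ^ (2 * j))" for j :: nat
      by (intro integrable_cong_AE integral_cong_AE; simp)+
    show ?thesis using *[of k] *[of 1] by (cases k) (auto simp: prob_space)
  next
    assume "\<exists>\<sigma>>0. distributed M lborel X (\<lambda>x. ennreal (normal_density m \<sigma> x))"
    then obtain \<sigma> where \<sigma>: "0 < \<sigma>" and D: "distributed M lborel X (\<lambda>x. ennreal (normal_density m \<sigma> x))" by blast
    have m: "m = 0" using normal_distributed_expectation[OF \<sigma> D] assms(2) by simp
    have I: "integrable M (\<lambda>\<omega>. X \<omega> ^ (2 * j))" for j
      using distributed_integrable[OF D, of "\<lambda>x. x ^ (2 * j)"] integrable_normal_moment[OF \<sigma>, of m "2 * j"]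
      by (simp add: m)
    have E: "expectation (\<lambda>\<omega>. X \<omega> ^ (2 * j)) = fact (2 * j) / ((2 / \<sigma>\<^sup>2) ^ j * fact j)" for j
      using distributed_integral[OF D, of "\<lambda>x. x ^ (2 * j)"] integral_normal_moment_even[OF \<sigma>, of m j]
      by (simp add: m)
    have "expectation (\<lambda>\<omega>. (X \<omega>)\<^sup>2) = \<sigma>\<^sup>2" using E[of 1] \<sigma> by simp
    then show ?thesis using I E[of k] by (simp add: power_divide)
  qed
  then show "integrable M (\<lambda>\<omega>. X \<omega> ^ (2 * k))"
    and "expectation (\<lambda>\<omega>. X \<omega> ^ (2 * k)) = fact (2 * k) / (2 ^ k * fact k) * expectation (\<lambda>\<omega>. (X \<omega>)\<^sup>2) ^ k"
    by auto
qed

lemma fbm_gaussian: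
  assumes "fractional_brownian_motion M H B" "0 \<le> t"
  shows "gaussian_rv M (B t)" "expectation (B t) = 0"
proof -
  have "\<forall>I c. finite I \<longrightarrow> I \<subseteq> {0..} \<longrightarrow> gaussian_rv M (\<lambda>\<omega>. \<Sum>t\<in>I. c t * B t \<omega>)"
    using assms unfolding fractional_brownian_motion_def gaussian_process_def by (elim conjE)
  from this[rule_format, of "{t}" "\<lambda>_. 1"] show "gaussian_rv M (B t)" using assms(2) by simp
  show "expectation (B t) = 0" using assms unfolding fractional_brownian_motion_def by blast
qed

lemma fbm_integrable_mult:
  assumes "fractional_brownian_motion M H B" "0 \<le> t" "0 \<le> s"
  shows "integrable M (\<lambda>\<omega>. B t \<omega> * B s \<omega>)"
proof -
  note t = fbm_gaussian[OF assms(1,2)] and s = fbm_gaussian[OF assms(1,3)]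
  have [measurable]: "B t \<in> borel_measurable M" "B s \<in> borel_measurable M"
    using t(1) s(1) by (auto simp: gaussian_rv_def)
  show ?thesis
  proof (rule Bochner_Integration.integrable_bound)
    show "integrable M (\<lambda>\<omega>. (B t \<omega>)\<^sup>2 + (B s \<omega>)\<^sup>2)"
      using gaussian_rv_even_moment(1)[OF t, of 1] gaussian_rv_even_moment(1)[OF s, of 1] by simp
    have "\<bar>B t \<omega> * B s \<omega>\<bar> \<le> (B t \<omega>)\<^sup>2 + (B s \<omega>)\<^sup>2" for \<omega>
      using sum_squares_bound[of "\<bar>B t \<omega>\<bar>" "\<bar>B s \<omega>\<bar>"] abs_ge_zero[of "B t \<omega> * B s \<omega>"]
      unfolding power2_abs abs_mult mult.assoc by linarith
    then show "AE \<omega> in M. norm (B t \<omega> * B s \<omega>) \<le> norm ((B t \<omega>)\<^sup>2 + (B s \<omega>)\<^sup>2)" by simp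
  qed simp
qed

text \<open>The covariance gives the increment variance
  \<open>\<bar>t - s\<bar> powr (2 * H)\<close>. The condition \<open>0 < k\<close> matters at
  \<open>s = t\<close>: a zero base has \<open>powr\<close> equal to 0 even for exponent 0, whereas
  the zeroth moment is 1.\<close>

lemma fbm_increment_moment:
  assumes B: "fractional_brownian_motion M H B" and "0 \<le> t" "0 \<le> s" "0 < k"
  shows "integrable M (\<lambda>\<omega>. (B t \<omega> - B s \<omega>) ^ (2 * k))"
    and "expectation (\<lambda>\<omega>. (B t \<omega> - B s \<omega>) ^ (2 * k))
      = fact (2 * k) / (2 ^ k * fact k) * \<bar>t - s\<bar> powr (H * real (2 * k))"
proof -
  have "integrable M (\<lambda>\<omega>. (B t \<omega> - B s \<omega>) ^ (2 * k)) \<and> expectation (\<lambda>\<omega>. (B t \<omega> - B s \<omega>) ^ (2 * k))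
      = fact (2 * k) / (2 ^ k * fact k) * \<bar>t - s\<bar> powr (H * real (2 * k))"
  proof (cases "s = t")
    case True
    then show ?thesis using \<open>0 < k\<close> by simp
  next
    case False
    have "\<forall>I c. finite I \<longrightarrow> I \<subseteq> {0..} \<longrightarrow> gaussian_rv M (\<lambda>\<omega>. \<Sum>t\<in>I. c t * B t \<omega>)"
      using B unfolding fractional_brownian_motion_def gaussian_process_def by (elim conjE)
    \<comment> \<open>Here \<open>s \<noteq> t\<close> is essential: otherwise the index set
      collapses and the combination becomes \<open>- B s\<close>.\<close>
    from this[rule_format, of "{s, t}" "\<lambda>r. if r = s then -1 else 1"]
    have G: "gaussian_rv M (\<lambda>\<omega>. B t \<omega> - B s \<omega>)" using False assms(2,3) by simp
    note t = fbm_gaussian[OF B \<open>0 \<le> t\<close>] and s = fbm_gaussian[OF B \<open>0 \<le> s\<close>]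
    have E: "expectation (\<lambda>\<omega>. B t \<omega> - B s \<omega>) = 0"
      using t s by (simp add: gaussian_rv_integrable)
    have cov: "expectation (\<lambda>\<omega>. B t \<omega> * B s \<omega>)
        = (t powr (2 * H) + s powr (2 * H) - \<bar>t - s\<bar> powr (2 * H)) / 2" if "0 \<le> t" "0 \<le> s" for t s
      using B that unfolding fractional_brownian_motion_def by blast
    have "expectation (\<lambda>\<omega>. (B t \<omega> - B s \<omega>)\<^sup>2)
      = expectation (\<lambda>\<omega>. B t \<omega> * B t \<omega> - 2 * (B t \<omega> * B s \<omega>) + B s \<omega> * B s \<omega>)"
      by (simp add: power2_eq_square algebra_simps)
    also have "\<dots> = expectation (\<lambda>\<omega>. B t \<omega> * B t \<omega>) - 2 * expectation (\<lambda>\<omega>. B t \<omega> * B s \<omega>)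
        + expectation (\<lambda>\<omega>. B s \<omega> * B s \<omega>)"
      using fbm_integrable_mult[OF B] assms(2,3) by simp
    also have "\<dots> = \<bar>t - s\<bar> powr (2 * H)" using assms(2,3) by (simp add: cov diff_divide_distrib add_divide_distrib)
    finally have V: "expectation (\<lambda>\<omega>. (B t \<omega> - B s \<omega>)\<^sup>2) = \<bar>t - s\<bar> powr (2 * H)" .
    show ?thesis
      using gaussian_rv_even_moment[OF G E, of k] False
      by (simp add: V powr_power mult.commute mult.left_commute)
  qed
  then show "integrable M (\<lambda>\<omega>. (B t \<omega> - B s \<omega>) ^ (2 * k))"
    and "expectation (\<lambda>\<omega>. (B t \<omega> - B s \<omega>) ^ (2 * k))
      = fact (2 * k) / (2 ^ k * fact k) * \<bar>t - s\<bar> powr (H * real (2 * k))" by auto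
qed

text \<open>An even order above \<open>1 / (H - \<beta>)\<close> meets the chaining condition; the
  free lower bound \<open>m\<close> allows the order to be raised to whatever moment is wanted
  later.\<close>

lemma fbm_holder_bound:
  assumes B: "fractional_brownian_motion M H B" and "0 < T" "0 < \<beta>" "\<beta> < H"
  obtains p K where "m \<le> p" "0 < p" "integrable M K"
    "AE \<omega> in M. 0 \<le> K \<omega> \<and> (\<forall>s\<in>{0..T}. \<forall>t\<in>{0..T}. \<bar>B t \<omega> - B s \<omega>\<bar> ^ p \<le> K \<omega> * (\<bar>t - s\<bar> powr \<beta>) ^ p)"
proof -
  obtain k :: nat where k: "max (real m) (1 / (H - \<beta>)) < real k" using reals_Archimedean2 by blast
  have "0 < 1 / (H - \<beta>)" using assms by simp
  then have "0 < real k" using k by linarith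
  have "1 / (H - \<beta>) < real (2 * k)" using k \<open>0 < real k\<close> by simp
  then have "1 < real (2 * k) * (H - \<beta>)" using assms(4) by (simp add: field_simps)
  moreover have "continuous_on {0..T} (\<lambda>t. B t \<omega>)" if "\<omega> \<in> space M" for \<omega>
    using B that unfolding fractional_brownian_motion_def
    by (meson continuous_on_subset Icc_subset_Ici_iff order_refl)
  ultimately obtain K where "integrable M K" "AE \<omega> in M. 0 \<le> K \<omega> \<and>
    (\<forall>s\<in>{0..T}. \<forall>t\<in>{0..T}. \<bar>B t \<omega> - B s \<omega>\<bar> ^ (2 * k) \<le> K \<omega> * (\<bar>t - s\<bar> powr \<beta>) ^ (2 * k))"
    using kolmogorov_chentsov_bound[of T \<beta> "2 * k" H M B "fact (2 * k) / (2 ^ k * fact k)"]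
      assms fbm_increment_moment[OF B] \<open>0 < real k\<close> by (auto simp del: of_nat_mult)
  then show ?thesis using that[of "2 * k" K] k \<open>0 < real k\<close> by auto
qed

text \<open>The start at 0 is read off the covariance: the second moment at time 0 is
  \<open>0 powr (2 * H)\<close> up to cancelling terms, hence 0.\<close>

lemma fbm_start: "fractional_brownian_motion M H B \<Longrightarrow> AE \<omega> in M. B 0 \<omega> = 0"
proof -
  assume B: "fractional_brownian_motion M H B"
  then have "\<forall>t\<ge>0. \<forall>s\<ge>0. expectation (\<lambda>\<omega>. B t \<omega> * B s \<omega>)
      = (t powr (2 * H) + s powr (2 * H) - \<bar>t - s\<bar> powr (2 * H)) / 2"
    unfolding fractional_brownian_motion_def by blast
  from this[rule_format, of 0 0] have "expectation (\<lambda>\<omega>. B 0 \<omega> * B 0 \<omega>) = 0" by simp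
  then have "AE \<omega> in M. B 0 \<omega> * B 0 \<omega> = 0"
    using fbm_integrable_mult[OF B, of 0 0] by (subst (asm) integral_nonneg_eq_0_iff_AE) auto
  then show ?thesis by simp
qed

lemma fbm_holder:
  assumes B: "fractional_brownian_motion M H B" and "0 < T" "0 < \<beta>" "\<beta> < H"
  shows "AE \<omega> in M. holder_on \<beta> {0..T} (\<lambda>t. B t \<omega>)"
proof -
  obtain p K where "0 \<le> p" and p: "0 < p" and "integrable M K" and AE: "AE \<omega> in M. 0 \<le> K \<omega> \<and> (\<forall>s\<in>{0..T}. \<forall>t\<in>{0..T}.
    \<bar>B t \<omega> - B s \<omega>\<bar> ^ p \<le> K \<omega> * (\<bar>t - s\<bar> powr \<beta>) ^ p)"
    by (rule fbm_holder_bound[OF assms, of 0])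
  from AE show ?thesis
  proof eventually_elim
    fix \<omega> assume *: "0 \<le> K \<omega> \<and> (\<forall>s\<in>{0..T}. \<forall>t\<in>{0..T}. \<bar>B t \<omega> - B s \<omega>\<bar> ^ p \<le> K \<omega> * (\<bar>t - s\<bar> powr \<beta>) ^ p)"
    have "\<bar>B t \<omega> - B s \<omega>\<bar> \<le> root p (K \<omega>) * \<bar>t - s\<bar> powr \<beta>" if "s \<in> {0..T}" "t \<in> {0..T}" for s t
    proof (rule power_le_imp_le_base[of _ "p - 1"])
      show "\<bar>B t \<omega> - B s \<omega>\<bar> ^ Suc (p - 1) \<le> (root p (K \<omega>) * \<bar>t - s\<bar> powr \<beta>) ^ Suc (p - 1)"
        using * that p by (simp add: power_mult_distrib del: power_Suc)
    qed (use * p in auto)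
    then show "holder_on \<beta> {0..T} (\<lambda>t. B t \<omega>)" unfolding holder_on_def by blast
  qed
qed

text \<open>One null set must serve all exponents and horizons, so a countable family is used;
  \<open>H - H / (i + 2)\<close> increases to \<open>H\<close> and is positive already at
  \<open>i = 0\<close>. On a bounded interval a smaller exponent follows from a larger one at the
  cost of a constant.\<close>

lemma fbm_holder_all:
  assumes B: "fractional_brownian_motion M H B" and "0 < H"
  shows "AE \<omega> in M. B 0 \<omega> = 0 \<and> (\<forall>T \<beta>. 0 < \<beta> \<and> \<beta> < H \<longrightarrow> holder_on \<beta> {0..T} (\<lambda>t. B t \<omega>))"
proof -
  have "AE \<omega> in M. \<forall>n i. holder_on (H - H / (real i + 2)) {0..real (Suc n)} (\<lambda>t. B t \<omega>)"
    using assms by (intro AE_all_countable[THEN iffD2] allI fbm_holder[OF B]) (auto simp: field_simps add_pos_nonneg)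
  with fbm_start[OF B] show ?thesis
  proof eventually_elim
    case (elim \<omega>)
    have "holder_on \<beta> {0..T} (\<lambda>t. B t \<omega>)" if \<beta>: "0 < \<beta>" "\<beta> < H" for T \<beta>
    proof -
      obtain n where n: "T < real n" using reals_Archimedean2 by blast
      obtain i where "H / (H - \<beta>) < real i" using reals_Archimedean2 by blast
      then have "H / (real i + 2) \<le> H - \<beta>" using \<beta> \<open>0 < H\<close> by (simp add: field_simps)
      define \<beta>' where "\<beta>' = H - H / (real i + 2)"
      have "\<beta> \<le> \<beta>'" using \<open>H / (real i + 2) \<le> H - \<beta>\<close> by (simp add: \<beta>'_def)
      obtain C where C: "\<And>s t. s \<in> {0..real (Suc n)} \<Longrightarrow> t \<in> {0..real (Suc n)} \<Longrightarrow>
          \<bar>B t \<omega> - B s \<omega>\<bar> \<le> C * \<bar>t - s\<bar> powr \<beta>'"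
        using elim(2) unfolding holder_on_def \<beta>'_def by meson
      have "\<bar>B t \<omega> - B s \<omega>\<bar> \<le> \<bar>C\<bar> * real (Suc n) powr (\<beta>' - \<beta>) * \<bar>t - s\<bar> powr \<beta>"
        if st: "s \<in> {0..T}" "t \<in> {0..T}" for s t
      proof -
        have "\<bar>B t \<omega> - B s \<omega>\<bar> \<le> C * \<bar>t - s\<bar> powr \<beta>'" using st n by (intro C) auto
        also have "\<dots> \<le> \<bar>C\<bar> * \<bar>t - s\<bar> powr \<beta>'" by (intro mult_right_mono) auto
        also have "\<bar>t - s\<bar> powr \<beta>' = \<bar>t - s\<bar> powr (\<beta>' - \<beta>) * \<bar>t - s\<bar> powr \<beta>"
          by (simp flip: powr_add)
        also have "\<bar>C\<bar> * (\<bar>t - s\<bar> powr (\<beta>' - \<beta>) * \<bar>t - s\<bar> powr \<beta>)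
            \<le> \<bar>C\<bar> * (real (Suc n) powr (\<beta>' - \<beta>) * \<bar>t - s\<bar> powr \<beta>)"
          using st n \<open>\<beta> \<le> \<beta>'\<close> by (intro mult_left_mono mult_right_mono powr_mono2) auto
        finally show ?thesis by (simp add: mult.assoc)
      qed
      then show ?thesis unfolding holder_on_def by blast
    qed
    then show ?case using elim(1) by blast
  qed
qed

end

section \<open>Delayed approximation of one-sided Lipschitz equations\<close>

text \<open>Paths live on the whole line because the delayed argument \<open>r - d\<close> reaches
  below 0; through \<open>max 0 t\<close> only \<open>x0 + b t\<close> remains at negative
  times.\<close>

definition delay_step :: "(real \<Rightarrow> real \<Rightarrow> real) \<Rightarrow> real \<Rightarrow> (real \<Rightarrow> real) \<Rightarrow> real \<Rightarrow> (real \<Rightarrow> real) \<Rightarrow> real \<Rightarrow> real" where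
  "delay_step D x0 b d X t = x0 + integral {0..max 0 t} (\<lambda>r. D r (X (r - d))) + b t"

definition delay_iter :: "(real \<Rightarrow> real \<Rightarrow> real) \<Rightarrow> real \<Rightarrow> (real \<Rightarrow> real) \<Rightarrow> real \<Rightarrow> nat \<Rightarrow> real \<Rightarrow> real" where
  "delay_iter D x0 b d j = (delay_step D x0 b d ^^ j) (\<lambda>_. x0)"

text \<open>
  \<open>delay_approx D x0 b n\<close> solves \<open>X' = D(t, X(t - d)) + b'\<close> with delay \<open>d = 1/(n+1)\<close> up to time
  \<open>n + 1\<close>: the iterates are stationary on \<open>(-\<infinity>, j d]\<close> after \<open>j\<close> steps.
\<close>

definition delay_approx :: "(real \<Rightarrow> real \<Rightarrow> real) \<Rightarrow> real \<Rightarrow> (real \<Rightarrow> real) \<Rightarrow> nat \<Rightarrow> real \<Rightarrow> real" where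
  "delay_approx D x0 b n = delay_iter D x0 b (1 / real (Suc n)) (Suc n * Suc n)"

definition ode_flow :: "(real \<Rightarrow> real \<Rightarrow> real) \<Rightarrow> real \<Rightarrow> (real \<Rightarrow> real) \<Rightarrow> real \<Rightarrow> real" where
  "ode_flow D x0 b t = lim (\<lambda>n. delay_approx D x0 b n t)"

lemma continuous_on_integral_max:
  fixes u :: "real \<Rightarrow> real"
  assumes "continuous_on UNIV u"
  shows "continuous_on UNIV (\<lambda>t. integral {0..max 0 t} u)"
proof -
  have "continuous_on {..<T} (\<lambda>t. integral {0..max 0 t} u)" for T
  proof (rule continuous_on_compose2[of "{0..max 0 T}" "\<lambda>t. integral {0..t} u"])
    show "continuous_on {0..max 0 T} (\<lambda>t. integral {0..t} u)"
      by (intro indefinite_integral_continuous_1 integrable_continuous_interval continuous_on_subset[OF assms]) auto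
  qed (auto intro!: continuous_intros)
  then have "continuous_on (\<Union>n::nat. {..<real n}) (\<lambda>t. integral {0..max 0 t} u)"
    by (intro continuous_on_open_UN) auto
  moreover have "(\<Union>n::nat. {..<real n}) = UNIV" using reals_Archimedean2 by auto
  ultimately show ?thesis by simp
qed

locale one_sided_lipschitz_drift =
  fixes D :: "real \<Rightarrow> real \<Rightarrow> real"
  assumes D_cont: "continuous_on UNIV (\<lambda>(t, x). D t x)"
    and D_bound: "\<exists>K. \<forall>t\<in>{0..T}. \<forall>x. \<bar>D t x\<bar> \<le> K"
    and D_osl: "\<exists>L>0. \<forall>t\<in>{0..T}. \<forall>x y. x \<le> y \<longrightarrow> D t y - D t x \<le> L * (y - x)"
begin

lemma D_comp: "continuous_on S u \<Longrightarrow> continuous_on S X \<Longrightarrow> continuous_on S (\<lambda>r. D (u r) (X r))"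
  using continuous_on_compose2[OF D_cont, of S "\<lambda>r. (u r, X r)"] by (auto intro: continuous_intros)

lemma solution_unique:
  assumes "continuous_on {0..T} X" "continuous_on {0..T} Z"
    and X: "\<And>t. t \<in> {0..T} \<Longrightarrow> X t = x0 + integral {0..t} (\<lambda>r. D r (X r)) + b t"
    and Z: "\<And>t. t \<in> {0..T} \<Longrightarrow> Z t = x0 + integral {0..t} (\<lambda>r. D r (Z r)) + b t"
    and t: "t \<in> {0..T}"
  shows "X t = Z t"
proof -
  obtain L where L: "0 < L" "\<And>t x y. t \<in> {0..T} \<Longrightarrow> x \<le> y \<Longrightarrow> D t y - D t x \<le> L * (y - x)"
    using D_osl[of T] by blast
  have le: "X t - Z t \<le> 0 / L * (exp (L * t) - 1)"
    if "continuous_on {0..T} X" "continuous_on {0..T} Z"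
    and X: "\<And>t. t \<in> {0..T} \<Longrightarrow> X t = x0 + integral {0..t} (\<lambda>r. D r (X r)) + b t"
    and Z: "\<And>t. t \<in> {0..T} \<Longrightarrow> Z t = x0 + integral {0..t} (\<lambda>r. D r (Z r)) + b t" for X Z
  proof (rule one_sided_comparison)
    show "continuous_on {0..t} (\<lambda>r. D r (X r))" "continuous_on {0..t} (\<lambda>r. D r (Z r))"
      using t by (auto intro!: D_comp continuous_intros continuous_on_subset[OF that(1)] continuous_on_subset[OF that(2)])
    show "D s (X s) - D s (Z s) \<le> L * (X s - Z s) + 0" if "s \<in> {0..t}" "Z s < X s" for s
      using L(2)[of s "Z s" "X s"] that t by auto
  qed (use t L X Z in auto)
  show ?thesis using le[OF assms(1,2) X Z] le[OF assms(2,1) Z X] by simp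
qed

end

locale driven_ode = one_sided_lipschitz_drift +
  fixes b :: "real \<Rightarrow> real" and x0 :: real
  assumes b_cont: "continuous_on UNIV b" and b_start: "\<And>t. t \<le> 0 \<Longrightarrow> b t = 0"
begin

abbreviation "Xn \<equiv> delay_approx D x0 b"
abbreviation "dn n \<equiv> 1 / real (Suc n)"

lemma delay_iter_Suc: "delay_iter D x0 b d (Suc j) t
    = x0 + integral {0..max 0 t} (\<lambda>r. D r (delay_iter D x0 b d j (r - d))) + b t"
  by (simp add: delay_iter_def delay_step_def)

lemma delay_iter_cont: "continuous_on UNIV (delay_iter D x0 b d j)"
proof (induction j)
  case 0 show ?case by (simp add: delay_iter_def)
next
  case (Suc j)
  have "continuous_on UNIV (\<lambda>r. D r (delay_iter D x0 b d j (r - d)))"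
    by (intro D_comp continuous_intros continuous_on_compose2[OF Suc]) auto
  from continuous_on_integral_max[OF this] show ?case
    unfolding delay_iter_Suc[abs_def] by (intro continuous_intros b_cont)
qed

lemma delay_iter_start: "t \<le> 0 \<Longrightarrow> delay_iter D x0 b d j t = x0"
  by (cases j) (auto simp: delay_iter_Suc b_start max_def delay_iter_def[of _ _ _ _ 0])

text \<open>Method of steps: the value at \<open>t\<close> reads the previous iterate only up to
  time \<open>t - d\<close>, so each application extends the stationary range by
  \<open>d\<close>.\<close>

lemma delay_iter_stable:
  "0 < d \<Longrightarrow> t \<le> real j * d \<Longrightarrow> delay_iter D x0 b d (Suc j) t = delay_iter D x0 b d j t"
proof (induction j arbitrary: t)
  case 0 then show ?case by (simp add: delay_iter_start)
next
  case (Suc j)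
  have "delay_iter D x0 b d (Suc j) (r - d) = delay_iter D x0 b d j (r - d)" if "r \<in> {0..max 0 t}" for r
  proof (rule Suc.IH[OF Suc.prems(1)])
    have "0 \<le> real j * d" using Suc.prems(1) by simp
    then show "r - d \<le> real j * d" using that Suc.prems by (auto simp: algebra_simps max_def split: if_splits)
  qed
  then have "integral {0..max 0 t} (\<lambda>r. D r (delay_iter D x0 b d (Suc j) (r - d)))
      = integral {0..max 0 t} (\<lambda>r. D r (delay_iter D x0 b d j (r - d)))"
    by (intro integral_cong) simp
  then show ?case unfolding delay_iter_Suc[of d "Suc j"] delay_iter_Suc[of d j] by simp
qed

lemma Xn_cont: "continuous_on UNIV (Xn n)"
  unfolding delay_approx_def by (rule delay_iter_cont)

lemma integrand_cont: "continuous_on UNIV (\<lambda>r. D r (Xn n (r - d)))"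
  by (intro D_comp continuous_intros continuous_on_compose2[OF Xn_cont]) auto

lemma Xn_eq:
  assumes "t \<le> real (Suc n)"
  shows "Xn n t = x0 + integral {0..max 0 t} (\<lambda>r. D r (Xn n (r - dn n))) + b t"
proof -
  have "t \<le> real (Suc n * Suc n) * dn n" using assms unfolding of_nat_mult by (simp del: of_nat_Suc)
  then have "Xn n t = delay_iter D x0 b (dn n) (Suc (Suc n * Suc n)) t"
    unfolding delay_approx_def by (intro delay_iter_stable[symmetric]) auto
  then show ?thesis by (simp only: delay_iter_Suc delay_approx_def)
qed

lemma dn_lim: "(\<lambda>n. dn n) \<longlonglongrightarrow> 0"
  using LIMSEQ_inverse_real_of_nat by (simp add: inverse_eq_divide)

text \<open>\<open>s\<close> may be negative, since a delayed time can precede 0; the integral then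
  starts at \<open>max 0 s\<close>. The constant \<open>K\<close> does not depend on
  \<open>n\<close>.\<close>

lemma Xn_increment:
  assumes K: "\<And>t x. t \<in> {0..T} \<Longrightarrow> \<bar>D t x\<bar> \<le> K" and "T \<le> real (Suc n)" "s \<le> t" "t \<in> {0..T}"
  shows "\<bar>Xn n t - Xn n s\<bar> \<le> K * (t - s) + \<bar>b t - b s\<bar>"
proof -
  let ?u = "\<lambda>r. D r (Xn n (r - dn n))"
  have K0: "0 \<le> K" using K[of t 0] assms(4) by linarith
  have "integral {0..max 0 s} ?u + integral {max 0 s..t} ?u = integral {0..t} ?u"
    using assms by (intro Henstock_Kurzweil_Integration.integral_combine integrable_continuous_interval
      continuous_on_subset[OF integrand_cont]) auto
  then have "Xn n t - Xn n s = integral {max 0 s..t} ?u + (b t - b s)"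
    using Xn_eq[of t n] Xn_eq[of s n] assms by (simp add: max_def)
  moreover have "\<bar>integral {max 0 s..t} ?u\<bar> \<le> K * (t - max 0 s)"
    using assms integral_bound[of "max 0 s" t ?u K] continuous_on_subset[OF integrand_cont] K by auto
  moreover have "K * (t - max 0 s) \<le> K * (t - s)" using K0 by (intro mult_left_mono) auto
  ultimately show ?thesis by linarith
qed

text \<open>During one delay an approximant moves by at most \<open>K * dn n\<close> plus an
  increment of \<open>b\<close>, and \<open>D\<close> is uniformly continuous on a compact box that
  contains all the approximants concerned.\<close>

lemma delay_error:
  assumes "0 \<le> T" "0 < \<epsilon>"
  obtains N where "T \<le> real N" "\<And>n r. N \<le> n \<Longrightarrow> r \<in> {0..T} \<Longrightarrow>
    \<bar>D r (Xn n (r - dn n)) - D r (Xn n r)\<bar> \<le> \<epsilon>"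
proof -
  obtain K where K: "\<And>t x. t \<in> {0..T} \<Longrightarrow> \<bar>D t x\<bar> \<le> K" using D_bound[of T] by blast
  have K0: "0 \<le> K" using K[of 0 0] assms(1) by auto
  have "compact (b ` {-1..T})" by (intro compact_continuous_image continuous_on_subset[OF b_cont]) auto
  then have "bounded (b ` {-1..T})" by (rule compact_imp_bounded)
  then obtain S where S: "\<And>t. t \<in> {-1..T} \<Longrightarrow> \<bar>b t\<bar> \<le> S" by (force simp: bounded_real)
  \<comment> \<open>This is a common bound on \<open>{-1..T}\<close>; the interval starts at -1
    because no delay exceeds 1.\<close>
  define R where "R = \<bar>x0\<bar> + K * T + S + 1"
  have XR: "\<bar>Xn n t\<bar> \<le> R" if "T \<le> real (Suc n)" "t \<in> {-1..T}" for n t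
  proof (cases "t \<le> 0")
    case True
    have "0 \<le> S" using S[of 0] assms(1) by auto
    then show ?thesis using True K0 assms(1)
      by (simp add: delay_approx_def delay_iter_start R_def add_nonneg_nonneg)
  next
    case False
    then have "\<bar>Xn n t - Xn n 0\<bar> \<le> K * (t - 0) + \<bar>b t - b 0\<bar>"
      using that by (intro Xn_increment[OF K]) auto
    moreover have "Xn n 0 = x0" "b 0 = 0" by (auto simp: delay_approx_def delay_iter_start b_start)
    moreover have "K * t \<le> K * T" using that K0 by (intro mult_left_mono) auto
    ultimately show ?thesis using S[OF that(2)] by (simp add: R_def abs_if split: if_splits)
  qed
  have "uniformly_continuous_on ({0..T} \<times> {-R..R}) (\<lambda>(t, x). D t x)"
    by (intro compact_uniformly_continuous continuous_on_subset[OF D_cont] compact_Times) auto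
  then obtain \<eta> where \<eta>: "0 < \<eta>" "\<And>p q. p \<in> {0..T} \<times> {-R..R} \<Longrightarrow> q \<in> {0..T} \<times> {-R..R} \<Longrightarrow>
      dist q p < \<eta> \<Longrightarrow> dist (case q of (t, x) \<Rightarrow> D t x) (case p of (t, x) \<Rightarrow> D t x) < \<epsilon>"
    unfolding uniformly_continuous_on_def using assms(2) by metis
  have "uniformly_continuous_on {-1..T} b"
    by (intro compact_uniformly_continuous continuous_on_subset[OF b_cont]) auto
  then obtain \<eta>' where \<eta>': "0 < \<eta>'" "\<And>s t. s \<in> {-1..T} \<Longrightarrow> t \<in> {-1..T} \<Longrightarrow> dist t s < \<eta>' \<Longrightarrow> dist (b t) (b s) < \<eta> / 2"
    unfolding uniformly_continuous_on_def using \<eta>(1) by (metis half_gt_zero)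
  have "(\<lambda>n. K * dn n) \<longlonglongrightarrow> K * 0" by (intro tendsto_intros dn_lim)
  then have "\<forall>\<^sub>F n in sequentially. K * dn n < \<eta> / 2" using \<eta>(1) by (intro order_tendstoD) auto
  moreover have "\<forall>\<^sub>F n in sequentially. dn n < \<eta>'" using \<eta>'(1) dn_lim by (intro order_tendstoD) auto
  moreover have "\<forall>\<^sub>F n in sequentially. T \<le> real n"
    using filterlim_real_sequentially by (simp add: filterlim_at_top)
  ultimately have "\<forall>\<^sub>F n in sequentially. K * dn n < \<eta> / 2 \<and> dn n < \<eta>' \<and> T \<le> real n"
    by eventually_elim simp
  then obtain N where N: "\<And>n. N \<le> n \<Longrightarrow> K * dn n < \<eta> / 2 \<and> dn n < \<eta>' \<and> T \<le> real n"
    by (auto simp: eventually_sequentially)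
  show thesis
  proof (rule that[of N])
    show "T \<le> real N" using N[of N] by simp
    fix n r assume n: "N \<le> n" and r: "r \<in> {0..T}"
    note N = N[OF n]
    have "0 \<le> dn n" "dn n \<le> 1" by auto
    then have mem: "r - dn n \<in> {-1..T}" "r \<in> {-1..T}" using r unfolding atLeastAtMost_iff by linarith+
    have "\<bar>Xn n r - Xn n (r - dn n)\<bar> \<le> K * (r - (r - dn n)) + \<bar>b r - b (r - dn n)\<bar>"
      using N r by (intro Xn_increment[OF K]) auto
    moreover have "dist (b r) (b (r - dn n)) < \<eta> / 2"
      using N by (intro \<eta>'(2) mem) (simp add: dist_real_def)
    moreover have "K * (r - (r - dn n)) < \<eta> / 2" using N by simp
    ultimately have "dist (Xn n (r - dn n)) (Xn n r) < \<eta>" unfolding dist_real_def by linarith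
    then have "dist (D r (Xn n (r - dn n))) (D r (Xn n r)) < \<epsilon>"
      using \<eta>(2)[of "(r, Xn n r)" "(r, Xn n (r - dn n))"] XR[of n r] XR[of n "r - dn n"] N r mem
      by (auto simp: dist_Pair_Pair abs_le_iff)
    then show "\<bar>D r (Xn n (r - dn n)) - D r (Xn n r)\<bar> \<le> \<epsilon>" by (simp add: dist_real_def)
  qed
qed

text \<open>Up to the delay error every approximant solves the undelayed equation with the same
  noise, so the one-sided comparison, used in both orders, makes the sequence Cauchy.\<close>

lemma Xn_tendsto:
  assumes "0 \<le> t"
  shows "(\<lambda>n. Xn n t) \<longlonglongrightarrow> ode_flow D x0 b t"
proof -
  obtain L where L: "0 < L" "\<And>s x y. s \<in> {0..t} \<Longrightarrow> x \<le> y \<Longrightarrow> D s y - D s x \<le> L * (y - x)"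
    using D_osl[of t] by blast
  have "Cauchy (\<lambda>n. Xn n t)"
  proof (rule metric_CauchyI)
    fix e :: real assume "0 < e"
    \<comment> \<open>The two delay errors add up to \<open>2 * \<epsilon>\<close>, and the
      comparison bound becomes at most \<open>\<epsilon> * E\<close>, which the choice of
      \<open>\<epsilon>\<close> makes \<open>e / 2\<close>.\<close>
    define E where "E = 2 / L * exp (L * t)"
    have "0 < E" using L(1) by (simp add: E_def)
    define \<epsilon> where "\<epsilon> = e / (2 * E)"
    have "0 < \<epsilon>" using \<open>0 < e\<close> \<open>0 < E\<close> by (simp add: \<epsilon>_def)
    obtain N where N: "t \<le> real N" "\<And>n r. N \<le> n \<Longrightarrow> r \<in> {0..t} \<Longrightarrow>
      \<bar>D r (Xn n (r - dn n)) - D r (Xn n r)\<bar> \<le> \<epsilon>"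
      using delay_error[OF assms \<open>0 < \<epsilon>\<close>] by blast
    have le: "Xn n t - Xn m t < e" if "N \<le> n" "N \<le> m" for n m
    proof -
      have "Xn n t - Xn m t \<le> 2 * \<epsilon> / L * (exp (L * t) - 1)"
      proof (rule one_sided_comparison)
        show "Xn n s = x0 + integral {0..s} (\<lambda>r. D r (Xn n (r - dn n))) + b s" if "s \<in> {0..t}" for s
          using Xn_eq[of s n] that N(1) \<open>N \<le> n\<close> by (simp add: max_def)
        show "Xn m s = x0 + integral {0..s} (\<lambda>r. D r (Xn m (r - dn m))) + b s" if "s \<in> {0..t}" for s
          using Xn_eq[of s m] that N(1) \<open>N \<le> m\<close> by (simp add: max_def)
        fix s assume s: "s \<in> {0..t}" "Xn m s < Xn n s"
        have "D s (Xn n s) - D s (Xn m s) \<le> L * (Xn n s - Xn m s)" using s by (intro L) auto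
        then show "D s (Xn n (s - dn n)) - D s (Xn m (s - dn m)) \<le> L * (Xn n s - Xn m s) + 2 * \<epsilon>"
          using N(2)[OF \<open>N \<le> n\<close> s(1)] N(2)[OF \<open>N \<le> m\<close> s(1)] by linarith
      qed (use assms L \<open>0 < \<epsilon>\<close> in \<open>auto intro: continuous_on_subset[OF integrand_cont]\<close>)
      also have "\<dots> \<le> 2 * \<epsilon> / L * exp (L * t)" using \<open>0 < \<epsilon>\<close> L(1) by (intro mult_left_mono) auto
      also have "\<dots> = \<epsilon> * E" by (simp add: E_def)
      also have "\<dots> < e" using \<open>0 < e\<close> \<open>0 < E\<close> by (simp add: \<epsilon>_def)
      finally show ?thesis .
    qed
    show "\<exists>N. \<forall>n\<ge>N. \<forall>m\<ge>N. dist (Xn n t) (Xn m t) < e"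
      using le by (force simp: dist_real_def abs_less_iff)
  qed
  then show ?thesis unfolding ode_flow_def by (simp add: Cauchy_convergent_iff convergent_LIMSEQ_iff)
qed

text \<open>Only pointwise convergence is known here, not continuity of the limit. Integrability of
  the drift along the flow therefore comes from dominated convergence with the bound
  \<open>K\<close>, and continuity is afterwards read off the equation.\<close>

lemma flow_equation:
  assumes "0 \<le> t"
  shows "(\<lambda>r. D r (ode_flow D x0 b r)) integrable_on {0..t}"
    and "ode_flow D x0 b t = x0 + integral {0..t} (\<lambda>r. D r (ode_flow D x0 b r)) + b t"
proof -
  obtain K where K: "\<And>s x. s \<in> {0..t} \<Longrightarrow> \<bar>D s x\<bar> \<le> K" using D_bound[of t] by blast
  have lim: "(\<lambda>n. D r (Xn n (r - dn n))) \<longlonglongrightarrow> D r (ode_flow D x0 b r)" if r: "r \<in> {0..t}" for r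
  proof -
    have "continuous_on UNIV (D r)" using D_comp[OF continuous_on_const continuous_on_id] by auto
    then have "isCont (D r) (ode_flow D x0 b r)" by (simp add: continuous_on_eq_continuous_at)
    then have 1: "(\<lambda>n. D r (Xn n r)) \<longlonglongrightarrow> D r (ode_flow D x0 b r)"
      using Xn_tendsto[of r] r by (intro isCont_tendsto_compose[of _ "D r"]) auto
    have "(\<lambda>n. D r (Xn n (r - dn n)) - D r (Xn n r)) \<longlonglongrightarrow> 0"
    proof (rule LIMSEQ_I)
      fix e :: real assume "0 < e"
      then obtain N where N: "\<And>n r. N \<le> n \<Longrightarrow> r \<in> {0..t} \<Longrightarrow>
        \<bar>D r (Xn n (r - dn n)) - D r (Xn n r)\<bar> \<le> e / 2"
        using delay_error[OF assms, of "e / 2"] by (metis half_gt_zero)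
      show "\<exists>no. \<forall>n\<ge>no. norm (D r (Xn n (r - dn n)) - D r (Xn n r) - 0) < e"
      proof (intro exI allI impI)
        fix n assume "N \<le> n"
        from N[OF this r] \<open>0 < e\<close> show "norm (D r (Xn n (r - dn n)) - D r (Xn n r) - 0) < e" by simp
      qed
    qed
    from tendsto_add[OF this 1] show ?thesis by simp
  qed
  have int: "(\<lambda>r. D r (Xn n (r - dn n))) integrable_on {0..t}" for n
    by (intro integrable_continuous_interval continuous_on_subset[OF integrand_cont]) auto
  note dc = dominated_convergence[OF int integrable_const_ivl[of K] _ lim]
  show "(\<lambda>r. D r (ode_flow D x0 b r)) integrable_on {0..t}" by (rule dc(1)) (use K in auto)
  have I: "(\<lambda>n. integral {0..t} (\<lambda>r. D r (Xn n (r - dn n)))) \<longlonglongrightarrow> integral {0..t} (\<lambda>r. D r (ode_flow D x0 b r))"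
    by (rule dc(2)) (use K in auto)
  have "(\<lambda>n. x0 + integral {0..t} (\<lambda>r. D r (Xn n (r - dn n))) + b t) \<longlonglongrightarrow>
      x0 + integral {0..t} (\<lambda>r. D r (ode_flow D x0 b r)) + b t" by (intro tendsto_intros I)
  moreover have "\<forall>\<^sub>F n in sequentially. x0 + integral {0..t} (\<lambda>r. D r (Xn n (r - dn n))) + b t = Xn n t"
  proof -
    have "\<forall>\<^sub>F n in sequentially. t \<le> real n"
      using filterlim_real_sequentially by (simp add: filterlim_at_top)
    then show ?thesis by eventually_elim (use Xn_eq[of t] assms in \<open>auto simp: max_def\<close>)
  qed
  ultimately have "(\<lambda>n. Xn n t) \<longlonglongrightarrow> x0 + integral {0..t} (\<lambda>r. D r (ode_flow D x0 b r)) + b t"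
    by (rule Lim_transform_eventually)
  with Xn_tendsto[OF assms] show "ode_flow D x0 b t = x0 + integral {0..t} (\<lambda>r. D r (ode_flow D x0 b r)) + b t"
    by (rule LIMSEQ_unique)
qed

lemma flow_cont: "continuous_on {0..T} (ode_flow D x0 b)"
proof (cases "0 \<le> T")
  case True
  have "continuous_on {0..T} (\<lambda>t. x0 + integral {0..t} (\<lambda>r. D r (ode_flow D x0 b r)) + b t)"
    by (intro continuous_intros indefinite_integral_continuous_1 flow_equation True continuous_on_subset[OF b_cont]) auto
  then show ?thesis by (rule continuous_on_eq) (use flow_equation in auto)
qed simp

end

text \<open>Continuity in \<open>r\<close> upgrades measurability at each time to joint
  measurability: sampling on a grid of width \<open>1 / Suc n\<close> uses countably many times, and
  the samples converge. The integral is then rewritten as a Lebesgue integral depending measurably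
  on the parameter.\<close>

lemma borel_measurable_path_integral:
  fixes u :: "real \<Rightarrow> 'a \<Rightarrow> real"
  assumes meas[measurable]: "\<And>r. u r \<in> borel_measurable M"
    and cont: "\<And>\<omega>. \<omega> \<in> space M \<Longrightarrow> continuous_on UNIV (\<lambda>r. u r \<omega>)"
  shows "(\<lambda>\<omega>. integral {0..s} (\<lambda>r. u r \<omega>)) \<in> borel_measurable M"
proof -
  have joint[measurable]: "(\<lambda>(\<omega>, r). u r \<omega>) \<in> borel_measurable (M \<Otimes>\<^sub>M lborel)"
  proof (rule borel_measurable_LIMSEQ_real)
    fix n :: nat
    have "(\<lambda>p. (\<lambda>i p. u (real_of_int i / real (Suc n)) (fst p)) \<lfloor>snd p * real (Suc n)\<rfloor> p)
        \<in> borel_measurable (M \<Otimes>\<^sub>M lborel)"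
      by (rule measurable_compose_countable) measurable
    then show "(\<lambda>p. u (real_of_int \<lfloor>snd p * real (Suc n)\<rfloor> / real (Suc n)) (fst p))
        \<in> borel_measurable (M \<Otimes>\<^sub>M lborel)" by simp
  next
    fix p :: "'a \<times> real" assume p: "p \<in> space (M \<Otimes>\<^sub>M lborel)"
    obtain \<omega> r where [simp]: "p = (\<omega>, r)" by (cases p)
    have "\<bar>real_of_int \<lfloor>r * real (Suc n)\<rfloor> / real (Suc n) - r\<bar> \<le> 1 / real (Suc n)" for n
    proof -
      have "real_of_int \<lfloor>r * real (Suc n)\<rfloor> / real (Suc n) - r
          = (real_of_int \<lfloor>r * real (Suc n)\<rfloor> - r * real (Suc n)) / real (Suc n)"
        by (simp add: field_simps)
      moreover have "\<bar>real_of_int \<lfloor>r * real (Suc n)\<rfloor> - r * real (Suc n)\<bar> \<le> 1" by linarith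
      ultimately show ?thesis by (simp add: abs_div divide_right_mono)
    qed
    then have "(\<lambda>n. real_of_int \<lfloor>r * real (Suc n)\<rfloor> / real (Suc n) - r) \<longlonglongrightarrow> 0"
      by (intro Lim_null_comparison[OF _ LIMSEQ_inverse_real_of_nat]) (auto simp: inverse_eq_divide)
    then have "(\<lambda>n. real_of_int \<lfloor>r * real (Suc n)\<rfloor> / real (Suc n)) \<longlonglongrightarrow> r" by (simp add: LIM_zero_iff)
    moreover have "isCont (\<lambda>r. u r \<omega>) r" using cont[of \<omega>] p
      by (auto simp: space_pair_measure continuous_on_eq_continuous_at)
    ultimately show "(\<lambda>n. u (real_of_int \<lfloor>snd p * real (Suc n)\<rfloor> / real (Suc n)) (fst p))
        \<longlonglongrightarrow> (case p of (\<omega>, r) \<Rightarrow> u r \<omega>)"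
      using isCont_tendsto_compose[of r "\<lambda>r. u r \<omega>"] by simp
  qed
  have m: "(\<lambda>\<omega>. \<integral>r. indicator {0..s} r *\<^sub>R u r \<omega> \<partial>lborel) \<in> borel_measurable M"
    by (rule lborel.borel_measurable_lebesgue_integral) measurable
  have eq: "(\<integral>r. indicator {0..s} r *\<^sub>R u r \<omega> \<partial>lborel) = integral {0..s} (\<lambda>r. u r \<omega>)"
    if "\<omega> \<in> space M" for \<omega>
  proof -
    have "set_integrable lborel {0..s} (\<lambda>r. u r \<omega>)"
      by (intro borel_integrable_atLeastAtMost' continuous_on_subset[OF cont[OF that]]) auto
    from set_borel_integral_eq_integral(2)[OF this] show ?thesis by (simp add: set_lebesgue_integral_def)
  qed
  show ?thesis by (rule measurable_cong[THEN iffD1, OF eq m])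
qed

context one_sided_lipschitz_drift
begin

lemma ode_flow_measurable:
  fixes b :: "'a \<Rightarrow> real \<Rightarrow> real"
  assumes meas: "\<And>t. (\<lambda>\<omega>. b \<omega> t) \<in> borel_measurable M"
    and ode: "\<And>\<omega>. \<omega> \<in> space M \<Longrightarrow> driven_ode D (b \<omega>)"
  shows "(\<lambda>\<omega>. ode_flow D x0 (b \<omega>) t) \<in> borel_measurable M"
proof -
  have "(\<lambda>\<omega>. delay_iter D x0 (b \<omega>) d j t) \<in> borel_measurable M" for d j t
  proof (induction j arbitrary: t)
    case 0 show ?case by (simp add: delay_iter_def)
  next
    case (Suc j)
    note [measurable] = Suc meas
    have [measurable]: "D r \<in> borel_measurable borel" for r
      using D_comp[OF continuous_on_const continuous_on_id] by (intro borel_measurable_continuous_onI) auto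
    have "(\<lambda>\<omega>. integral {0..max 0 t} (\<lambda>r. D r (delay_iter D x0 (b \<omega>) d j (r - d)))) \<in> borel_measurable M"
    proof (rule borel_measurable_path_integral)
      fix \<omega> assume "\<omega> \<in> space M"
      then interpret driven_ode D "b \<omega>" x0 by (rule ode)
      show "continuous_on UNIV (\<lambda>r. D r (delay_iter D x0 (b \<omega>) d j (r - d)))"
        by (intro D_comp continuous_intros continuous_on_compose2[OF delay_iter_cont]) auto
    qed measurable
    then have "(\<lambda>\<omega>. x0 + integral {0..max 0 t} (\<lambda>r. D r (delay_iter D x0 (b \<omega>) d j (r - d))) + b \<omega> t) \<in> borel_measurable M"
      by measurable
    then show ?case by (simp add: delay_iter_def delay_step_def)
  qed
  then show ?thesis unfolding ode_flow_def delay_approx_def by (intro borel_measurable_lim_metric)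
qed

end

section \<open>The singular drift\<close>

lemma holder_onE:
  assumes "holder_on \<beta> S u"
  obtains C where "0 < C" "\<And>s t. s \<in> S \<Longrightarrow> t \<in> S \<Longrightarrow> \<bar>u t - u s\<bar> \<le> C * \<bar>t - s\<bar> powr \<beta>"
proof -
  obtain C where C: "\<And>s t. s \<in> S \<Longrightarrow> t \<in> S \<Longrightarrow> \<bar>u t - u s\<bar> \<le> C * \<bar>t - s\<bar> powr \<beta>"
    using assms unfolding holder_on_def by blast
  have "\<bar>u t - u s\<bar> \<le> (\<bar>C\<bar> + 1) * \<bar>t - s\<bar> powr \<beta>" if "s \<in> S" "t \<in> S" for s t
  proof -
    have "C \<le> \<bar>C\<bar> + 1" by linarith
    then have "C * \<bar>t - s\<bar> powr \<beta> \<le> (\<bar>C\<bar> + 1) * \<bar>t - s\<bar> powr \<beta>" by (rule mult_right_mono) simp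
    then show ?thesis using C[OF that] by linarith
  qed
  then show ?thesis by (intro that[of "\<bar>C\<bar> + 1"]) auto
qed

lemma eventually_powr_less:
  assumes "0 < k" "0 < e"
  shows "\<forall>\<^sub>F r in at_right 0. (r::real) powr k < e"
proof -
  have "((\<lambda>r::real. r powr k) \<longlongrightarrow> 0) (at_right 0)"
    by (rule tendsto_zero_powrI[of _ _ _ k])
      (use assms in \<open>auto simp: eventually_at_right_less intro: tendsto_eq_intros eventually_at_rightI[of 0 1]\<close>)
  then show ?thesis using assms by (intro order_tendstoD) auto
qed

locale singular_drift =
  fixes f :: "real \<Rightarrow> real \<Rightarrow> real" and g h :: "real \<Rightarrow> real" and x1 :: real
  assumes f_nonneg: "\<And>t x. 0 \<le> t \<Longrightarrow> 0 < x \<Longrightarrow> 0 \<le> f t x"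
    and f_cont: "continuous_on ({0..} \<times> {0<..}) (\<lambda>(t, x). f t x)"
    and f_diff: "\<And>t x. 0 \<le> t \<Longrightarrow> 0 < x \<Longrightarrow> f t field_differentiable at x"
    and x1_pos: "0 < x1"
    and g_cont: "continuous_on {0..} g"
    and g_pos: "\<And>t. 0 < t \<Longrightarrow> 0 < g t"
    and f_ge_g: "\<And>t x. 0 < t \<Longrightarrow> 0 < x \<Longrightarrow> x < x1 \<Longrightarrow> g t \<le> f t x"
    and f_ge_deriv: "\<And>t x. 0 < t \<Longrightarrow> 0 < x \<Longrightarrow> x * deriv (f t) x \<le> f t x"
    and h_bounded: "\<And>T. 0 \<le> T \<Longrightarrow> bounded (h ` {0..T})"
    and f_le_h: "\<And>t x. 0 \<le> t \<Longrightarrow> 0 < x \<Longrightarrow> f t x \<le> h t * (x + 1)"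
begin

lemma f_comp:
  "continuous_on S u \<Longrightarrow> continuous_on S v \<Longrightarrow> (\<And>s. s \<in> S \<Longrightarrow> 0 \<le> u s \<and> 0 < v s) \<Longrightarrow>
    continuous_on S (\<lambda>s. f (u s) (v s))"
  using continuous_on_compose2[OF f_cont, of S "\<lambda>s. (u s, v s)"] by (fastforce intro: continuous_intros)

lemma f_over_x_antimono:
  assumes "0 \<le> t" "0 < x" "x \<le> y"
  shows "f t y / y \<le> f t x / x"
proof -
  have pos: "f t y / y \<le> f t x / x" if "0 < t" for t
  proof (rule DERIV_nonpos_imp_nonincreasing[of x y "\<lambda>z. f t z / z"])
    fix z assume "x \<le> z" "z \<le> y"
    then have "0 < z" using assms by simp
    then have "(f t has_real_derivative deriv (f t) z) (at z)"
      using f_diff[of t z] that by (simp add: field_differentiable_derivI)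
    then have "((\<lambda>z. f t z / z) has_real_derivative (deriv (f t) z * z - f t z * 1) / (z * z)) (at z)"
      using \<open>0 < z\<close> by (intro DERIV_divide DERIV_ident) auto
    moreover have "(deriv (f t) z * z - f t z * 1) / (z * z) \<le> 0"
      using f_ge_deriv[OF that \<open>0 < z\<close>] by (intro divide_nonpos_nonneg) (auto simp: mult.commute)
    ultimately show "\<exists>d. ((\<lambda>z. f t z / z) has_real_derivative d) (at z) \<and> d \<le> 0" by blast
  qed (use assms in auto)
  show ?thesis
  proof (cases "t = 0")
    \<comment> \<open>The derivative condition is assumed only for positive times; time 0 is reached
      by continuity along \<open>1 / Suc n\<close>.\<close>
    case True
    have lim: "(\<lambda>n. f (inverse (real (Suc n))) z / z) \<longlonglongrightarrow> f 0 z / z" if "0 < z" for z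
    proof -
      have "continuous_on {0..} (\<lambda>s. f s z)" using that by (intro f_comp continuous_intros) auto
      then have "(\<lambda>n. f (inverse (real (Suc n))) z) \<longlonglongrightarrow> f 0 z"
        by (rule continuous_on_tendsto_compose[OF _ LIMSEQ_inverse_real_of_nat]) auto
      then show ?thesis using that by (intro tendsto_intros) auto
    qed
    have "f 0 y / y \<le> f 0 x / x"
      by (rule LIMSEQ_le[OF lim lim]) (use assms pos in auto)
    then show ?thesis using True by simp
  qed (use assms pos in auto)
qed

lemma h_bound: obtains K where "0 < K" "\<And>t. t \<in> {0..T} \<Longrightarrow> h t \<le> K"
proof (cases "0 \<le> T")
  case True
  then obtain K where K: "\<And>t. t \<in> {0..T} \<Longrightarrow> \<bar>h t\<bar> \<le> K" using h_bounded by (force simp: bounded_real)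
  have "h t \<le> \<bar>K\<bar> + 1" if "t \<in> {0..T}" for t using K[OF that] by linarith
  then show ?thesis using that[of "\<bar>K\<bar> + 1"] by auto
qed (use that[of 1] in auto)

section \<open>The square-root drift and its truncation\<close>

definition F :: "real \<Rightarrow> real \<Rightarrow> real" where
  "F t x = f t (x\<^sup>2) / (2 * x)"

text \<open>One parameter cuts off both ends, so letting \<open>a\<close> decrease alone exhausts
  the positive half-line.\<close>

definition clamp :: "real \<Rightarrow> real \<Rightarrow> real" where
  "clamp a x = max a (min (1 / a) x)"

definition Fc :: "real \<Rightarrow> real \<Rightarrow> real \<Rightarrow> real" where
  "Fc a t x = F (max 0 t) (clamp a x)"

lemma clamp_bounds: "0 < a \<Longrightarrow> a \<le> 1 \<Longrightarrow> a \<le> clamp a x \<and> clamp a x \<le> 1 / a"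
  by (auto simp: clamp_def field_simps power2_eq_square[symmetric] power_le_one)

lemma Fc_eq_F: "0 \<le> t \<Longrightarrow> a \<le> x \<Longrightarrow> x \<le> 1 / a \<Longrightarrow> Fc a t x = F t x"
  by (simp add: Fc_def clamp_def)

lemma F_nonneg: "0 \<le> t \<Longrightarrow> 0 < x \<Longrightarrow> 0 \<le> F t x"
  unfolding F_def by (intro divide_nonneg_nonneg f_nonneg) auto

lemma Fc_nonneg: "0 < a \<Longrightarrow> a \<le> 1 \<Longrightarrow> 0 \<le> Fc a t x"
  unfolding Fc_def using clamp_bounds[of a x] by (intro F_nonneg) auto

lemma F_le:
  assumes "0 \<le> t" "0 < x" "h t \<le> K"
  shows "F t x \<le> K * (x + 1 / x) / 2"
proof -
  have "f t (x\<^sup>2) \<le> h t * (x\<^sup>2 + 1)" using assms by (intro f_le_h) auto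
  also have "\<dots> \<le> K * (x\<^sup>2 + 1)" using assms(3) by (intro mult_right_mono) auto
  finally have "F t x \<le> K * (x\<^sup>2 + 1) / (2 * x)" unfolding F_def using assms by (intro divide_right_mono) auto
  also have "\<dots> = K * (x + 1 / x) / 2" using assms by (simp add: field_simps power2_eq_square)
  finally show ?thesis .
qed

text \<open>Write \<open>F t x\<close> as \<open>x / 2\<close> times the ratio
  \<open>f t z / z\<close> at \<open>z = x\<^sup>2\<close>. The ratio does not increase in
  \<open>x\<close>, so an increment of \<open>F\<close> is at most half the increment of
  \<open>x\<close> times the ratio at the left end, and linear growth bounds that by
  \<open>K * (1 + 1 / a\<^sup>2)\<close>. Since \<open>clamp a\<close> is monotone and does not
  expand distances, the estimate survives truncation.\<close>

lemma Fc_drift: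
  assumes a: "0 < a" "a \<le> 1"
  shows "one_sided_lipschitz_drift (Fc a)"
proof
  have "continuous_on UNIV (\<lambda>p. F (max 0 (fst p)) (clamp a (snd p)))"
    unfolding F_def
    by (intro continuous_intros f_comp)
      (use clamp_bounds[OF a] a in \<open>auto simp: clamp_def intro!: continuous_intros\<close>)
  then show "continuous_on UNIV (\<lambda>(t, x). Fc a t x)" by (simp add: Fc_def split_def)
next
  fix T
  obtain K where K: "0 < K" "\<And>t. t \<in> {0..T} \<Longrightarrow> h t \<le> K" using h_bound by blast
  have "\<bar>Fc a t x\<bar> \<le> K * (1 / a + 1 / a) / 2" if t: "t \<in> {0..T}" for t x
  proof -
    note cb = clamp_bounds[OF a, of x]
    have "Fc a t x \<le> K * (clamp a x + 1 / clamp a x) / 2"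
      unfolding Fc_def using t cb a K(2)[OF t] by (intro F_le) (auto simp: max_def)
    also have "\<dots> \<le> K * (1 / a + 1 / a) / 2"
      using cb a K(1) by (intro divide_right_mono mult_left_mono add_mono frac_le) auto
    finally show ?thesis using Fc_nonneg[OF a] by simp
  qed
  then show "\<exists>K. \<forall>t\<in>{0..T}. \<forall>x. \<bar>Fc a t x\<bar> \<le> K" by blast
  have "Fc a t y - Fc a t x \<le> K * (1 + 1 / a\<^sup>2) * (y - x)" if t: "t \<in> {0..T}" and "x \<le> y" for t x y
  proof -
    define x' y' where "x' = clamp a x" and "y' = clamp a y"
    have xy: "x' \<le> y'" "y' - x' \<le> y - x" using \<open>x \<le> y\<close> by (auto simp: x'_def y'_def clamp_def max_def min_def)
    have x': "a \<le> x'" "0 < x'" "0 < y'" using clamp_bounds[OF a, of x] xy a by (auto simp: x'_def)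
    define \<phi> where "\<phi> = f t (x'\<^sup>2) / x'\<^sup>2"
    have "f t (y'\<^sup>2) / y'\<^sup>2 \<le> \<phi>"
      unfolding \<phi>_def using t xy x' by (intro f_over_x_antimono power_mono) auto
    then have "y' / 2 * (f t (y'\<^sup>2) / y'\<^sup>2) \<le> y' / 2 * \<phi>" using x' by (intro mult_left_mono) auto
    moreover have "F t y' = y' / 2 * (f t (y'\<^sup>2) / y'\<^sup>2)" "F t x' = x' / 2 * \<phi>"
      using x' by (simp_all add: F_def \<phi>_def power2_eq_square)
    ultimately have "F t y' - F t x' \<le> (y' - x') / 2 * \<phi>" by (simp add: field_simps)
    also have "\<phi> \<le> K * (1 + 1 / a\<^sup>2)"
    proof -
      have "f t (x'\<^sup>2) \<le> h t * (x'\<^sup>2 + 1)" using t x' by (intro f_le_h) auto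
      also have "\<dots> \<le> K * (x'\<^sup>2 + 1)" using K(2)[OF t] by (intro mult_right_mono) auto
      finally have "\<phi> \<le> K * (x'\<^sup>2 + 1) / x'\<^sup>2" unfolding \<phi>_def by (intro divide_right_mono) auto
      also have "\<dots> = K * (1 + 1 / x'\<^sup>2)" using x' by (simp add: field_simps)
      also have "\<dots> \<le> K * (1 + 1 / a\<^sup>2)"
        using x' a K(1) by (intro mult_left_mono add_left_mono frac_le power_mono) auto
      finally show ?thesis .
    qed
    then have "(y' - x') / 2 * \<phi> \<le> (y' - x') / 2 * (K * (1 + 1 / a\<^sup>2))" using xy by (intro mult_left_mono) auto
    also have "\<dots> \<le> (y - x) * (K * (1 + 1 / a\<^sup>2))" using xy K(1) by (intro mult_right_mono) auto
    finally show ?thesis using t by (simp add: Fc_def x'_def y'_def max_def mult.commute)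
  qed
  moreover have "0 < K * (1 + 1 / a\<^sup>2)" using K(1) by (simp add: add_pos_nonneg)
  ultimately show "\<exists>L>0. \<forall>t\<in>{0..T}. \<forall>x y. x \<le> y \<longrightarrow> Fc a t y - Fc a t x \<le> L * (y - x)" by blast
qed

section \<open>Truncated solutions and their a priori bounds\<close>

definition solves :: "real \<Rightarrow> (real \<Rightarrow> real) \<Rightarrow> real \<Rightarrow> real \<Rightarrow> (real \<Rightarrow> real) \<Rightarrow> bool" where
  "solves x0 b T a X \<longleftrightarrow> continuous_on {0..T} X \<and>
     (\<forall>t\<in>{0..T}. X t = x0 + integral {0..t} (\<lambda>r. Fc a r (X r)) + b t)"

lemma solves_unique:
  assumes "0 < a" "a \<le> 1" "solves x0 b T a X" "solves x0 b T a Z" "t \<in> {0..T}"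
  shows "X t = Z t"
proof -
  interpret one_sided_lipschitz_drift "Fc a" by (rule Fc_drift[OF assms(1,2)])
  show ?thesis using assms(3-5) unfolding solves_def by (intro solution_unique[of T X Z x0 b]) auto
qed

text \<open>A path confined to \<open>[a, 1 / a]\<close> does not feel the truncation at
  \<open>a\<close> nor at any smaller level. This makes solutions at different levels comparable by
  uniqueness.\<close>

lemma solves_mono:
  assumes X: "solves x0 b T a X" and "0 < a'" "a' \<le> a" and bnd: "\<And>t. t \<in> {0..T} \<Longrightarrow> a \<le> X t \<and> X t \<le> 1 / a"
  shows "solves x0 b T a' X"
proof -
  have "1 / a \<le> 1 / a'" using assms by (intro frac_le) auto
  have "integral {0..t} (\<lambda>r. Fc a r (X r)) = integral {0..t} (\<lambda>r. Fc a' r (X r))" if "t \<in> {0..T}" for t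
  proof (intro integral_cong)
    fix r assume r: "r \<in> {0..t}"
    then have "a \<le> X r" "X r \<le> 1 / a" using bnd[of r] that by auto
    then show "Fc a r (X r) = Fc a' r (X r)"
      using r \<open>1 / a \<le> 1 / a'\<close> \<open>a' \<le> a\<close> by (simp add: Fc_eq_F)
  qed
  then show ?thesis using X by (simp add: solves_def)
qed

lemma solves_increment:
  assumes a: "0 < a" "a \<le> 1" and X: "solves x0 b T a X" and "0 \<le> s" "s \<le> t" "t \<le> T"
  shows "X t - X s = integral {s..t} (\<lambda>r. Fc a r (X r)) + (b t - b s)"
    and "(\<lambda>r. Fc a r (X r)) integrable_on {s..t}"
proof -
  interpret one_sided_lipschitz_drift "Fc a" by (rule Fc_drift[OF a])
  have c: "continuous_on {0..T} (\<lambda>r. Fc a r (X r))"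
    using X by (intro D_comp continuous_intros) (auto simp: solves_def)
  have int: "(\<lambda>r. Fc a r (X r)) integrable_on {u..v}" if "0 \<le> u" "v \<le> T" for u v
    using that by (intro integrable_continuous_interval continuous_on_subset[OF c]) auto
  then show "(\<lambda>r. Fc a r (X r)) integrable_on {s..t}" using assms by auto
  have "integral {0..s} (\<lambda>r. Fc a r (X r)) + integral {s..t} (\<lambda>r. Fc a r (X r)) = integral {0..t} (\<lambda>r. Fc a r (X r))"
    using assms by (intro Henstock_Kurzweil_Integration.integral_combine int) auto
  then show "X t - X s = integral {s..t} (\<lambda>r. Fc a r (X r)) + (b t - b s)"
    using X assms by (simp add: solves_def)
qed

text \<open>
  If the solution first reaches \<open>\<epsilon> = C r\<^sup>\<beta>\<close> at time \<open>t\<close>, then \<open>X \<le> 2\<epsilon>\<close> on \<open>[t - r, t]\<close>, so the drift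
  contributes at least \<open>r c/(4\<epsilon>)\<close> there, which exceeds \<open>2\<epsilon>\<close> for small \<open>r\<close> because \<open>2\<beta> > 1\<close>.
\<close>

lemma solution_lower_bound:
  assumes "0 < x0" "1 / 2 < \<beta>" "b 0 = 0" and hold: "holder_on \<beta> {0..T} b"
  obtains \<epsilon> where "0 < \<epsilon>" "\<And>a X t. 0 < a \<Longrightarrow> a \<le> \<epsilon> \<Longrightarrow> a \<le> 1 \<Longrightarrow> solves x0 b T a X \<Longrightarrow> t \<in> {0..T} \<Longrightarrow> \<epsilon> \<le> X t"
proof -
  obtain C where C: "0 < C" "\<And>s t. s \<in> {0..T} \<Longrightarrow> t \<in> {0..T} \<Longrightarrow> \<bar>b t - b s\<bar> \<le> C * \<bar>t - s\<bar> powr \<beta>"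
    using holder_onE[OF hold] by blast
  have "\<forall>\<^sub>F r in at_right 0. r powr \<beta> < x0 / (2 * C) \<and> 0 < r"
    using eventually_powr_less[of \<beta> "x0 / (2 * C)"] assms(1,2) C(1) eventually_at_right_less[of "0::real"]
    by (intro eventually_conj) auto
  \<comment> \<open>Up to time \<open>\<delta>\<close> the noise stays below \<open>x0 / 2\<close>
    in size and the drift only pushes upwards, so a level below \<open>x0 / 2\<close> is not
    reached. This keeps the hitting time away from 0, where \<open>g\<close> may vanish.\<close>
  then obtain \<delta> :: real where \<delta>: "0 < \<delta>" "\<delta> powr \<beta> < x0 / (2 * C)"
    by (blast dest: eventually_happens'[OF trivial_limit_at_right_real])
  \<comment> \<open>Starting at \<open>\<delta> / 2\<close> leaves room for a backward window of
    length \<open>r < \<delta> / 2\<close>; the \<open>max\<close> keeps \<open>J\<close> nonempty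
    when \<open>T\<close> is small.\<close>
  define J where "J = {\<delta> / 2..max (\<delta> / 2) T}"
  have "continuous_on J g" using \<delta>(1) by (intro continuous_on_subset[OF g_cont]) (auto simp: J_def)
  then obtain t0 where t0: "t0 \<in> J" "\<And>t. t \<in> J \<Longrightarrow> g t0 \<le> g t"
    using continuous_attains_inf[of J g] by (auto simp: J_def)
  define c where "c = g t0"
  have "0 < c" unfolding c_def using t0(1) \<delta>(1) by (intro g_pos) (auto simp: J_def)
  have "\<forall>\<^sub>F r in at_right 0. r powr (2 * \<beta> - 1) < c / (8 * C\<^sup>2) \<and> r powr \<beta> < sqrt x1 / (2 * C) \<and> 0 < r \<and> r < \<delta> / 2"
    using eventually_powr_less[of "2 * \<beta> - 1" "c / (8 * C\<^sup>2)"] eventually_powr_less[of \<beta> "sqrt x1 / (2 * C)"]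
      assms(2) C(1) \<open>0 < c\<close> x1_pos \<delta>(1) eventually_at_right_less[of "0::real"] eventually_at_right_field[of "\<lambda>r. r < \<delta> / 2" 0]
    by (intro eventually_conj) (auto intro!: exI[of _ "\<delta> / 2"])
  \<comment> \<open>The bound on \<open>r powr (2 * \<beta> - 1)\<close> becomes
    \<open>8 * \<epsilon>\<^sup>2 < c * r\<close>; the bound by \<open>sqrt x1\<close> becomes
    \<open>2 * \<epsilon> < sqrt x1\<close>, so that squares of values up to
    \<open>2 * \<epsilon>\<close> lie where \<open>f\<close> dominates \<open>g\<close>. None of
    these choices involves \<open>a\<close>.\<close>
  then obtain r :: real where r: "0 < r" "r < \<delta> / 2" "r powr (2 * \<beta> - 1) < c / (8 * C\<^sup>2)" "r powr \<beta> < sqrt x1 / (2 * C)"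
    by (blast dest: eventually_happens'[OF trivial_limit_at_right_real])
  define \<epsilon> where "\<epsilon> = C * r powr \<beta>"
  have "0 < \<epsilon>" using C(1) r(1) by (simp add: \<epsilon>_def)
  have e1: "2 * \<epsilon> < sqrt x1" using r(4) C(1) by (simp add: \<epsilon>_def field_simps)
  have "r powr \<beta> \<le> \<delta> powr \<beta>" using r \<delta>(1) assms(2) by (intro powr_mono2) auto
  then have "r powr \<beta> < x0 / (2 * C)" using \<delta>(2) by simp
  then have e2: "\<epsilon> < x0 / 2" using C(1) by (simp add: \<epsilon>_def field_simps)
  have "r powr (2 * \<beta>) = r powr (2 * \<beta> - 1) * r" using r(1) by (simp add: powr_diff)
  moreover have "\<epsilon>\<^sup>2 = C\<^sup>2 * r powr (2 * \<beta>)"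
    unfolding \<epsilon>_def power_mult_distrib by (simp add: power2_eq_square flip: powr_add)
  moreover have "8 * C\<^sup>2 * r powr (2 * \<beta> - 1) * r < c * r"
    using r(1,3) C(1) by (intro mult_strict_right_mono) (auto simp: field_simps)
  ultimately have e3: "8 * \<epsilon>\<^sup>2 < c * r" by (simp add: mult.assoc)
  show thesis
  proof (rule that[OF \<open>0 < \<epsilon>\<close>], rule ccontr)
    fix a X t' assume a: "0 < a" "a \<le> \<epsilon>" "a \<le> 1" and X: "solves x0 b T a X"
      and t': "t' \<in> {0..T}" "\<not> \<epsilon> \<le> X t'"
    note inc = solves_increment[OF a(1,3) X]
    define S where "S = {t \<in> {0..T}. X t \<le> \<epsilon>}"
    have "continuous_on {0..T} X" using X by (simp add: solves_def)
    then have "compact S"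
      using continuous_on_closed_Collect_le[OF _ continuous_on_const closed_atLeastAtMost, of 0 T X \<epsilon>]
      by (auto simp: S_def compact_eq_bounded_closed intro: bounded_subset[OF bounded_closed_interval[of 0 T]])
    moreover have "t' \<in> S" using t' by (simp add: S_def)
    then have "S \<noteq> {}" by blast
    ultimately obtain t where t: "t \<in> S" "\<And>s. s \<in> S \<Longrightarrow> t \<le> s"
      using compact_attains_inf[of S] by metis
    have tT: "0 \<le> t" "t \<le> T" "X t \<le> \<epsilon>" using t(1) by (auto simp: S_def)
    have "\<delta> \<le> t"
    proof (rule ccontr)
      assume "\<not> \<delta> \<le> t"
      have "\<bar>b t - b 0\<bar> \<le> C * \<bar>t - 0\<bar> powr \<beta>" using tT by (intro C(2)) auto
      also have "\<dots> \<le> C * \<delta> powr \<beta>"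
        using \<open>\<not> \<delta> \<le> t\<close> tT assms(2) C(1) by (intro mult_left_mono powr_mono2) auto
      also have "\<dots> < x0 / 2" using \<delta>(2) C(1) by (simp add: field_simps)
      finally have "\<bar>b t\<bar> < x0 / 2" using assms(3) by simp
      moreover have "0 \<le> integral {0..t} (\<lambda>r. Fc a r (X r))"
        using inc(2)[of 0 t] tT Fc_nonneg a by (intro integral_nonneg) auto
      moreover have "X t = x0 + integral {0..t} (\<lambda>r. Fc a r (X r)) + b t" using X tT by (simp add: solves_def)
      ultimately show False using e2 tT by linarith
    qed
    define s where "s = t - r"
    have s: "\<delta> / 2 \<le> s" "s < t" "0 \<le> s" using r \<open>\<delta> \<le> t\<close> \<delta>(1) by (auto simp: s_def)
    have "s \<notin> S" using t(2) s(2) by force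
    then have "\<epsilon> < X s" using s tT by (auto simp: S_def)
    have close: "\<bar>b t - b u\<bar> \<le> \<epsilon>" if "u \<in> {s..t}" for u
    proof -
      have "\<bar>b t - b u\<bar> \<le> C * \<bar>t - u\<bar> powr \<beta>" using that tT s by (intro C(2)) auto
      also have "\<dots> \<le> \<epsilon>" unfolding \<epsilon>_def using that assms(2) C(1) r(1)
        by (intro mult_left_mono powr_mono2) (auto simp: s_def)
      finally show ?thesis .
    qed
    have "c / (4 * \<epsilon>) \<le> Fc a u (X u)" if u: "u \<in> {s..t}" for u
    proof -
      have "0 \<le> integral {u..t} (\<lambda>r. Fc a r (X r))"
        using inc(2)[of u t] u s tT Fc_nonneg a by (intro integral_nonneg) auto
      then have "X u \<le> 2 * \<epsilon>" using inc(1)[of u t] close[OF u] u s tT by auto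
      \<comment> \<open>Because \<open>a \<le> \<epsilon>\<close>, the lower cut-off cannot lift the
        value above \<open>2 * \<epsilon>\<close>.\<close>
      define y where "y = clamp a (X u)"
      have y: "0 < y" "y \<le> 2 * \<epsilon>" using \<open>X u \<le> 2 * \<epsilon>\<close> a \<open>0 < \<epsilon>\<close> by (auto simp: y_def clamp_def)
      then have "y < sqrt x1" using e1 by simp
      then have "y\<^sup>2 < x1" using power_strict_mono[of y "sqrt x1" 2] y x1_pos by simp
      have "u \<in> J" using u s tT by (auto simp: J_def)
      have "c \<le> f u (y\<^sup>2)"
        using f_ge_g[of u "y\<^sup>2"] t0(2)[OF \<open>u \<in> J\<close>] \<open>y\<^sup>2 < x1\<close> y u s \<delta>(1) by (auto simp: c_def)
      then have "c / (4 * \<epsilon>) \<le> f u (y\<^sup>2) / (2 * y)"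
        using y \<open>0 < c\<close> \<open>0 < \<epsilon>\<close> by (intro frac_le) auto
      then show ?thesis using u s by (simp add: Fc_def F_def y_def max_def)
    qed
    then have "integral {s..t} (\<lambda>_. c / (4 * \<epsilon>)) \<le> integral {s..t} (\<lambda>r. Fc a r (X r))"
      using inc(2)[of s t] s tT by (intro integral_le) auto
    moreover have "integral {s..t} (\<lambda>_. c / (4 * \<epsilon>)) = r * (c / (4 * \<epsilon>))" using s by (simp add: s_def)
    moreover have "2 * \<epsilon> < r * (c / (4 * \<epsilon>))" using e3 \<open>0 < \<epsilon>\<close> by (simp add: field_simps power2_eq_square)
    moreover have "X t - X s = integral {s..t} (\<lambda>r. Fc a r (X r)) + (b t - b s)" using s tT by (intro inc) auto
    moreover have "\<bar>b t - b s\<bar> \<le> \<epsilon>" using s by (intro close) auto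
    ultimately show False using tT(3) \<open>\<epsilon> < X s\<close> by linarith
  qed
qed

text \<open>The function \<open>\<phi>\<close> is differentiable and majorises \<open>X\<close>.
  Above the threshold \<open>x0 + 1 + 2 * S\<close> it forces \<open>X \<ge> 1\<close>, where
  \<open>(x + 1 / x) / 2 \<le> x\<close> turns the singular bound on the drift into linear growth.
  Hence the estimate does not depend on \<open>a\<close>.\<close>

lemma solution_upper_bound:
  assumes a: "0 < a" "a \<le> 1" and X: "solves x0 b T a X" and "0 < x0"
    and K: "0 < K" "\<And>t. t \<in> {0..T} \<Longrightarrow> h t \<le> K"
    and S: "\<And>t. t \<in> {0..T} \<Longrightarrow> \<bar>b t\<bar> \<le> S" and t: "t \<in> {0..T}"
  shows "X t \<le> (x0 + 1 + 2 * S) * exp (K * t)"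
proof -
  interpret one_sided_lipschitz_drift "Fc a" by (rule Fc_drift[OF a])
  have Xc: "continuous_on {0..T} X" and Xeq: "\<And>t. t \<in> {0..T} \<Longrightarrow> X t = x0 + integral {0..t} (\<lambda>r. Fc a r (X r)) + b t"
    using X by (auto simp: solves_def)
  have c: "continuous_on {0..T} (\<lambda>r. Fc a r (X r))" by (intro D_comp continuous_intros Xc)
  have "0 \<le> S" using S[OF t] by linarith
  define \<phi> where "\<phi> = (\<lambda>s. x0 + S + integral {0..s} (\<lambda>r. Fc a r (X r)))"
  have "\<phi> t \<le> (x0 + 1 + 2 * S + 0 / K) * exp (K * t) - 0 / K"
  proof (rule one_sided_gronwall)
    show "continuous_on {0..t} \<phi>" unfolding \<phi>_def using t
      by (intro continuous_intros indefinite_integral_continuous_1 integrable_continuous_interval continuous_on_subset[OF c]) auto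
    fix s assume s: "0 < s" "s < t" "x0 + 1 + 2 * S < \<phi> s"
    have sT: "s \<in> {0..T}" using s t by auto
    have "X s = \<phi> s + b s - S" using Xeq[OF sT] by (simp add: \<phi>_def)
    then have X1: "1 \<le> X s" "X s \<le> \<phi> s" using S[OF sT] s(3) \<open>0 < x0\<close> by auto
    define y where "y = clamp a (X s)"
    have "1 \<le> 1 / a" using a by simp
    then have y: "1 \<le> y" "y \<le> X s" using X1 a by (auto simp: y_def clamp_def le_max_iff_disj)
    define w where "w = 1 / y"
    have "w \<le> 1" using y by (simp add: w_def)
    then have "(y + w) / 2 \<le> y" using y by simp
    then have "K * ((y + w) / 2) \<le> K * y" using K(1) by (intro mult_left_mono) auto
    moreover have "F s y \<le> K * (y + w) / 2" unfolding w_def using y K(2)[OF sT] sT by (intro F_le) auto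
    ultimately have "F s y \<le> K * y" by simp
    also have "\<dots> \<le> K * \<phi> s" using y X1 K(1) by (intro mult_left_mono) auto
    finally have "Fc a s (X s) \<le> K * \<phi> s + 0" using s by (simp add: Fc_def y_def max_def)
    moreover have "(\<phi> has_real_derivative 0 + Fc a s (X s)) (at s)"
      unfolding \<phi>_def using s t by (intro DERIV_add DERIV_const indefinite_integral_derivative[OF c]) auto
    ultimately show "\<exists>d\<le>K * \<phi> s + 0. (\<phi> has_real_derivative d) (at s)" by auto
  qed (use t K \<open>0 \<le> S\<close> \<open>0 < x0\<close> in \<open>auto simp: \<phi>_def\<close>)
  moreover have "X t \<le> \<phi> t" using Xeq[OF t] S[OF t] by (simp add: \<phi>_def)
  ultimately show ?thesis by simp
qed

section \<open>The solution without truncation\<close>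

definition sol :: "real \<Rightarrow> (real \<Rightarrow> real) \<Rightarrow> real \<Rightarrow> real" where
  "sol x0 b t = lim (\<lambda>n. ode_flow (Fc (1 / real (Suc n))) x0 b t)"

text \<open>The a priori bounds hold for all small truncation levels at once, so one
  \<open>a\<close> below them is never felt on \<open>{0..T}\<close>. Uniqueness identifies the
  flows at all smaller levels with this one, and the sequence defining \<open>sol\<close> is
  eventually constant. The level depends on \<open>b\<close> and \<open>T\<close>, but
  \<open>sol\<close> does not depend on the level.\<close>

lemma sol_solves:
  assumes "0 < x0" "1 / 2 < \<beta>" "continuous_on UNIV b" "\<And>t. t \<le> 0 \<Longrightarrow> b t = 0"
    and hold: "holder_on \<beta> {0..T} b"
  obtains a where "0 < a" "a \<le> 1" "solves x0 b T a (sol x0 b)"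
    "\<And>t. t \<in> {0..T} \<Longrightarrow> a \<le> sol x0 b t \<and> sol x0 b t \<le> 1 / a"
proof -
  obtain \<epsilon> where \<epsilon>: "0 < \<epsilon>" "\<And>a X t. 0 < a \<Longrightarrow> a \<le> \<epsilon> \<Longrightarrow> a \<le> 1 \<Longrightarrow> solves x0 b T a X \<Longrightarrow> t \<in> {0..T} \<Longrightarrow> \<epsilon> \<le> X t"
    using solution_lower_bound[OF assms(1,2) assms(4)[OF order_refl] hold] by blast
  obtain K where K: "0 < K" "\<And>t. t \<in> {0..T} \<Longrightarrow> h t \<le> K" using h_bound by blast
  have "bounded (b ` {0..T})"
    by (intro compact_imp_bounded compact_continuous_image continuous_on_subset[OF assms(3)]) auto
  then obtain S where S: "0 < S" "\<And>t. t \<in> {0..T} \<Longrightarrow> \<bar>b t\<bar> \<le> S" by (auto simp: bounded_pos)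
  define U where "U = (x0 + 1 + 2 * S) * exp (K * \<bar>T\<bar>)"
  have "0 < U" using assms(1) S(1) by (auto simp: U_def)
  define a where "a = min 1 (min \<epsilon> (1 / U))"
  have "a \<le> 1 / U" "0 < a" using \<epsilon>(1) \<open>0 < U\<close> by (auto simp: a_def)
  then have "a * U \<le> 1" using \<open>0 < U\<close> by (simp add: pos_le_divide_eq)
  then have a: "0 < a" "a \<le> 1" "a \<le> \<epsilon>" "U \<le> 1 / a"
    using \<open>0 < a\<close> by (auto simp: a_def pos_le_divide_eq mult.commute)
  have flow: "solves x0 b T a' (ode_flow (Fc a') x0 b)" if "0 < a'" "a' \<le> 1" for a'
  proof -
    interpret one_sided_lipschitz_drift "Fc a'" by (rule Fc_drift[OF that])
    interpret driven_ode "Fc a'" b x0 by standard (use assms in auto)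
    show ?thesis unfolding solves_def using flow_cont flow_equation(2) by auto
  qed
  define X where "X = ode_flow (Fc a) x0 b"
  have X: "solves x0 b T a X" unfolding X_def by (rule flow[OF a(1,2)])
  have bnd: "a \<le> X t \<and> X t \<le> 1 / a" if t: "t \<in> {0..T}" for t
  proof -
    have "\<epsilon> \<le> X t" by (rule \<epsilon>(2)[OF a(1,3,2) X t])
    moreover have "X t \<le> (x0 + 1 + 2 * S) * exp (K * t)"
      by (rule solution_upper_bound[OF a(1,2) X assms(1) K S(2) t])
    moreover have "\<dots> \<le> U" unfolding U_def using t K(1) S(1) assms(1) by (intro mult_left_mono) auto
    ultimately show ?thesis using a by linarith
  qed
  have eq: "ode_flow (Fc a') x0 b t = X t" if "0 < a'" "a' \<le> a" "t \<in> {0..T}" for a' t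
    by (rule solves_unique[OF _ _ flow solves_mono[OF X _ _ bnd]]) (use that a in auto)
  have sol: "sol x0 b t = X t" if t: "t \<in> {0..T}" for t
  proof -
    have "\<forall>\<^sub>F n in sequentially. 1 / real (Suc n) < a"
      using LIMSEQ_inverse_real_of_nat a(1) by (intro order_tendstoD) (auto simp: inverse_eq_divide)
    then have "\<forall>\<^sub>F n in sequentially. ode_flow (Fc (1 / real (Suc n))) x0 b t = X t"
      by eventually_elim (use t in \<open>auto intro!: eq\<close>)
    then have "(\<lambda>n. ode_flow (Fc (1 / real (Suc n))) x0 b t) \<longlonglongrightarrow> X t" by (rule tendsto_eventually)
    then show ?thesis unfolding sol_def by (rule limI)
  qed
  have "solves x0 b T a (sol x0 b)"
    unfolding solves_def
  proof (intro conjI ballI)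
    show "continuous_on {0..T} (sol x0 b)"
      by (rule continuous_on_eq[of _ X]) (use X sol in \<open>auto simp: solves_def\<close>)
    fix t assume t: "t \<in> {0..T}"
    have "integral {0..t} (\<lambda>r. Fc a r (sol x0 b r)) = integral {0..t} (\<lambda>r. Fc a r (X r))"
      by (intro integral_cong) (use t sol in auto)
    then show "sol x0 b t = x0 + integral {0..t} (\<lambda>r. Fc a r (sol x0 b r)) + b t"
      using X sol[OF t] t by (auto simp: solves_def)
  qed
  then show ?thesis using that a bnd sol by metis
qed

text \<open>A positive continuous path on a compact interval attains a positive minimum and a
  maximum, so it solves the truncated equation at some level \<open>a'\<close>, where uniqueness
  applies.\<close>

lemma sol_unique:
  assumes "0 < x0" "1 / 2 < \<beta>" "continuous_on UNIV b" "\<And>t. t \<le> 0 \<Longrightarrow> b t = 0"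
    and "holder_on \<beta> {0..T} b"
    and Uc: "continuous_on {0..T} U" and Upos: "\<And>t. t \<in> {0..T} \<Longrightarrow> 0 < U t"
    and Ueq: "\<And>t. t \<in> {0..T} \<Longrightarrow> U t = x0 + integral {0..t} (\<lambda>r. F r (U r)) + b t"
    and t: "t \<in> {0..T}"
  shows "U t = sol x0 b t"
proof -
  obtain a where a: "0 < a" "a \<le> 1" "solves x0 b T a (sol x0 b)"
    "\<And>t. t \<in> {0..T} \<Longrightarrow> a \<le> sol x0 b t \<and> sol x0 b t \<le> 1 / a" using sol_solves[OF assms(1-5)] by blast
  obtain s where s: "s \<in> {0..T}" "\<And>t. t \<in> {0..T} \<Longrightarrow> U s \<le> U t"
    using continuous_attains_inf[OF compact_Icc _ Uc] t by auto
  obtain v where v: "v \<in> {0..T}" "\<And>t. t \<in> {0..T} \<Longrightarrow> U t \<le> U v"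
    using continuous_attains_sup[OF compact_Icc _ Uc] t by auto
  define a' where "a' = min a (min (U s) (1 / U v))"
  have "a' \<le> 1 / U v" "0 < a'" using a(1) Upos[OF s(1)] Upos[OF v(1)] by (auto simp: a'_def)
  then have "a' * U v \<le> 1" using Upos[OF v(1)] by (simp add: pos_le_divide_eq)
  then have a': "0 < a'" "a' \<le> a" "a' \<le> U s" "U v \<le> 1 / a'"
    using \<open>0 < a'\<close> by (auto simp: a'_def pos_le_divide_eq mult.commute)
  have "integral {0..t} (\<lambda>r. F r (U r)) = integral {0..t} (\<lambda>r. Fc a' r (U r))" if "t \<in> {0..T}" for t
  proof (intro integral_cong)
    fix r assume "r \<in> {0..t}"
    then show "F r (U r) = Fc a' r (U r)" using s(2)[of r] v(2)[of r] a' that by (subst Fc_eq_F) auto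
  qed
  then have U: "solves x0 b T a' U" using Uc Ueq by (simp add: solves_def)
  show ?thesis
    by (rule solves_unique[OF a'(1) _ U solves_mono[OF a(3) a'(1,2) a(4)] t]) (use a a' in auto)
qed

lemma sol_le:
  assumes "0 < x0" "1 / 2 < \<beta>" "continuous_on UNIV b" "\<And>t. t \<le> 0 \<Longrightarrow> b t = 0"
    and "holder_on \<beta> {0..T} b"
    and K: "0 < K" "\<And>t. t \<in> {0..T} \<Longrightarrow> h t \<le> K"
    and S: "\<And>t. t \<in> {0..T} \<Longrightarrow> \<bar>b t\<bar> \<le> S" and t: "t \<in> {0..T}"
  shows "sol x0 b t \<le> (x0 + 1 + 2 * S) * exp (K * t)"
proof -
  obtain a where a: "0 < a" "a \<le> 1" "solves x0 b T a (sol x0 b)" using sol_solves[OF assms(1-5)] by blast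
  show ?thesis by (rule solution_upper_bound[OF a assms(1) K S t])
qed

lemma sol_measurable:
  fixes b :: "'a \<Rightarrow> real \<Rightarrow> real"
  assumes "\<And>t. (\<lambda>\<omega>. b \<omega> t) \<in> borel_measurable M"
    and "\<And>\<omega>. continuous_on UNIV (b \<omega>)" "\<And>\<omega> t. t \<le> 0 \<Longrightarrow> b \<omega> t = 0"
  shows "(\<lambda>\<omega>. sol x0 (b \<omega>) t) \<in> borel_measurable M"
  unfolding sol_def
proof (rule borel_measurable_lim_metric)
  fix n
  interpret one_sided_lipschitz_drift "Fc (1 / real (Suc n))" by (rule Fc_drift) auto
  show "(\<lambda>\<omega>. ode_flow (Fc (1 / real (Suc n))) x0 (b \<omega>) t) \<in> borel_measurable M"
    by (rule ode_flow_measurable[OF assms(1)]) (unfold_locales, use assms in auto)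
qed

end

section \<open>The chain rule for Young integrals\<close>

lemma has_RS_integral_cong:
  assumes I: "has_RS_integral u v a b I"
    and eq: "\<And>x. x \<in> {a..b} \<Longrightarrow> u' x = u x" "\<And>x. x \<in> {a..b} \<Longrightarrow> v' x = v x"
  shows "has_RS_integral u' v' a b I"
proof -
  have *: "(\<Sum>(x, k)\<in>p. u' x * (v' (Sup k) - v' (Inf k))) = (\<Sum>(x, k)\<in>p. u x * (v (Sup k) - v (Inf k)))"
    if p: "p tagged_division_of {a..b}" for p
  proof (intro sum.cong refl, clarify)
    fix x k assume "(x, k) \<in> p"
    then obtain c d where "a \<le> c" "c \<le> x" "x \<le> d" "d \<le> b" "Inf k = c" "Sup k = d"
      using tagged_division_real_piece[OF p] by metis
    then show "u' x * (v' (Sup k) - v' (Inf k)) = u x * (v (Sup k) - v (Inf k))"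
      using eq(1)[of x] eq(2)[of c] eq(2)[of d] by simp
  qed
  show ?thesis using I unfolding has_RS_integral_def by (simp add: * cong: imp_cong)
qed

lemma has_RS_integral_degenerate:
  assumes "has_RS_integral u v a a I"
  shows "I = 0"
proof (rule ccontr)
  assume "I \<noteq> 0"
  then obtain \<delta> where "0 < \<delta>" and \<delta>: "\<And>p. p tagged_division_of {a..a} \<Longrightarrow>
    (\<And>x k. (x, k) \<in> p \<Longrightarrow> Sup k - Inf k < \<delta>) \<Longrightarrow> \<bar>rs_sum u v p - I\<bar> < \<bar>I\<bar>"
    using has_RS_integralD[OF assms, of "\<bar>I\<bar>"] by (metis zero_less_abs_iff)
  have "\<bar>rs_sum u v {(a, {a..a})} - I\<bar> < \<bar>I\<bar>"
    using tagged_division_of_self_real[of a a a] \<open>0 < \<delta>\<close> by (intro \<delta>) auto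
  then show False by (simp add: rs_sum_def)
qed

text \<open>This lowers Lipschitz terms coming from the drift to Hoelder order, so that they combine
  with those of the noise.\<close>

lemma le_powr_of_le:
  assumes "0 \<le> l" "l \<le> T" "\<beta> \<le> (1::real)"
  shows "l \<le> T powr (1 - \<beta>) * l powr \<beta>"
proof (cases "l = 0")
  case False
  then have "l = l powr (1 - \<beta>) * l powr \<beta>" using assms(1) by (simp flip: powr_add)
  also have "\<dots> \<le> T powr (1 - \<beta>) * l powr \<beta>" using assms by (intro mult_right_mono powr_mono2) auto
  finally show ?thesis .
qed simp

lemma continuous_on_interval_bound:
  fixes \<phi> :: "real \<Rightarrow> real"
  assumes "continuous_on {0..T} \<phi>"
  obtains K where "0 < K" "\<And>t. t \<in> {0..T} \<Longrightarrow> \<bar>\<phi> t\<bar> \<le> K"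
proof -
  have "bounded (\<phi> ` {0..T})" by (intro compact_imp_bounded compact_continuous_image assms) auto
  then show ?thesis using that by (auto simp: bounded_pos)
qed

lemma integral_increment:
  fixes \<phi> :: "real \<Rightarrow> real"
  assumes "continuous_on {0..T} \<phi>" "0 \<le> c" "c \<le> d" "d \<le> T"
  shows "integral {0..d} \<phi> - integral {0..c} \<phi> = integral {c..d} \<phi>"
  using Henstock_Kurzweil_Integration.integral_combine[of 0 c d \<phi>] assms
    integrable_continuous_interval[OF continuous_on_subset[OF assms(1), of "{0..d}"]] by auto

lemma integral_diff_mult:
  fixes p q :: "real \<Rightarrow> real"
  assumes "continuous_on {c..d} p" "continuous_on {c..d} q"
  shows "integral {c..d} (\<lambda>r. p r - k * q r) = integral {c..d} p - k * integral {c..d} q"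
proof -
  have "p integrable_on {c..d}" "(\<lambda>r. k * q r) integrable_on {c..d}"
    using assms by (auto intro!: integrable_continuous_interval continuous_intros)
  then show ?thesis by (simp add: Henstock_Kurzweil_Integration.integral_diff)
qed

lemma holder_on_continuous:
  assumes "holder_on \<beta> S u" "0 < \<beta>"
  shows "continuous_on S u"
  unfolding continuous_on_def
proof
  fix x assume x: "x \<in> S"
  obtain C where C: "0 < C" "\<And>s t. s \<in> S \<Longrightarrow> t \<in> S \<Longrightarrow> \<bar>u t - u s\<bar> \<le> C * \<bar>t - s\<bar> powr \<beta>"
    using holder_onE[OF assms(1)] by blast
  have "((\<lambda>y. C * \<bar>y - x\<bar> powr \<beta>) \<longlongrightarrow> C * 0) (at x within S)"
    by (intro tendsto_intros tendsto_zero_powrI[of _ _ _ \<beta>]) (use assms(2) in \<open>auto intro!: tendsto_eq_intros\<close>)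
  then have "((\<lambda>y. u y - u x) \<longlongrightarrow> 0) (at x within S)"
    by (intro Lim_null_comparison[of "\<lambda>y. u y - u x" "\<lambda>y. C * \<bar>y - x\<bar> powr \<beta>"])
      (use C(2)[OF x] in \<open>auto simp: eventually_at_filter\<close>)
  then show "(u \<longlongrightarrow> u x) (at x within S)" by (simp add: Lim_null[symmetric])
qed

lemma holder_on_square:
  assumes hold: "holder_on \<gamma> {0..T} u" and "continuous_on {0..T} u"
  shows "holder_on \<gamma> {0..T} (\<lambda>t. (u t)\<^sup>2)"
proof -
  obtain C where C: "0 < C" "\<And>s t. s \<in> {0..T} \<Longrightarrow> t \<in> {0..T} \<Longrightarrow> \<bar>u t - u s\<bar> \<le> C * \<bar>t - s\<bar> powr \<gamma>"
    using holder_onE[OF hold] by blast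
  obtain K where K: "0 < K" "\<And>t. t \<in> {0..T} \<Longrightarrow> \<bar>u t\<bar> \<le> K"
    using continuous_on_interval_bound[OF assms(2)] by blast
  have "\<bar>(u t)\<^sup>2 - (u s)\<^sup>2\<bar> \<le> (2 * K * C) * \<bar>t - s\<bar> powr \<gamma>" if "s \<in> {0..T}" "t \<in> {0..T}" for s t
  proof -
    have "\<bar>(u t)\<^sup>2 - (u s)\<^sup>2\<bar> = \<bar>u t + u s\<bar> * \<bar>u t - u s\<bar>"
      by (simp add: power2_eq_square algebra_simps flip: abs_mult)
    also have "\<dots> \<le> (2 * K) * (C * \<bar>t - s\<bar> powr \<gamma>)"
      using K(2)[OF that(1)] K(2)[OF that(2)] K(1) C(2)[OF that] by (intro mult_mono) auto
    finally show ?thesis by (simp add: mult.assoc)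
  qed
  then show ?thesis unfolding holder_on_def by blast
qed

text \<open>Solving the equation for \<open>v\<close> expresses its increments through
  \<open>X\<close>. The germ then differs from the increment of \<open>(X t)\<^sup>2\<close> minus
  the drift integral by \<open>(2 * X \<xi> - X c - X d) * (X d - X c)\<close> and an integral of
  \<open>2 * (X r - X \<xi>) * \<phi> r\<close>, both of order
  \<open>(d - c) powr (2 * \<beta>)\<close>. So the germ lemma gives the chain rule together with
  existence of the integral.\<close>

lemma young_integral_of_path:
  fixes X v \<phi> :: "real \<Rightarrow> real"
  assumes "0 \<le> T" "1 / 2 < \<beta>" "\<beta> \<le> 1" and hold: "holder_on \<beta> {0..T} X"
    and \<phi>: "continuous_on {0..T} \<phi>"
    and X: "\<And>t. t \<in> {0..T} \<Longrightarrow> X t = x0 + integral {0..t} \<phi> + v t / 2"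
  shows "has_RS_integral X v 0 T ((X T)\<^sup>2 - (X 0)\<^sup>2 - integral {0..T} (\<lambda>r. 2 * X r * \<phi> r))"
proof -
  obtain C where C: "0 < C" "\<And>s t. s \<in> {0..T} \<Longrightarrow> t \<in> {0..T} \<Longrightarrow> \<bar>X t - X s\<bar> \<le> C * \<bar>t - s\<bar> powr \<beta>"
    using holder_onE[OF hold] by blast
  obtain K where K: "0 < K" "\<And>t. t \<in> {0..T} \<Longrightarrow> \<bar>\<phi> t\<bar> \<le> K"
    using continuous_on_interval_bound[OF \<phi>] by blast
  have Xc: "continuous_on {0..T} X" using holder_on_continuous[OF hold] assms(2) by simp
  define J where "J = (\<lambda>t. (X t)\<^sup>2 - integral {0..t} (\<lambda>r. 2 * X r * \<phi> r))"
  define M where "M = 2 * C * C + 2 * C * K * T powr (1 - \<beta>)"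
  have "has_RS_integral X v 0 T (J T - J 0)"
  proof (rule has_RS_integral_of_germ[of 0 T "2 * \<beta>" M])
    fix \<xi> c d assume *: "0 \<le> c" "c \<le> \<xi>" "\<xi> \<le> d" "d \<le> T"
    define l where "l = (d - c) powr \<beta>"
    have l: "(d - c) powr (2 * \<beta>) = l * l" unfolding l_def by (simp flip: powr_add)
    have close: "\<bar>X s - X t\<bar> \<le> C * l" if "s \<in> {c..d}" "t \<in> {c..d}" for s t
    proof -
      have "\<bar>X s - X t\<bar> \<le> C * \<bar>s - t\<bar> powr \<beta>" using that * by (intro C(2)) auto
      also have "\<dots> \<le> C * l" unfolding l_def using that C(1) assms(2) by (intro mult_left_mono powr_mono2) auto
      finally show ?thesis .
    qed
    have cont: "continuous_on {c..d} \<phi>" "continuous_on {c..d} X"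
      using * by (auto intro: continuous_on_subset[OF \<phi>] continuous_on_subset[OF Xc])
    have v: "v d - v c = 2 * (X d - X c - integral {c..d} \<phi>)"
      using X[of d] X[of c] integral_increment[OF \<phi>, of c d] * by (simp add: field_simps)
    have Jd: "J d - J c = (X d)\<^sup>2 - (X c)\<^sup>2 - integral {c..d} (\<lambda>r. 2 * X r * \<phi> r)"
      using integral_increment[of T "\<lambda>r. 2 * X r * \<phi> r" c d] * unfolding J_def
      by (simp add: continuous_on_mult Xc \<phi>)
    have "integral {c..d} (\<lambda>r. 2 * (X r - X \<xi>) * \<phi> r)
        = integral {c..d} (\<lambda>r. 2 * X r * \<phi> r - 2 * X \<xi> * \<phi> r)" by (simp add: algebra_simps)
    also have "\<dots> = integral {c..d} (\<lambda>r. 2 * X r * \<phi> r) - 2 * X \<xi> * integral {c..d} \<phi>"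
      by (intro integral_diff_mult continuous_intros cont)
    finally have eq: "X \<xi> * (v d - v c) - (J d - J c)
        = (2 * X \<xi> - X c - X d) * (X d - X c) + integral {c..d} (\<lambda>r. 2 * (X r - X \<xi>) * \<phi> r)"
      unfolding v Jd by (simp add: algebra_simps power2_eq_square)
    have "\<bar>(2 * X \<xi> - X c - X d) * (X d - X c)\<bar> \<le> (2 * (C * l)) * (C * l)"
      unfolding abs_mult using close[of \<xi> c] close[of \<xi> d] close[of d c] *
      by (intro mult_mono) (auto simp: abs_le_iff)
    moreover have "\<bar>integral {c..d} (\<lambda>r. 2 * (X r - X \<xi>) * \<phi> r)\<bar> \<le> 2 * (C * l) * K * (d - c)"
    proof -
      have "norm (2 * (X r - X \<xi>) * \<phi> r) \<le> 2 * (C * l) * K" if "r \<in> {c..d}" for r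
        unfolding real_norm_def abs_mult using close[of r \<xi>] K(2)[of r] that * by (intro mult_mono) auto
      then show ?thesis using integral_bound[of c d "\<lambda>r. 2 * (X r - X \<xi>) * \<phi> r"] * cont
        by (simp add: continuous_on_mult continuous_on_diff)
    qed
    moreover have "2 * (C * l) * K * (d - c) \<le> 2 * (C * l) * K * (T powr (1 - \<beta>) * l)"
      unfolding l_def using * C(1) K(1) assms(3) by (intro mult_left_mono le_powr_of_le) auto
    ultimately have "\<bar>X \<xi> * (v d - v c) - (J d - J c)\<bar> \<le> 2 * (C * l) * (C * l) + 2 * (C * l) * K * (T powr (1 - \<beta>) * l)"
      unfolding eq by linarith
    also have "\<dots> = M * (d - c) powr (2 * \<beta>)" unfolding M_def l by (simp add: algebra_simps)
    finally show "\<bar>X \<xi> * (v d - v c) - (J d - J c)\<bar> \<le> M * (d - c) powr (2 * \<beta>)" .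
  qed (use assms C K in \<open>auto simp: M_def\<close>)
  then show ?thesis by (simp add: J_def algebra_simps)
qed

text \<open>
  The Young-Loeve estimate makes \<open>U - \<integral>\<psi>/(2U) - v/2\<close> Hoelder of exponent \<open>2\<beta> > 1\<close>, hence constant.
\<close>

lemma young_chain_rule_sqrt:
  fixes U v \<psi> I :: "real \<Rightarrow> real"
  assumes "0 \<le> T" "1 / 2 < \<beta>" "\<beta> \<le> 1" and hU: "holder_on \<beta> {0..T} U" and hv: "holder_on \<beta> {0..T} v"
    and \<psi>: "continuous_on {0..T} \<psi>" and a: "0 < a" "\<And>t. t \<in> {0..T} \<Longrightarrow> a \<le> U t"
    and I: "\<And>t. t \<in> {0..T} \<Longrightarrow> has_RS_integral U v 0 t (I t)"
    and eq: "\<And>t. t \<in> {0..T} \<Longrightarrow> (U t)\<^sup>2 = y + integral {0..t} \<psi> + I t"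
  shows "U T = U 0 + integral {0..T} (\<lambda>r. \<psi> r / (2 * U r)) + (v T - v 0) / 2"
proof -
  obtain C where C: "0 < C" "\<And>s t. s \<in> {0..T} \<Longrightarrow> t \<in> {0..T} \<Longrightarrow> \<bar>U t - U s\<bar> \<le> C * \<bar>t - s\<bar> powr \<beta>"
    using holder_onE[OF hU] by blast
  obtain E where E: "0 < E" "\<And>s t. s \<in> {0..T} \<Longrightarrow> t \<in> {0..T} \<Longrightarrow> \<bar>v t - v s\<bar> \<le> E * \<bar>t - s\<bar> powr \<beta>"
    using holder_onE[OF hv] by blast
  obtain K where K: "0 < K" "\<And>t. t \<in> {0..T} \<Longrightarrow> \<bar>\<psi> t\<bar> \<le> K"
    using continuous_on_interval_bound[OF \<psi>] by blast
  have Uc: "continuous_on {0..T} U" using holder_on_continuous[OF hU] assms(2) by simp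
  have U0: "U t \<noteq> 0" if "t \<in> {0..T}" for t using a that by force
  have qc: "continuous_on {0..T} (\<lambda>r. \<psi> r / (2 * U r))" using U0 by (intro continuous_intros \<psi> Uc) auto
  define A where "A = C * E / (1 - 2 powr (1 - 2 * \<beta>))"
  have YL: "\<bar>I d - I c - U c * (v d - v c)\<bar> \<le> A * (d - c) powr (2 * \<beta>)" if "0 \<le> c" "c \<le> d" "d \<le> T" for c d
    unfolding A_def
  proof (rule young_loeve[where T = T])
    fix r s t assume *: "0 \<le> r" "r \<le> s" "s \<le> t" "t \<le> T"
    have "\<bar>U s - U r\<bar> \<le> C * \<bar>s - r\<bar> powr \<beta>" using * by (intro C(2)) auto
    also have "\<dots> \<le> C * (t - r) powr \<beta>" using * C(1) assms(2) by (intro mult_left_mono powr_mono2) auto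
    finally have 1: "\<bar>U s - U r\<bar> \<le> C * (t - r) powr \<beta>" .
    have "\<bar>v t - v s\<bar> \<le> E * \<bar>t - s\<bar> powr \<beta>" using * by (intro E(2)) auto
    also have "\<dots> \<le> E * (t - r) powr \<beta>" using * E(1) assms(2) by (intro mult_left_mono powr_mono2) auto
    finally have "\<bar>(U s - U r) * (v t - v s)\<bar> \<le> (C * (t - r) powr \<beta>) * (E * (t - r) powr \<beta>)"
      unfolding abs_mult using 1 C(1) by (intro mult_mono) auto
    also have "\<dots> = C * E * (t - r) powr (2 * \<beta>)" using powr_add[of "t - r" \<beta> \<beta>] by simp
    finally show "\<bar>(U s - U r) * (v t - v s)\<bar> \<le> C * E * (t - r) powr (2 * \<beta>)" .
  qed (use assms(2) C(1) E(1) that I in auto)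
  define J where "J = (\<lambda>t. U t - integral {0..t} (\<lambda>r. \<psi> r / (2 * U r)) - v t / 2)"
  \<comment> \<open>The three summands bound the drift error, the Young-Loeve remainder and the
    square of the increment of \<open>U\<close>; the denominator comes from dividing by
    \<open>2 * U c \<ge> 2 * a\<close>.\<close>
  define M where "M = (K * C / a * T powr (1 - \<beta>) + A + C * C) / (2 * a)"
  have "0 \<le> A"
  proof -
    have "2 powr (1 - 2 * \<beta>) < 2 powr 0" using assms(2) by (intro powr_less_mono) auto
    then show ?thesis using C(1) E(1) by (simp add: A_def)
  qed
  have "J T = J 0"
  proof (rule constant_of_powr_increments[of 0 T "2 * \<beta>" M])
    show "0 \<le> M" using \<open>0 \<le> A\<close> C(1) K(1) a(1) by (simp add: M_def)
    fix c d assume *: "0 \<le> c" "c \<le> d" "d \<le> T"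
    define l where "l = (d - c) powr \<beta>"
    have l: "(d - c) powr (2 * \<beta>) = l * l" unfolding l_def by (simp flip: powr_add)
    have sub: "{c..d} \<subseteq> {0..T}" using * by auto
    have cont: "continuous_on {c..d} \<psi>" "continuous_on {c..d} U" "continuous_on {c..d} (\<lambda>r. \<psi> r / (2 * U r))"
      using sub by (auto intro: continuous_on_subset[OF \<psi>] continuous_on_subset[OF Uc] continuous_on_subset[OF qc])
    have Udiff: "\<bar>U r - U c\<bar> \<le> C * l" if "r \<in> {c..d}" for r
    proof -
      have "\<bar>U r - U c\<bar> \<le> C * \<bar>r - c\<bar> powr \<beta>" using that * by (intro C(2)) auto
      also have "\<dots> \<le> C * l" unfolding l_def using that C(1) assms(2) by (intro mult_left_mono powr_mono2) auto
      finally show ?thesis .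
    qed
    define R where "R = I d - I c - U c * (v d - v c)"
    have R: "\<bar>R\<bar> \<le> A * (l * l)" using YL[OF *] l by (simp add: R_def)
    have sq: "(U d)\<^sup>2 - (U c)\<^sup>2 = integral {c..d} \<psi> + R + U c * (v d - v c)"
      using eq[of d] eq[of c] integral_increment[OF \<psi> *] * by (simp add: R_def)
    have Jd: "J d - J c = U d - U c - integral {c..d} (\<lambda>r. \<psi> r / (2 * U r)) - (v d / 2 - v c / 2)"
      using integral_increment[OF qc *] by (simp add: J_def field_simps)
    have "integral {c..d} (\<lambda>r. \<psi> r * (U r - U c) / U r) = integral {c..d} (\<lambda>r. \<psi> r - 2 * U c * (\<psi> r / (2 * U r)))"
      using U0 sub by (intro integral_cong) (auto simp: field_simps)
    also have "\<dots> = integral {c..d} \<psi> - 2 * U c * integral {c..d} (\<lambda>r. \<psi> r / (2 * U r))"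
      by (intro integral_diff_mult cont)
    \<comment> \<open>This rests on \<open>(U d)\<^sup>2 - (U c)\<^sup>2 = 2 * U c * (U d - U c) +
      (U d - U c)\<^sup>2\<close>: the terms of first order cancel and only errors of order
      \<open>2 * \<beta>\<close> remain.\<close>
    finally have 1: "2 * U c * (J d - J c) = integral {c..d} (\<lambda>r. \<psi> r * (U r - U c) / U r) + R - (U d - U c)\<^sup>2"
      using sq unfolding Jd by (simp add: algebra_simps power2_eq_square)
    have 2: "\<bar>integral {c..d} (\<lambda>r. \<psi> r * (U r - U c) / U r)\<bar> \<le> K * (C * l) / a * (d - c)"
    proof -
      have "norm (\<psi> r * (U r - U c) / U r) \<le> K * (C * l) / a" if r: "r \<in> {c..d}" for r
      proof -
        have "r \<in> {0..T}" using sub r by blast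
        then show ?thesis
          unfolding real_norm_def abs_divide abs_mult using Udiff[OF r] K a(2)[of r] a(1) C(1)
          by (intro frac_le mult_mono mult_nonneg_nonneg) (auto simp: l_def)
      qed
      moreover have "continuous_on {c..d} (\<lambda>r. \<psi> r * (U r - U c) / U r)"
        using U0 sub by (intro continuous_intros cont) auto
      ultimately have "norm (integral {c..d} (\<lambda>r. \<psi> r * (U r - U c) / U r)) \<le> K * (C * l) / a * (d - c)"
        using * by (intro integral_bound) auto
      then show ?thesis by simp
    qed
    have "K * (C * l) / a * (d - c) \<le> K * (C * l) / a * (T powr (1 - \<beta>) * l)"
      unfolding l_def using * C(1) K(1) a(1) assms(3) by (intro mult_left_mono le_powr_of_le) auto
    moreover have "(U d - U c)\<^sup>2 \<le> (C * l) * (C * l)"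
      using mult_mono[OF Udiff[of d] Udiff[of d]] C(1) * by (simp add: power2_eq_square abs_mult_self_eq l_def)
    moreover have "0 \<le> (U d - U c)\<^sup>2" by simp
    ultimately have "\<bar>2 * U c * (J d - J c)\<bar> \<le> K * (C * l) / a * (T powr (1 - \<beta>) * l) + A * (l * l) + (C * l) * (C * l)"
      unfolding 1 using 2 R by linarith
    also have "\<dots> = 2 * a * (M * (l * l))" using a(1) by (simp add: M_def field_simps)
    finally have "2 * U c * \<bar>J d - J c\<bar> \<le> 2 * a * (M * (l * l))"
      using a(1) a(2)[of c] * by (simp add: abs_mult)
    moreover have "2 * a * \<bar>J d - J c\<bar> \<le> 2 * U c * \<bar>J d - J c\<bar>"
      using a(2)[of c] * by (intro mult_right_mono) auto
    ultimately have "2 * a * \<bar>J d - J c\<bar> \<le> 2 * a * (M * (l * l))" by linarith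
    then show "\<bar>J d - J c\<bar> \<le> M * (d - c) powr (2 * \<beta>)" unfolding l using a(1) by simp
  qed (use assms in auto)
  then show ?thesis by (simp add: J_def diff_divide_distrib)
qed

section \<open>The singular stochastic equation\<close>

context singular_drift
begin

lemma Fc_path_continuous:
  "0 < a \<Longrightarrow> a \<le> 1 \<Longrightarrow> continuous_on S X \<Longrightarrow> continuous_on S (\<lambda>r. Fc a r (X r))"
  by (intro one_sided_lipschitz_drift.D_comp[OF Fc_drift] continuous_intros)

text \<open>Two exponents occur: \<open>\<beta> > 1 / 2\<close> is needed for \<open>sol\<close> to
  solve the equation, whereas \<open>\<gamma>\<close> is any order of the noise and may be smaller.
  The drift part is Lipschitz and does not lower it.\<close>

lemma sol_holder:
  assumes sol: "0 < x0" "1 / 2 < \<beta>" "continuous_on UNIV b" "\<And>t. t \<le> 0 \<Longrightarrow> b t = 0"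
    "holder_on \<beta> {0..T} b"
    and "\<gamma> \<le> 1" and hold: "holder_on \<gamma> {0..T} b"
  shows "holder_on \<gamma> {0..T} (sol x0 b)"
proof -
  obtain a where a: "0 < a" "a \<le> 1" "solves x0 b T a (sol x0 b)" using sol_solves[OF sol] by blast
  obtain C where C: "0 < C" "\<And>s t. s \<in> {0..T} \<Longrightarrow> t \<in> {0..T} \<Longrightarrow> \<bar>b t - b s\<bar> \<le> C * \<bar>t - s\<bar> powr \<gamma>"
    using holder_onE[OF hold] by blast
  let ?\<phi> = "\<lambda>r. Fc a r (sol x0 b r)"
  have \<phi>: "continuous_on {0..T} ?\<phi>" using a by (intro Fc_path_continuous) (auto simp: solves_def)
  obtain K where K: "0 < K" "\<And>t. t \<in> {0..T} \<Longrightarrow> \<bar>?\<phi> t\<bar> \<le> K"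
    using continuous_on_interval_bound[OF \<phi>] by blast
  have le: "\<bar>sol x0 b t - sol x0 b s\<bar> \<le> (K * T powr (1 - \<gamma>) + C) * \<bar>t - s\<bar> powr \<gamma>"
    if st: "s \<in> {0..T}" "t \<in> {0..T}" "s \<le> t" for s t
  proof -
    have "\<bar>integral {s..t} ?\<phi>\<bar> \<le> K * (t - s)"
      using integral_bound[of s t ?\<phi> K] K(2) st continuous_on_subset[OF \<phi>, of "{s..t}"] by auto
    also have "\<dots> \<le> K * (T powr (1 - \<gamma>) * (t - s) powr \<gamma>)"
      using st K(1) \<open>\<gamma> \<le> 1\<close> by (intro mult_left_mono le_powr_of_le) auto
    finally have "\<bar>sol x0 b t - sol x0 b s\<bar> \<le> K * (T powr (1 - \<gamma>) * (t - s) powr \<gamma>) + C * (t - s) powr \<gamma>"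
      using solves_increment(1)[OF a, of s t] C(2)[of s t] st by auto
    then show ?thesis using st by (simp add: algebra_simps)
  qed
  have "\<bar>sol x0 b t - sol x0 b s\<bar> \<le> (K * T powr (1 - \<gamma>) + C) * \<bar>t - s\<bar> powr \<gamma>"
    if "s \<in> {0..T}" "t \<in> {0..T}" for s t
    using le[of s t] le[of t s] that by (cases "s \<le> t") (auto simp: abs_minus_commute)
  then show ?thesis unfolding holder_on_def by blast
qed

lemma two_x_F: "0 < x \<Longrightarrow> 2 * x * F t x = f t (x\<^sup>2)"
  by (simp add: F_def)

lemma sol_pos:
  assumes "0 < x0" "1 / 2 < \<beta>" "continuous_on UNIV b" "\<And>t. t \<le> 0 \<Longrightarrow> b t = 0"
    "holder_on \<beta> {0..t} b" "0 \<le> t"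
  shows "0 < sol x0 b t"
  using sol_solves[OF assms(1-5)] assms(6) by (metis atLeastAtMost_iff order_refl less_le_trans)

lemma sol_square_equation:
  assumes sol: "0 < x0" "1 / 2 < \<beta>" "continuous_on UNIV b" "\<And>t. t \<le> 0 \<Longrightarrow> b t = 0"
    "holder_on \<beta> {0..T} b" and "\<beta> \<le> 1" "0 \<le> T"
    and v: "\<And>t. t \<in> {0..T} \<Longrightarrow> b t = v t / 2"
  shows "\<exists>D I. ((\<lambda>s. f s ((sol x0 b s)\<^sup>2)) has_integral D) {0..T} \<and>
    has_RS_integral (\<lambda>s. sqrt ((sol x0 b s)\<^sup>2)) v 0 T I \<and> (sol x0 b T)\<^sup>2 = x0\<^sup>2 + D + I"
proof -
  let ?X = "sol x0 b"
  obtain a where a: "0 < a" "a \<le> 1" "solves x0 b T a ?X" "\<And>t. t \<in> {0..T} \<Longrightarrow> a \<le> ?X t \<and> ?X t \<le> 1 / a"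
    using sol_solves[OF sol] by blast
  have Xc: "continuous_on {0..T} ?X" using a(3) by (simp add: solves_def)
  let ?\<phi> = "\<lambda>r. Fc a r (?X r)"
  have \<phi>: "continuous_on {0..T} ?\<phi>" by (intro Fc_path_continuous a Xc)
  have pos: "0 < ?X t" if "t \<in> {0..T}" for t using a(1) a(4)[OF that] by linarith
  \<comment> \<open>On the range of the solution the truncation is invisible, and
    \<open>2 * x\<close> cancels the denominator of the square-root drift.\<close>
  have f\<phi>: "2 * ?X r * ?\<phi> r = f r ((?X r)\<^sup>2)" if "r \<in> {0..T}" for r
    using a(4)[OF that] that pos[OF that] by (simp add: Fc_eq_F two_x_F)
  have "has_RS_integral ?X v 0 T ((?X T)\<^sup>2 - (?X 0)\<^sup>2 - integral {0..T} (\<lambda>r. 2 * ?X r * ?\<phi> r))"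
    by (rule young_integral_of_path[OF \<open>0 \<le> T\<close> sol(2) \<open>\<beta> \<le> 1\<close> sol_holder[OF sol \<open>\<beta> \<le> 1\<close> sol(5)] \<phi>])
      (use a(3) v in \<open>auto simp: solves_def\<close>)
  then have RS: "has_RS_integral (\<lambda>s. sqrt ((?X s)\<^sup>2)) v 0 T
      ((?X T)\<^sup>2 - (?X 0)\<^sup>2 - integral {0..T} (\<lambda>r. 2 * ?X r * ?\<phi> r))"
    by (rule has_RS_integral_cong) (use pos in \<open>auto simp: less_imp_le\<close>)
  have "((\<lambda>r. 2 * ?X r * ?\<phi> r) has_integral integral {0..T} (\<lambda>r. 2 * ?X r * ?\<phi> r)) {0..T}"
    by (intro integrable_integral integrable_continuous_interval continuous_intros Xc \<phi>)
  then have D: "((\<lambda>s. f s ((?X s)\<^sup>2)) has_integral integral {0..T} (\<lambda>r. 2 * ?X r * ?\<phi> r)) {0..T}"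
    by (rule has_integral_eq[rotated]) (use f\<phi> in auto)
  have "?X 0 = x0" using a(3) \<open>0 \<le> T\<close> sol(4)[of 0] by (auto simp: solves_def)
  then show ?thesis using D RS by (intro exI conjI) auto
qed

text \<open>Any positive solution is carried back to the additive equation by the chain rule for the
  square root, where uniqueness is already known. The positive minimum of \<open>Z\<close> on
  \<open>{0..T}\<close> makes this possible.\<close>

lemma solution_is_sol_square:
  assumes "0 < y0" and sol: "1 / 2 < \<beta>" "continuous_on UNIV b" "\<And>t. t \<le> 0 \<Longrightarrow> b t = 0"
    "holder_on \<beta> {0..T} b" and "\<beta> \<le> 1" "0 \<le> T"
    and v: "\<And>t. t \<in> {0..T} \<Longrightarrow> b t = v t / 2"
    and Zpos: "\<And>t. t \<in> {0..T} \<Longrightarrow> 0 < Z t" and Zh: "holder_on \<beta> {0..T} Z"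
    and Zeq: "\<And>t. t \<in> {0..T} \<Longrightarrow> \<exists>D I. ((\<lambda>s. f s (Z s)) has_integral D) {0..t} \<and>
      has_RS_integral (\<lambda>s. sqrt (Z s)) v 0 t I \<and> Z t = y0 + D + I"
  shows "Z T = (sol (sqrt y0) b T)\<^sup>2"
proof -
  let ?U = "\<lambda>s. sqrt (Z s)"
  have Zc: "continuous_on {0..T} Z" using holder_on_continuous[OF Zh] sol(1) by simp
  obtain s where s: "s \<in> {0..T}" "\<And>t. t \<in> {0..T} \<Longrightarrow> Z s \<le> Z t"
    using continuous_attains_inf[OF compact_Icc _ Zc] \<open>0 \<le> T\<close> by auto
  define a where "a = sqrt (Z s)"
  have a: "0 < a" "\<And>t. t \<in> {0..T} \<Longrightarrow> a \<le> ?U t" using s Zpos[OF s(1)] by (auto simp: a_def)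
  obtain C where C: "0 < C" "\<And>s t. s \<in> {0..T} \<Longrightarrow> t \<in> {0..T} \<Longrightarrow> \<bar>Z t - Z s\<bar> \<le> C * \<bar>t - s\<bar> powr \<beta>"
    using holder_onE[OF Zh] by blast
  \<comment> \<open>The square root keeps the full exponent \<open>\<beta>\<close> because
    \<open>Z\<close> stays away from 0: the difference of roots is divided by a sum that is at least
    \<open>a\<close>.\<close>
  have Uh: "holder_on \<beta> {0..T} ?U" unfolding holder_on_def
  proof (intro exI ballI)
    fix s t assume st: "s \<in> {0..T}" "t \<in> {0..T}"
    have "\<bar>?U t - ?U s\<bar> * a \<le> \<bar>?U t - ?U s\<bar> * (?U t + ?U s)"
      using a(1) a(2)[OF st(1)] a(2)[OF st(2)] by (intro mult_left_mono) auto
    also have "\<dots> = \<bar>(?U t - ?U s) * (?U t + ?U s)\<bar>"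
      using a(1) a(2)[OF st(1)] a(2)[OF st(2)] by (simp add: abs_mult)
    also have "(?U t - ?U s) * (?U t + ?U s) = Z t - Z s"
      using Zpos[OF st(1)] Zpos[OF st(2)] by (simp add: algebra_simps)
    also have "\<bar>Z t - Z s\<bar> \<le> C * \<bar>t - s\<bar> powr \<beta>" by (rule C(2)[OF st])
    finally show "\<bar>?U t - ?U s\<bar> \<le> (C / a) * \<bar>t - s\<bar> powr \<beta>" using a(1) by (simp add: field_simps)
  qed
  have vh: "holder_on \<beta> {0..T} v"
  proof -
    obtain E where E: "0 < E" "\<And>s t. s \<in> {0..T} \<Longrightarrow> t \<in> {0..T} \<Longrightarrow> \<bar>b t - b s\<bar> \<le> E * \<bar>t - s\<bar> powr \<beta>"
      using holder_onE[OF sol(4)] by blast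
    have "\<bar>v t - v s\<bar> \<le> 2 * E * \<bar>t - s\<bar> powr \<beta>" if "s \<in> {0..T}" "t \<in> {0..T}" for s t
      using E(2)[OF that] v[OF that(1)] v[OF that(2)] by (simp add: field_simps flip: diff_divide_distrib)
    then show ?thesis unfolding holder_on_def by blast
  qed
  have fc: "continuous_on {0..T} (\<lambda>s. f s (Z s))"
    by (intro f_comp continuous_intros Zc) (use Zpos in auto)
  have "\<forall>t\<in>{0..T}. \<exists>I. has_RS_integral ?U v 0 t I \<and> Z t = y0 + integral {0..t} (\<lambda>s. f s (Z s)) + I"
    using Zeq by (metis integral_unique)
  then obtain I where I: "\<And>t. t \<in> {0..T} \<Longrightarrow> has_RS_integral ?U v 0 t (I t)"
    "\<And>t. t \<in> {0..T} \<Longrightarrow> Z t = y0 + integral {0..t} (\<lambda>s. f s (Z s)) + I t" by metis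
  \<comment> \<open>The initial value is part of the equation at time 0, where both integrals run
    over a single point.\<close>
  have "Z 0 = y0" using I[of 0] has_RS_integral_degenerate[of ?U v 0 "I 0"] \<open>0 \<le> T\<close> by auto
  have "v 0 = 0" using v[of 0] sol(3)[of 0] \<open>0 \<le> T\<close> by simp
  have Ueq: "?U t = sqrt y0 + integral {0..t} (\<lambda>r. F r (?U r)) + b t" if t: "t \<in> {0..T}" for t
  proof -
    have sub: "{0..t} \<subseteq> {0..T}" using t by auto
    have "?U t = ?U 0 + integral {0..t} (\<lambda>r. f r (Z r) / (2 * ?U r)) + (v t - v 0) / 2"
    proof (rule young_chain_rule_sqrt[where I = I and y = y0])
      show "holder_on \<beta> {0..t} ?U" "holder_on \<beta> {0..t} v"
        using Uh vh sub by (auto intro: holder_on_mono)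
      show "(?U r)\<^sup>2 = y0 + integral {0..r} (\<lambda>s. f s (Z s)) + I r" if "r \<in> {0..t}" for r
        using I(2)[of r] Zpos[of r] that sub by auto
    qed (use a I t sub sol \<open>\<beta> \<le> 1\<close> in \<open>auto intro: continuous_on_subset[OF fc]\<close>)
    also have "integral {0..t} (\<lambda>r. f r (Z r) / (2 * ?U r)) = integral {0..t} (\<lambda>r. F r (?U r))"
      using Zpos sub by (intro integral_cong) (auto simp: F_def less_imp_le)
    finally show ?thesis using \<open>Z 0 = y0\<close> \<open>v 0 = 0\<close> v[OF t] by simp
  qed
  have "?U T = sol (sqrt y0) b T"
  proof (rule sol_unique[OF _ sol])
    show "continuous_on {0..T} ?U" by (intro continuous_intros Zc)
    show "0 < ?U t" if "t \<in> {0..T}" for t using Zpos[OF that] by simp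
    show "?U t = sqrt y0 + integral {0..t} (\<lambda>r. F r (?U r)) + b t" if "t \<in> {0..T}" for t by (rule Ueq[OF that])
  qed (use \<open>0 < y0\<close> \<open>0 \<le> T\<close> in auto)
  then have "(?U T)\<^sup>2 = (sol (sqrt y0) b T)\<^sup>2" by simp
  then show ?thesis using Zpos[of T] \<open>0 \<le> T\<close> by simp
qed

end

lemma power_add_le: "0 \<le> a \<Longrightarrow> 0 \<le> b \<Longrightarrow> (a + b) ^ n \<le> 2 ^ n * (a ^ n + b ^ n)" for a b :: real
proof -
  assume ab: "0 \<le> a" "0 \<le> b"
  have "(a + b) ^ n \<le> (2 * max a b) ^ n" using ab by (intro power_mono) auto
  also have "\<dots> = 2 ^ n * max a b ^ n" by (rule power_mult_distrib)
  also have "max a b ^ n \<le> a ^ n + b ^ n" using ab by (auto simp: max_def)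
  finally show ?thesis by simp
qed

theorem mainTheorem3:
  fixes M :: "'a measure" and B :: "real \<Rightarrow> 'a \<Rightarrow> real" and H y0 x1 :: real
    and f :: "real \<Rightarrow> real \<Rightarrow> real" and g h :: "real \<Rightarrow> real"
  assumes "prob_space M"
    and "1 / 2 < H" and "H < 1"
    and "fractional_brownian_motion M H B"
    and "0 < y0"
    and f_nonneg: "\<And>t x. 0 \<le> t \<Longrightarrow> 0 < x \<Longrightarrow> 0 \<le> f t x"
    and f_cont: "continuous_on ({0..} \<times> {0<..}) (\<lambda>(t, x). f t x)"
    and f_diff: "\<And>t x. 0 \<le> t \<Longrightarrow> 0 < x \<Longrightarrow> f t field_differentiable at x"
    and "0 < x1"
    and g_cont: "continuous_on {0..} g"
    and g_pos: "\<And>t. 0 < t \<Longrightarrow> 0 < g t"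
    and f_ge_g: "\<And>t x. 0 < t \<Longrightarrow> 0 < x \<Longrightarrow> x < x1 \<Longrightarrow> g t \<le> f t x"
    and f_ge_deriv: "\<And>t x. 0 < t \<Longrightarrow> 0 < x \<Longrightarrow> x * deriv (f t) x \<le> f t x"
    and h_nonneg: "\<And>t. 0 \<le> t \<Longrightarrow> 0 \<le> h t"
    and h_bounded: "\<And>T. 0 \<le> T \<Longrightarrow> bounded (h ` {0..T})"
    and f_le_h: "\<And>t x. 0 \<le> t \<Longrightarrow> 0 < x \<Longrightarrow> f t x \<le> h t * (x + 1)"
  shows "\<exists>Y. positive_solution M H B f y0 Y \<and>
           (\<forall>Z. positive_solution M H B f y0 Z \<longrightarrow>
              (AE \<omega> in M. \<forall>t\<ge>0. Z t \<omega> = Y t \<omega>)) \<and>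
           (\<forall>t\<ge>0. \<forall>p>0. integrable M (\<lambda>\<omega>. Y t \<omega> powr p))"
proof -
  interpret prob_space M by fact
  interpret singular_drift f g h x1 by standard (fact assms)+
  note B = \<open>fractional_brownian_motion M H B\<close>
  have "0 < H" using \<open>1 / 2 < H\<close> by simp
  \<comment> \<open>The midpoint of \<open>1 / 2\<close> and \<open>H\<close>: above the Young
    threshold, yet below the regularity of the noise.\<close>
  define \<beta> where "\<beta> = (1 / 2 + H) / 2"
  have \<beta>: "1 / 2 < \<beta>" "\<beta> < H" "\<beta> \<le> 1" "0 < \<beta>" using \<open>1 / 2 < H\<close> \<open>H < 1\<close> by (auto simp: \<beta>_def)
  define x0 where "x0 = sqrt y0"
  have x0: "0 < x0" "x0\<^sup>2 = y0" using \<open>0 < y0\<close> by (auto simp: x0_def)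
  obtain N where N': "{\<omega> \<in> space M. \<not> (B 0 \<omega> = 0 \<and>
      (\<forall>T \<beta>. 0 < \<beta> \<and> \<beta> < H \<longrightarrow> holder_on \<beta> {0..T} (\<lambda>t. B t \<omega>)))} \<subseteq> N"
      "emeasure M N = 0" "N \<in> sets M"
    by (rule AE_E[OF fbm_holder_all[OF B \<open>0 < H\<close>]])
  then have N: "N \<in> null_sets M" by (intro null_setsI)
  define G where "G = space M - N"
  have G_sets[measurable]: "G \<in> sets M" using N'(3) by (auto simp: G_def)
  have G_AE: "AE \<omega> in M. \<omega> \<in> G" using AE_not_in[OF N] AE_space by eventually_elim (auto simp: G_def)
  have G: "\<omega> \<in> space M" "B 0 \<omega> = 0" "\<And>T \<beta>. 0 < \<beta> \<Longrightarrow> \<beta> < H \<Longrightarrow> holder_on \<beta> {0..T} (\<lambda>t. B t \<omega>)"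
    if "\<omega> \<in> G" for \<omega> using that N'(1) by (auto simp: G_def)
  \<comment> \<open>A positive solution must be positive and Hoelder for every
    \<open>\<omega>\<close>, not only almost surely, so the noise is replaced by 0 off the
    measurable full-measure set \<open>G\<close>. The factor 1/2 comes from the square root, and
    \<open>max 0 t\<close> extends the path to negative times.\<close>
  define b where "b = (\<lambda>\<omega> t. if \<omega> \<in> G then B (max 0 t) \<omega> / 2 else 0)"
  have b_meas: "(\<lambda>\<omega>. b \<omega> t) \<in> borel_measurable M" for t
  proof -
    have [measurable]: "B (max 0 t) \<in> borel_measurable M"
      using fbm_gaussian(1)[OF B, of "max 0 t"] by (simp add: gaussian_rv_def)
    show ?thesis unfolding b_def by measurable
  qed
  have b_cont: "continuous_on UNIV (b \<omega>)" for \<omega>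
  proof (cases "\<omega> \<in> G")
    case True
    then have "continuous_on {0..} (\<lambda>t. B t \<omega>)"
      using B G(1) unfolding fractional_brownian_motion_def by blast
    then show ?thesis unfolding b_def using True
      by (auto intro!: continuous_intros continuous_on_compose2[of "{0..}" "\<lambda>t. B t \<omega>"])
  qed (simp add: b_def)
  have b_start: "b \<omega> t = 0" if "t \<le> 0" for \<omega> t using that G(2) by (simp add: b_def max_def)
  have b_holder: "holder_on \<gamma> {0..T} (b \<omega>)" if \<gamma>: "0 < \<gamma>" "\<gamma> < H" for \<omega> \<gamma> T
  proof (cases "\<omega> \<in> G")
    case True
    obtain C where C: "\<And>s t. s \<in> {0..T} \<Longrightarrow> t \<in> {0..T} \<Longrightarrow> \<bar>B t \<omega> - B s \<omega>\<bar> \<le> C * \<bar>t - s\<bar> powr \<gamma>"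
      using holder_onE[OF G(3)[OF True \<gamma>]] by blast
    show ?thesis unfolding holder_on_def
    proof (intro exI ballI)
      fix s t assume st: "s \<in> {0..T}" "t \<in> {0..T}"
      then show "\<bar>b \<omega> t - b \<omega> s\<bar> \<le> (C / 2) * \<bar>t - s\<bar> powr \<gamma>"
        using C[OF st] True by (simp add: b_def max_def flip: diff_divide_distrib)
    qed
  qed (auto simp: b_def holder_on_def intro: exI[of _ 0])
  note path = x0(1) \<beta>(1) b_cont b_start b_holder[OF \<beta>(4,2)]
  define Y where "Y = (\<lambda>t \<omega>. (sol x0 (b \<omega>) t)\<^sup>2)"
  have sol_meas[measurable]: "(\<lambda>\<omega>. sol x0 (b \<omega>) t) \<in> borel_measurable M" for t
    by (rule sol_measurable[OF b_meas b_cont b_start])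
  have pos: "0 < sol x0 (b \<omega>) t" if "0 \<le> t" for \<omega> t by (rule sol_pos[OF path that])
  have bB: "b \<omega> t = B t \<omega> / 2" if "\<omega> \<in> G" "t \<in> {0..T}" for \<omega> t T
    using that by (simp add: b_def max_def)
  have Y_sol: "positive_solution M H B f y0 Y"
    unfolding positive_solution_def
  proof (intro conjI allI ballI impI)
    show "Y t \<in> borel_measurable M" for t unfolding Y_def by measurable
    show "0 < Y t \<omega>" if "0 \<le> t" for t \<omega> using pos[OF that, of \<omega>] by (simp add: Y_def)
    show "holder_on \<gamma> {0..T} (\<lambda>t. Y t \<omega>)" if "0 < \<gamma> \<and> \<gamma> < H" for \<omega> \<gamma> T
    proof -
      have h: "holder_on \<gamma> {0..T} (sol x0 (b \<omega>))"
        using that \<open>H < 1\<close> by (intro sol_holder[OF path] b_holder) auto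
      then show ?thesis unfolding Y_def
        using that by (intro holder_on_square holder_on_continuous[OF h]) auto
    qed
    show "AE \<omega> in M. \<forall>t\<ge>0. \<exists>D I. ((\<lambda>s. f s (Y s \<omega>)) has_integral D) {0..t} \<and>
        has_RS_integral (\<lambda>s. sqrt (Y s \<omega>)) (\<lambda>s. B s \<omega>) 0 t I \<and> Y t \<omega> = y0 + D + I"
      using G_AE
    proof eventually_elim
      fix \<omega> assume "\<omega> \<in> G"
      show "\<forall>t\<ge>0. \<exists>D I. ((\<lambda>s. f s (Y s \<omega>)) has_integral D) {0..t} \<and>
        has_RS_integral (\<lambda>s. sqrt (Y s \<omega>)) (\<lambda>s. B s \<omega>) 0 t I \<and> Y t \<omega> = y0 + D + I"
        unfolding Y_def x0(2)[symmetric]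
        by (intro allI impI sol_square_equation[OF path \<beta>(3)] bB[OF \<open>\<omega> \<in> G\<close>])
    qed
  qed
  have unique: "AE \<omega> in M. \<forall>t\<ge>0. Z t \<omega> = Y t \<omega>" if Z: "positive_solution M H B f y0 Z" for Z
  proof -
    have Zpos: "\<And>\<omega> t. \<omega> \<in> space M \<Longrightarrow> 0 \<le> t \<Longrightarrow> 0 < Z t \<omega>"
      and Zh: "\<And>\<omega> t. \<omega> \<in> space M \<Longrightarrow> 0 \<le> t \<Longrightarrow> holder_on \<beta> {0..t} (\<lambda>s. Z s \<omega>)"
      and Zeq: "AE \<omega> in M. \<forall>t\<ge>0. \<exists>D I. ((\<lambda>s. f s (Z s \<omega>)) has_integral D) {0..t} \<and>
        has_RS_integral (\<lambda>s. sqrt (Z s \<omega>)) (\<lambda>s. B s \<omega>) 0 t I \<and> Z t \<omega> = y0 + D + I"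
      using Z \<beta> unfolding positive_solution_def by auto
    from Zeq G_AE show ?thesis
    proof eventually_elim
      fix \<omega> assume eq: "\<forall>t\<ge>0. \<exists>D I. ((\<lambda>s. f s (Z s \<omega>)) has_integral D) {0..t} \<and>
        has_RS_integral (\<lambda>s. sqrt (Z s \<omega>)) (\<lambda>s. B s \<omega>) 0 t I \<and> Z t \<omega> = y0 + D + I" and \<omega>: "\<omega> \<in> G"
      show "\<forall>t\<ge>0. Z t \<omega> = Y t \<omega>"
      proof (intro allI impI)
        fix t :: real assume "0 \<le> t"
        show "Z t \<omega> = Y t \<omega>" unfolding Y_def x0_def
          by (rule solution_is_sol_square[where v = "\<lambda>s. B s \<omega>",
                OF \<open>0 < y0\<close> path(2-5) \<beta>(3) \<open>0 \<le> t\<close> bB[OF \<omega>] _ Zh[OF G(1)[OF \<omega>] \<open>0 \<le> t\<close>]])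
            (use eq Zpos G(1)[OF \<omega>] in auto)
      qed
    qed
  qed
  have moments: "integrable M (\<lambda>\<omega>. Y t \<omega> powr p)" if "0 \<le> t" "0 < p" for t p
  proof -
    \<comment> \<open>Since \<open>Y t \<omega> powr p\<close> is the power \<open>2 * p\<close> of
      the square-root solution, any integer order \<open>n \<ge> m > 2 * p\<close> bounds it by 1
      plus the \<open>n\<close>-th power.\<close>
    obtain m where m: "2 * p < real m" using reals_Archimedean2 by blast
    \<comment> \<open>The Hoelder bound needs a positive horizon, and \<open>t\<close> may be
      0.\<close>
    have "0 < t + 1" using \<open>0 \<le> t\<close> by simp
    obtain n K where n: "m \<le> n" "0 < n" and K: "integrable M K" "AE \<omega> in M. 0 \<le> K \<omega> \<and>
      (\<forall>s\<in>{0..t + 1}. \<forall>r\<in>{0..t + 1}. \<bar>B r \<omega> - B s \<omega>\<bar> ^ n \<le> K \<omega> * (\<bar>r - s\<bar> powr \<beta>) ^ n)"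
      by (rule fbm_holder_bound[OF B \<open>0 < t + 1\<close> \<beta>(4,2)])
    obtain k where k: "0 < k" "\<And>s. s \<in> {0..t} \<Longrightarrow> h s \<le> k" using h_bound by blast
    define E where "E = exp (k * t)"
    define R where "R = (\<lambda>\<omega>. 1 + E ^ n * (2 ^ n * ((x0 + 1) ^ n + K \<omega> * ((t + 1) powr \<beta>) ^ n)))"
    show ?thesis
    proof (rule Bochner_Integration.integrable_bound)
      show "integrable M R" unfolding R_def using K(1) by auto
      show "(\<lambda>\<omega>. Y t \<omega> powr p) \<in> borel_measurable M" unfolding Y_def by measurable
      show "AE \<omega> in M. norm (Y t \<omega> powr p) \<le> norm (R \<omega>)"
        using K(2) G_AE
      proof eventually_elim
        fix \<omega> assume bound: "0 \<le> K \<omega> \<and> (\<forall>s\<in>{0..t + 1}. \<forall>r\<in>{0..t + 1}.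
            \<bar>B r \<omega> - B s \<omega>\<bar> ^ n \<le> K \<omega> * (\<bar>r - s\<bar> powr \<beta>) ^ n)" and \<omega>: "\<omega> \<in> G"
        let ?x = "sol x0 (b \<omega>) t"
        \<comment> \<open>\<open>S\<close> bounds \<open>B\<close> on \<open>{0..t}\<close>, because
          \<open>B 0 \<omega> = 0\<close> on \<open>G\<close>; its \<open>n\<close>-th power is a
          constant multiple of the integrable \<open>K \<omega>\<close>.\<close>
        define S where "S = root n (K \<omega>) * (t + 1) powr \<beta>"
        have S: "0 \<le> S" "S ^ n = K \<omega> * ((t + 1) powr \<beta>) ^ n"
          using bound n(2) by (auto simp: S_def power_mult_distrib)
        have "\<bar>b \<omega> s\<bar> \<le> S / 2" if s: "s \<in> {0..t}" for s
        proof -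
          have "\<bar>B s \<omega> - B 0 \<omega>\<bar> ^ n \<le> K \<omega> * (\<bar>s - 0\<bar> powr \<beta>) ^ n" using bound s \<open>0 \<le> t\<close> by force
          also have "\<dots> \<le> S ^ n" unfolding S(2) using s bound \<beta>
            by (intro mult_left_mono power_mono powr_mono2) auto
          finally have "\<bar>B s \<omega>\<bar> \<le> S" using S(1) n(2) G(2)[OF \<omega>] by (simp add: power_mono_iff)
          then show ?thesis using bB[OF \<omega> s] by simp
        qed
        then have "?x \<le> (x0 + 1 + 2 * (S / 2)) * exp (k * t)"
          using \<open>0 \<le> t\<close> by (intro sol_le[OF path k]) auto
        then have "?x \<le> E * (x0 + 1 + S)" by (simp add: E_def mult.commute)
        then have "?x ^ n \<le> (E * (x0 + 1 + S)) ^ n" using pos[OF \<open>0 \<le> t\<close>, of \<omega>] by (intro power_mono) auto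
        also have "\<dots> = E ^ n * (x0 + 1 + S) ^ n" by (rule power_mult_distrib)
        also have "\<dots> \<le> E ^ n * (2 ^ n * ((x0 + 1) ^ n + S ^ n))"
          using x0(1) S(1) by (intro mult_left_mono power_add_le) (auto simp: E_def)
        finally have xn: "1 + ?x ^ n \<le> R \<omega>" by (simp add: R_def S(2))
        have "Y t \<omega> powr p = ?x powr (2 * p)"
          using pos[OF \<open>0 \<le> t\<close>, of \<omega>] by (simp add: Y_def power2_eq_square powr_mult flip: powr_add)
        also have "\<dots> \<le> 1 + ?x ^ n"
        proof (cases "?x \<le> 1")
          case True
          have "?x powr (2 * p) \<le> 1" using pos[OF \<open>0 \<le> t\<close>, of \<omega>] True \<open>0 < p\<close> by (intro powr_le1) auto
          moreover have "0 \<le> ?x ^ n" using pos[OF \<open>0 \<le> t\<close>, of \<omega>] by simp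
          ultimately show ?thesis by linarith
        next
          case False
          then have "?x powr (2 * p) \<le> ?x powr real n" using m n by (intro powr_mono) auto
          also have "\<dots> = ?x ^ n" using pos[OF \<open>0 \<le> t\<close>, of \<omega>] by (simp add: powr_realpow)
          finally show ?thesis by simp
        qed
        finally show "norm (Y t \<omega> powr p) \<le> norm (R \<omega>)" using xn by simp
      qed
    qed
  qed
  show ?thesis using Y_sol unique moments by blast
qed

end
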